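(* Let $\lambda$ be Lebesgue measure on $\mathbb R^n$. Let $\phi:\mathbb R^n\to\mathbb R$ be nonnegative, $C^\infty$, with $\int\phi\,d\lambda=1$, $\operatorname{supp}\phi\subseteq\mathscr B(0,1)$ and $\phi(-y)=\phi(y)$, and set $\phi_{z,\epsilon}(y)=\epsilon^{-n}\phi((z-y)/\epsilon)$. Let $X\subset\mathbb R^n$ be a compact regular Lipschitz domain, and $d\mu=f\,d\lambda$ on $X$, where $f\in C^2(X)$, $0<m\le f\le M<\infty$ on $X$, and $f,1/f\in\mathscr H^s(X)$ for some $s>n/2$. Let $g=1/f$, $h_{x,\epsilon}=\phi_{x,\epsilon}/f$, $\Pi_d$ the $\mathscr L^2(\mu)$-orthogonal projection onto polynomials of degree $\le d$, and $$\widehat g_{d,\epsilon}(x):=\frac{\|\Pi_dh_{x,\epsilon}\|^2_{\mathscr L^2(\mu)}}{\|\phi_{x,\epsilon}\|^2_{\mathscr L^2(\lambda)}}.$$ Let $k$ be an integer with $1\le k\le s$ and $k>n/2$. Then for every compact $K\subset\operatorname{int}X$ there exist constants $A,B>0$ and $\epsilon_0>0$ such that for all $x\in K$, all $d\in\mathbb N$ and all $0<\epsilon<\epsilon_0$, $$|\widehat g_{d,\epsilon}(x)-g(x)|\le A(\epsilon d)^{-2k}+B\epsilon^2.$$ In particular, choosing $\epsilon=\epsilon_d=d^{-k/(k+1)}$ gives $|\widehat g_{d,\epsilon_d}(x)-g(x)|=O(d^{-2k/(k+1)})$ uniformly on compact subsets of $\operatorname{int}X$.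
   Context: $\mathscr B(x,r)$ is the Euclidean ball of radius $r$ at $x$. A regular Lipschitz domain is a compact set equal to the closure of its interior whose boundary is locally the graph of a Lipschitz function. $\mathscr H^s(X)$ is the $L^2$-Sobolev space of order $s$ on $X$. Note $\|\Pi_dh_{x,\epsilon}\|^2_{\mathscr L^2(\mu)}$ equals the diagonal $DMCD^\mu_{d,\epsilon}(x,x)$ of the density-estimator mollified Christoffel–Darboux kernel. *)

theory Defs
  imports "HOL-Analysis.Analysis"
begin

text \<open>Ck_on k U f: f is k times continuously (Frechet) differentiable on the open set U.
  Higher derivatives are expressed through directional derivatives of the derivative.\<close>
fun Ck_on :: "nat \<Rightarrow> 'a::real_normed_vector set \<Rightarrow> ('a \<Rightarrow> real) \<Rightarrow> bool" where
  "Ck_on 0 U f = continuous_on U f"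
| "Ck_on (Suc k) U f = (continuous_on U f \<and> (\<forall>x\<in>U. f differentiable (at x)) \<and>
      (\<forall>v. Ck_on k U (\<lambda>x. frechet_derivative f (at x) v)))"

definition smooth_fun :: "('a::real_normed_vector \<Rightarrow> real) \<Rightarrow> bool" where
  "smooth_fun f \<longleftrightarrow> (\<forall>k. Ck_on k UNIV f)"

definition Ck_set :: "nat \<Rightarrow> 'a::real_normed_vector set \<Rightarrow> ('a \<Rightarrow> real) \<Rightarrow> bool" where
  "Ck_set k X f \<longleftrightarrow> (\<exists>F U. open U \<and> X \<subseteq> U \<and> Ck_on k U F \<and> (\<forall>x\<in>X. F x = f x))"

definition fsupp :: "('a::real_normed_vector \<Rightarrow> real) \<Rightarrow> 'a set" where
  "fsupp f = closure {x. f x \<noteq> 0}"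

definition regular_lipschitz_domain :: "(real^'n) set \<Rightarrow> bool" where
  "regular_lipschitz_domain X \<longleftrightarrow> compact X \<and> X = closure (interior X) \<and>
     (\<forall>p\<in>frontier X. \<exists>e r L \<gamma>. norm e = 1 \<and> r > 0 \<and>
        L-lipschitz_on {v. v \<bullet> e = 0} \<gamma> \<and>
        X \<inter> ball p r = {y \<in> ball p r. y \<bullet> e \<le> \<gamma> (y - (y \<bullet> e) *\<^sub>R e)})"

definition partial_deriv :: "'n \<Rightarrow> (real^'n \<Rightarrow> real) \<Rightarrow> real^'n \<Rightarrow> real" where
  "partial_deriv i f x = frechet_derivative f (at x) (axis i 1)"

fun pderivs :: "'n list \<Rightarrow> (real^'n \<Rightarrow> real) \<Rightarrow> real^'n \<Rightarrow> real" where
  "pderivs [] f = f"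
| "pderivs (i # is) f = partial_deriv i (pderivs is f)"

definition test_fun :: "(real^'n) set \<Rightarrow> (real^'n \<Rightarrow> real) \<Rightarrow> bool" where
  "test_fun U \<psi> \<longleftrightarrow> smooth_fun \<psi> \<and> compact (fsupp \<psi>) \<and> fsupp \<psi> \<subseteq> U"

definition L2_on :: "(real^'n) set \<Rightarrow> (real^'n \<Rightarrow> real) \<Rightarrow> bool" where
  "L2_on X u \<longleftrightarrow> (\<lambda>x. indicator X x * u x) \<in> borel_measurable lebesgue \<and>
      integrable lebesgue (\<lambda>x. indicator X x * (u x)\<^sup>2)"

definition weak_deriv :: "(real^'n) set \<Rightarrow> 'n list \<Rightarrow> (real^'n \<Rightarrow> real) \<Rightarrow> (real^'n \<Rightarrow> real) \<Rightarrow> bool" where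
  "weak_deriv X \<alpha> u v \<longleftrightarrow> (\<forall>\<psi>. test_fun (interior X) \<psi> \<longrightarrow>
      (LINT x|lebesgue. indicator (interior X) x * u x * pderivs \<alpha> \<psi> x) =
      (-1) ^ length \<alpha> * (LINT x|lebesgue. indicator (interior X) x * v x * \<psi> x))"

definition sobolev_H :: "real \<Rightarrow> (real^'n) set \<Rightarrow> (real^'n \<Rightarrow> real) \<Rightarrow> bool" where
  "sobolev_H s X u \<longleftrightarrow> 0 \<le> s \<and> L2_on X u \<and>
     (let m = nat \<lfloor>s\<rfloor>; \<sigma> = s - real m in
      \<forall>\<alpha>::'n list. length \<alpha> \<le> m \<longrightarrow>
        (\<exists>v. weak_deriv X \<alpha> u v \<and> L2_on X v \<and>
           (\<sigma> > 0 \<and> length \<alpha> = m \<longrightarrow>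
              (\<integral>\<^sup>+x. \<integral>\<^sup>+y. ennreal (indicator X x * indicator X y *
                  ((v x - v y)\<^sup>2 / norm (x - y) powr (real CARD('n) + 2 * \<sigma>))) \<partial>lebesgue \<partial>lebesgue) < \<infinity>)))"

definition poly_fun :: "nat \<Rightarrow> (real^'n \<Rightarrow> real) \<Rightarrow> bool" where
  "poly_fun d p \<longleftrightarrow> (\<exists>c :: ('n \<Rightarrow> nat) \<Rightarrow> real.
      p = (\<lambda>x. \<Sum>e\<in>{e::'n \<Rightarrow> nat. sum e UNIV \<le> d}. c e * (\<Prod>i\<in>UNIV. (x $ i) ^ e i)))"

definition mu_meas :: "(real^'n) set \<Rightarrow> (real^'n \<Rightarrow> real) \<Rightarrow> (real^'n) measure" where
  "mu_meas X f = density lebesgue (\<lambda>y. ennreal (indicator X y * f y))"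

definition proj_norm2 :: "(real^'n) measure \<Rightarrow> nat \<Rightarrow> (real^'n \<Rightarrow> real) \<Rightarrow> real" where
  "proj_norm2 M d h = (let p = (SOME p. poly_fun d p \<and>
        (\<forall>q. poly_fun d q \<longrightarrow> (LINT y|M. (h y - p y) * q y) = 0))
     in LINT y|M. (p y)\<^sup>2)"

definition mollifier :: "(real^'n \<Rightarrow> real) \<Rightarrow> real^'n \<Rightarrow> real \<Rightarrow> real^'n \<Rightarrow> real" where
  "mollifier \<phi> z \<epsilon> y = \<epsilon> powr (- real CARD('n)) * \<phi> ((1 / \<epsilon>) *\<^sub>R (z - y))"

definition g_hat :: "(real^'n \<Rightarrow> real) \<Rightarrow> (real^'n) set \<Rightarrow> (real^'n \<Rightarrow> real) \<Rightarrow> nat \<Rightarrow> real \<Rightarrow> real^'n \<Rightarrow> real" where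
  "g_hat \<phi> X f d \<epsilon> x =
     proj_norm2 (mu_meas X f) d (\<lambda>y. mollifier \<phi> x \<epsilon> y / f y) /
     (LINT y|lebesgue. (mollifier \<phi> x \<epsilon> y)\<^sup>2)"

end

theory Submission
  imports Defs
begin

text \<open>
  By Pythagoras, \<open>\<parallel>\<Pi>\<^sub>d h\<parallel>\<^sup>2 = \<parallel>h\<parallel>\<^sup>2 - \<parallel>h - \<Pi>\<^sub>d h\<parallel>\<^sup>2\<close>. The first term divided by \<open>\<parallel>\<phi>\<^bsub>x,\<epsilon>\<^esub>\<parallel>\<^sup>2\<close> is a symmetric
  weighted average of \<open>g = 1 / f\<close> around \<open>x\<close>, so it differs from \<open>g x\<close> by a second difference, of
  order \<open>\<epsilon>\<^sup>2\<close>. For the second term, \<open>h = \<phi>\<^bsub>x,\<epsilon>\<^esub> w\<close> where \<open>w\<close> is \<open>g\<close> times a fixed smooth cutoff supported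
  in the interior of \<open>X\<close>; this localisation removes any need to extend \<open>g\<close> across the boundary of \<open>X\<close>.
  Let \<open>p\<close> and \<open>q\<close> be Jackson approximants of degree \<open>d / 2\<close> of \<open>\<phi>\<^bsub>x,\<epsilon>\<^esub>\<close> and \<open>w\<close>. Then
  \<open>\<parallel>h - p q\<parallel> \<le> \<parallel>w\<parallel>\<^sub>\<infinity> \<parallel>\<phi>\<^bsub>x,\<epsilon>\<^esub> - p\<parallel> + \<parallel>p\<parallel>\<^sub>\<infinity> \<parallel>w - q\<parallel>\<close>, which is at most a constant times
  \<open>d\<^sup>-\<^sup>k (\<epsilon>\<^bsup>-k-n/2\<^esup> + \<epsilon>\<^sup>-\<^sup>n)\<close>, and \<open>k > n / 2\<close> makes the first summand dominant.
  The approximants come from convolution with powers of the Dirichlet kernel, a polynomial in \<open>|t|\<^sup>2\<close>;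
  their error is controlled by the mean squares of \<open>k\<close>-th differences, which are bounded through weak
  derivatives by mollifying and Fatou's lemma.
\<close>

section \<open>Smooth functions and convolution\<close>

text \<open>Smoothness is measured throughout by one quantity: the least N for which the mean square
  of the k-th difference with step t is at most N |t|^(2 k). It bounds the error of the kernel
  approximants directly, and it survives pointwise limits, so it can be verified for
  \<open>w\<close> without classical derivatives. The two factors of \<open>h\<close> are
  approximated separately because the k-th derivatives of their product would pair intermediate
  derivatives of \<open>w\<close>, known only in L2, with sup norms of derivatives of the bump, and
  this costs too many powers of 1 / \<epsilon> in general. With separate approximants only sup norms
  of \<open>w\<close> and of the approximant of the bump enter; the latter is of order
  \<epsilon>^(-n), and comparing its square with \<epsilon>^(-n - 2 k) is the one place where n
  \<le> 2 k is used. The kernel is a polynomial, hence uncontrolled far from the origin. Therefore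
  all functions are supported in one fixed ball containing \<open>X\<close>, and errors are measured
  only on that ball. Constants are uniform in \<open>x\<close> since mean squares of differences are
  translation invariant.\<close>

lemma Ck_on_imp_continuous_on: "Ck_on k U f \<Longrightarrow> continuous_on U f"
  by (cases k) auto

lemma smooth_fun_differentiable: "smooth_fun f \<Longrightarrow> f differentiable (at x)"
  unfolding smooth_fun_def by (metis Ck_on.simps(2) UNIV_I)

lemma smooth_fun_has_derivative:
  "smooth_fun f \<Longrightarrow> (f has_derivative frechet_derivative f (at x)) (at x)"
  using smooth_fun_differentiable frechet_derivative_works by blast

lemma smooth_fun_frechet_derivative:
  "smooth_fun f \<Longrightarrow> smooth_fun (\<lambda>x. frechet_derivative f (at x) v)"
  unfolding smooth_fun_def by (metis Ck_on.simps(2))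

lemma smooth_fun_continuous_on: "smooth_fun f \<Longrightarrow> continuous_on S f"
  unfolding smooth_fun_def by (metis Ck_on.simps(1) continuous_on_subset subset_UNIV)

text \<open>Induction on the order works once the function is left free, since each derivative again
  satisfies \<open>P\<close>. It serves families whose derivatives keep their shape, such as
  rescalings of smooth functions and convolutions with them.\<close>

lemma smooth_fun_coinduct:
  assumes "P f"
    and step: "\<And>f. P f \<Longrightarrow> \<exists>D. (\<forall>x. (f has_derivative D x) (at x)) \<and> (\<forall>v. P (\<lambda>x. D x v))"
  shows "smooth_fun f"
proof -
  have "Ck_on k UNIV f" if "P f" for k f
    using that
  proof (induction k arbitrary: f)
    case 0
    obtain D where "\<forall>x. (f has_derivative D x) (at x)" using step[OF 0] by blast
    then show ?case
      by (auto intro!: continuous_at_imp_continuous_on has_derivative_continuous)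
  next
    case (Suc k)
    obtain D where D: "\<And>x. (f has_derivative D x) (at x)" "\<And>v. P (\<lambda>x. D x v)"
      using step[OF Suc.prems] by blast
    have "frechet_derivative f (at x) = D x" for x
      using D(1) frechet_derivative_at by metis
    with D Suc.IH show ?case
      by (auto intro!: continuous_at_imp_continuous_on has_derivative_continuous
          simp: differentiable_def)
  qed
  with assms(1) show ?thesis unfolding smooth_fun_def by blast
qed

lemma frechet_derivative_add:
  "f differentiable (at x) \<Longrightarrow> g differentiable (at x) \<Longrightarrow>
    frechet_derivative (\<lambda>x. f x + g x) (at x)
      = (\<lambda>v. frechet_derivative f (at x) v + frechet_derivative g (at x) v)"
  by (rule frechet_derivative_at[symmetric], rule has_derivative_add)
    (simp_all add: frechet_derivative_works)

lemma Ck_on_UNIV_add: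
  "Ck_on k UNIV f \<Longrightarrow> Ck_on k UNIV g \<Longrightarrow> Ck_on k UNIV (\<lambda>x. f x + g x)"
proof (induction k arbitrary: f g)
  case 0
  then show ?case by (auto intro: continuous_intros)
next
  case (Suc k)
  have "frechet_derivative (\<lambda>x. f x + g x) (at x)
      = (\<lambda>v. frechet_derivative f (at x) v + frechet_derivative g (at x) v)" for x
    using Suc.prems by (simp add: frechet_derivative_add)
  with Suc show ?case by (auto intro!: continuous_intros)
qed

lemma smooth_fun_add: "smooth_fun f \<Longrightarrow> smooth_fun g \<Longrightarrow> smooth_fun (\<lambda>x. f x + g x)"
  unfolding smooth_fun_def using Ck_on_UNIV_add by blast

lemma frechet_derivative_mult_smooth:
  assumes "smooth_fun f" "smooth_fun g"
  shows "frechet_derivative (\<lambda>x. f x * g x) (at x)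
    = (\<lambda>v. f x * frechet_derivative g (at x) v + frechet_derivative f (at x) v * g x)"
  by (rule frechet_derivative_at[symmetric],
      rule has_derivative_mult[OF smooth_fun_has_derivative smooth_fun_has_derivative, OF assms])

text \<open>Products are not closed under derivatives, since the product rule yields a sum; hence an
  induction on the order combined with \<open>Ck_on_UNIV_add\<close> in place of
  \<open>smooth_fun_coinduct\<close>.\<close>

lemma smooth_fun_mult:
  assumes "smooth_fun f" "smooth_fun g"
  shows "smooth_fun (\<lambda>x. f x * g x)"
proof -
  have "Ck_on k UNIV (\<lambda>x. f x * g x)" if "smooth_fun f" "smooth_fun g" for k f g
    using that
  proof (induction k arbitrary: f g)
    case 0
    then show ?case by (simp add: continuous_on_mult smooth_fun_continuous_on)
  next
    case (Suc k)
    show ?case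
      using Suc.prems
      by (simp add: frechet_derivative_mult_smooth continuous_on_mult smooth_fun_continuous_on
          Ck_on_UNIV_add Suc.IH smooth_fun_frechet_derivative differentiable_mult
          smooth_fun_differentiable)
  qed
  with assms show ?thesis unfolding smooth_fun_def by blast
qed

section \<open>Affine substitutions and iterated partial derivatives\<close>

lemma has_derivative_smooth_affine:
  assumes "smooth_fun F"
  shows "((\<lambda>x. b * F (a + c *\<^sub>R x)) has_derivative
          (\<lambda>v. (b * c) * frechet_derivative F (at (a + c *\<^sub>R x)) v)) (at x)"
proof -
  have 1: "((\<lambda>x. a + c *\<^sub>R x) has_derivative (\<lambda>v. c *\<^sub>R v)) (at x)"
    by (auto intro!: derivative_eq_intros)
  have lin: "linear (frechet_derivative F (at (a + c *\<^sub>R x)))"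
    using linear_frechet_derivative[OF smooth_fun_differentiable[OF assms]] .
  have "((\<lambda>x. F (a + c *\<^sub>R x)) has_derivative
          (\<lambda>v. c * frechet_derivative F (at (a + c *\<^sub>R x)) v)) (at x)"
    using has_derivative_compose[OF 1 smooth_fun_has_derivative[OF assms]]
    by (simp add: linear_cmul[OF lin])
  from has_derivative_mult_right[OF this, of b] show ?thesis by (simp add: mult_ac)
qed

text \<open>The free factor \<open>b\<close> makes the family stable: a derivative multiplies
  \<open>b\<close> by \<open>c\<close> and replaces \<open>F\<close> by one of its directional
  derivatives. Translations, dilations and reflections are special cases.\<close>

lemma smooth_fun_affine:
  assumes "smooth_fun F"
  shows "smooth_fun (\<lambda>x. b * F (a + c *\<^sub>R x))"
proof (rule smooth_fun_coinduct[where P="\<lambda>h. \<exists>F b. smooth_fun F \<and> h = (\<lambda>x. b * F (a + c *\<^sub>R x))"])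
  show "\<exists>F' b'. smooth_fun F' \<and> (\<lambda>x. b * F (a + c *\<^sub>R x)) = (\<lambda>x. b' * F' (a + c *\<^sub>R x))"
    using assms by blast
next
  fix h assume "\<exists>F b. smooth_fun F \<and> h = (\<lambda>x. b * F (a + c *\<^sub>R x))"
  then obtain F b where F: "smooth_fun F" and h: "h = (\<lambda>x. b * F (a + c *\<^sub>R x))" by blast
  show "\<exists>D. (\<forall>x. (h has_derivative D x) (at x)) \<and>
      (\<forall>v. \<exists>F b. smooth_fun F \<and> (\<lambda>x. D x v) = (\<lambda>x. b * F (a + c *\<^sub>R x)))"
    apply (rule exI[where x="\<lambda>x v. (b * c) * frechet_derivative F (at (a + c *\<^sub>R x)) v"])
    using has_derivative_smooth_affine[OF F] smooth_fun_frechet_derivative[OF F]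
    unfolding h by blast
qed

lemma smooth_fun_cmult: "smooth_fun F \<Longrightarrow> smooth_fun (\<lambda>x. b * F x)"
  using smooth_fun_affine[of F b 0 1] by simp

lemma smooth_partial_deriv: "smooth_fun f \<Longrightarrow> smooth_fun (partial_deriv i f)"
  unfolding partial_deriv_def by (rule smooth_fun_frechet_derivative)

lemma smooth_pderivs: "smooth_fun f \<Longrightarrow> smooth_fun (pderivs \<alpha> f)"
  by (induction \<alpha>) (auto intro: smooth_partial_deriv)

text \<open>\<open>pderivs\<close> applies the head of the list last, so the final entry is the
  innermost derivative. Induction from the right can thus differentiate a product before the
  remaining derivatives act.\<close>

lemma pderivs_snoc: "pderivs (\<alpha> @ [i]) f = pderivs \<alpha> (partial_deriv i f)"
  by (induction \<alpha>) auto

lemma partial_deriv_add: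
  "smooth_fun f \<Longrightarrow> smooth_fun g \<Longrightarrow>
    partial_deriv i (\<lambda>x. f x + g x) = (\<lambda>x. partial_deriv i f x + partial_deriv i g x)"
  by (simp add: fun_eq_iff partial_deriv_def frechet_derivative_add smooth_fun_differentiable)

lemma pderivs_add:
  "smooth_fun f \<Longrightarrow> smooth_fun g \<Longrightarrow>
    pderivs \<alpha> (\<lambda>x. f x + g x) = (\<lambda>x. pderivs \<alpha> f x + pderivs \<alpha> g x)"
  by (induction \<alpha>) (auto simp: partial_deriv_add smooth_pderivs)

lemma partial_deriv_mult:
  "smooth_fun f \<Longrightarrow> smooth_fun g \<Longrightarrow>
    partial_deriv i (\<lambda>x. f x * g x) = (\<lambda>x. f x * partial_deriv i g x + partial_deriv i f x * g x)"
  by (simp add: fun_eq_iff partial_deriv_def frechet_derivative_mult_smooth)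

lemma partial_deriv_affine:
  "smooth_fun F \<Longrightarrow>
    partial_deriv i (\<lambda>x. b * F (a + c *\<^sub>R x)) = (\<lambda>x. (b * c) * partial_deriv i F (a + c *\<^sub>R x))"
  by (simp add: fun_eq_iff partial_deriv_def
      frechet_derivative_at[OF has_derivative_smooth_affine, symmetric])

lemma pderivs_affine:
  assumes "smooth_fun F"
  shows "pderivs \<alpha> (\<lambda>x. b * F (a + c *\<^sub>R x)) = (\<lambda>x. (b * c ^ length \<alpha>) * pderivs \<alpha> F (a + c *\<^sub>R x))"
proof (induction \<alpha>)
  case (Cons i \<alpha>)
  then show ?case
    using partial_deriv_affine[OF smooth_pderivs[OF assms], of i "b * c ^ length \<alpha>" \<alpha> a c]
    by (simp add: mult.assoc mult.commute[of c])
qed simp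

text \<open>The complement of \<open>S\<close> is open, so \<open>u\<close> vanishes near each of
  its points, and so do, inductively, all derivatives.\<close>

lemma pderivs_eq_0_outside_closed:
  assumes "closed S" "\<And>x. x \<notin> S \<Longrightarrow> u x = 0" "x \<notin> S"
  shows "pderivs \<alpha> u x = 0"
  using assms(3)
proof (induction \<alpha> arbitrary: x)
  case Nil
  then show ?case using assms by simp
next
  case (Cons i \<alpha>)
  have "(pderivs \<alpha> u has_derivative (\<lambda>v. 0)) (at x)"
  proof (rule has_derivative_transform_within_open[where f="\<lambda>x. 0" and s="-S"])
    show "((\<lambda>x. 0) has_derivative (\<lambda>v. 0)) (at x)" by simp
  qed (use Cons assms in \<open>auto\<close>)
  from frechet_derivative_at[OF this, symmetric] show ?case
    by (simp add: partial_deriv_def)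
qed

text \<open>Differentiation under the integral asks for the derivative as a continuous map into the
  bounded linear maps; in finite dimension continuity may be tested direction by direction.\<close>

lemma continuous_on_Blinfun_frechet_derivative:
  fixes F :: "'a::euclidean_space \<Rightarrow> real"
  assumes "smooth_fun F"
  shows "continuous_on S (\<lambda>x. Blinfun (frechet_derivative F (at x)))"
proof -
  have bl: "bounded_linear (frechet_derivative F (at x))" for x
    using has_derivative_bounded_linear[OF smooth_fun_has_derivative[OF assms]] .
  show ?thesis
    by (rule continuous_on_blinfun_componentwise)
      (simp add: bounded_linear_Blinfun_apply[OF bl] smooth_fun_continuous_on
        smooth_fun_frechet_derivative[OF assms])
qed

section \<open>Convolution with a smooth kernel\<close>

definition conv :: "('a::euclidean_space \<Rightarrow> real) \<Rightarrow> ('a \<Rightarrow> real) \<Rightarrow> 'a \<Rightarrow> real" where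
  "conv u F z = (LINT y|lborel. u y * F (z - y))"

lemma integrable_lborel_continuous_compact_support:
  fixes u :: "'a::euclidean_space \<Rightarrow> real"
  assumes "continuous_on UNIV u" "\<And>y. y \<notin> cbox a b \<Longrightarrow> u y = 0"
  shows "integrable lborel u"
proof -
  have "integrable lborel (\<lambda>x. indicator (cbox a b) x *\<^sub>R u x)"
    by (rule borel_integrable_compact) (auto intro: continuous_on_subset[OF assms(1)])
  moreover have "(\<lambda>x. indicator (cbox a b) x *\<^sub>R u x) = u"
    using assms(2) by (auto simp: fun_eq_iff indicator_def)
  ultimately show ?thesis by simp
qed

lemma LINT_eq_integral_cbox:
  fixes u :: "'a::euclidean_space \<Rightarrow> real"
  assumes "continuous_on UNIV u" "\<And>y. y \<notin> cbox a b \<Longrightarrow> u y = 0"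
  shows "(LINT y|lborel. u y) = integral (cbox a b) u"
proof -
  have "(u has_integral (LINT y|lborel. u y)) UNIV"
    by (rule has_integral_integral_lborel[OF integrable_lborel_continuous_compact_support[OF assms]])
  moreover have "(\<lambda>x. if x \<in> cbox a b then u x else 0) = u"
    using assms(2) by (auto simp: fun_eq_iff)
  ultimately have "(u has_integral (LINT y|lborel. u y)) (cbox a b)"
    using has_integral_restrict_UNIV[of "cbox a b" u] by simp
  then show ?thesis by (simp add: integral_unique)
qed

lemma conv_eq_integral_cbox:
  fixes u :: "'a::euclidean_space \<Rightarrow> real"
  assumes "continuous_on UNIV u" "\<And>y. y \<notin> cbox a b \<Longrightarrow> u y = 0" "continuous_on UNIV F"
  shows "conv u F z = integral (cbox a b) (\<lambda>y. u y * F (z - y))"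
  unfolding conv_def
proof (rule LINT_eq_integral_cbox)
  show "continuous_on UNIV (\<lambda>y. u y * F (z - y))"
    by (intro continuous_intros assms continuous_on_compose2[OF assms(3)]) auto
qed (use assms in auto)

text \<open>All derivatives fall on the smooth factor \<open>F\<close>, while \<open>u\<close> stays
  merely continuous. Its support in a box makes the domain of integration compact, where the Leibniz
  rule applies; evaluation at \<open>v\<close> then commutes with the operator-valued
  integral.\<close>

lemma has_derivative_conv:
  fixes u :: "'a::euclidean_space \<Rightarrow> real"
  assumes u: "continuous_on UNIV u" "\<And>y. y \<notin> cbox a b \<Longrightarrow> u y = 0" and F: "smooth_fun F"
  shows "(conv u F has_derivative (\<lambda>v. conv u (\<lambda>x. frechet_derivative F (at x) v) z)) (at z)"
proof -
  define F' where "F' x = Blinfun (frechet_derivative F (at x))" for x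
  have bl: "bounded_linear (frechet_derivative F (at x))" for x
    using has_derivative_bounded_linear[OF smooth_fun_has_derivative[OF F]] .
  have F'_apply: "blinfun_apply (F' x) v = frechet_derivative F (at x) v" for x v
    unfolding F'_def by (simp add: bounded_linear_Blinfun_apply[OF bl])
  have cF': "continuous_on UNIV F'"
    unfolding F'_def by (rule continuous_on_Blinfun_frechet_derivative[OF F])
  have cont: "continuous_on (cbox a b) (\<lambda>y. u y *\<^sub>R F' (z - y))" for z
    by (intro continuous_intros continuous_on_subset[OF u(1)] continuous_on_compose2[OF cF']) auto
  have "((\<lambda>x. integral (cbox a b) (\<lambda>y. u y * F (x - y))) has_derivative
      blinfun_apply (integral (cbox a b) (\<lambda>y. u y *\<^sub>R F' (z - y)))) (at z within UNIV)"
  proof (rule leibniz_rule)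
    fix x t :: 'a
    have 1: "((\<lambda>x. x - t) has_derivative (\<lambda>v. v)) (at x)"
      by (auto intro!: derivative_eq_intros)
    have "((\<lambda>x. u t * F (x - t)) has_derivative (\<lambda>v. u t * frechet_derivative F (at (x - t)) v)) (at x)"
      by (intro has_derivative_mult_right has_derivative_compose[OF 1 smooth_fun_has_derivative[OF F]])
    then show "((\<lambda>x. u t * F (x - t)) has_derivative blinfun_apply (u t *\<^sub>R F' (x - t))) (at x within UNIV)"
      by (simp add: F'_apply scaleR_blinfun.rep_eq)
  next
    fix x
    show "(\<lambda>y. u y * F (x - y)) integrable_on cbox a b"
      by (intro integrable_continuous continuous_intros continuous_on_subset[OF u(1)]
          continuous_on_compose2[OF smooth_fun_continuous_on[OF F, of UNIV]]) auto
  next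
    show "continuous_on (UNIV \<times> cbox a b) (\<lambda>(x, y). u y *\<^sub>R F' (x - y))"
      unfolding split_beta
      by (intro continuous_intros continuous_on_compose2[OF u(1)] continuous_on_compose2[OF cF']) auto
  qed auto
  moreover have "(\<lambda>x. integral (cbox a b) (\<lambda>y. u y * F (x - y))) = conv u F"
    by (rule ext, rule conv_eq_integral_cbox[OF u smooth_fun_continuous_on[OF F], symmetric])
  moreover have "blinfun_apply (integral (cbox a b) (\<lambda>y. u y *\<^sub>R F' (z - y)))
      = (\<lambda>v. conv u (\<lambda>x. frechet_derivative F (at x) v) z)"
  proof
    fix v
    have "blinfun_apply (integral (cbox a b) (\<lambda>y. u y *\<^sub>R F' (z - y))) v
        = integral (cbox a b) (\<lambda>y. blinfun_apply (u y *\<^sub>R F' (z - y)) v)"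
      using integral_linear[OF integrable_continuous[OF cont] blinfun.bounded_linear_left, of v z]
      by (simp add: o_def)
    also have "\<dots> = conv u (\<lambda>x. frechet_derivative F (at x) v) z"
      using conv_eq_integral_cbox[OF u smooth_fun_continuous_on[OF smooth_fun_frechet_derivative[OF F]]]
      by (simp add: F'_apply scaleR_blinfun.rep_eq)
    finally show "blinfun_apply (integral (cbox a b) (\<lambda>y. u y *\<^sub>R F' (z - y))) v
        = conv u (\<lambda>x. frechet_derivative F (at x) v) z" .
  qed
  ultimately show ?thesis by simp
qed

lemma smooth_fun_conv:
  fixes u :: "'a::euclidean_space \<Rightarrow> real"
  assumes u: "continuous_on UNIV u" "\<And>y. y \<notin> cbox a b \<Longrightarrow> u y = 0" and F: "smooth_fun F"
  shows "smooth_fun (conv u F)"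
proof (rule smooth_fun_coinduct[where P="\<lambda>h. \<exists>F. smooth_fun F \<and> h = conv u F"])
  show "\<exists>F'. smooth_fun F' \<and> conv u F = conv u F'" using F by blast
next
  fix h assume "\<exists>F. smooth_fun F \<and> h = conv u F"
  then obtain F where F: "smooth_fun F" and h: "h = conv u F" by blast
  show "\<exists>D. (\<forall>x. (h has_derivative D x) (at x)) \<and>
      (\<forall>v. \<exists>F. smooth_fun F \<and> (\<lambda>x. D x v) = conv u F)"
    apply (rule exI[where x="\<lambda>x v. conv u (\<lambda>x. frechet_derivative F (at x) v) x"])
    using has_derivative_conv[OF u F] smooth_fun_frechet_derivative[OF F]
    unfolding h by blast
qed

lemma partial_deriv_conv:
  fixes u :: "real^'n \<Rightarrow> real"
  assumes u: "continuous_on UNIV u" "\<And>y. y \<notin> cbox a b \<Longrightarrow> u y = 0" and F: "smooth_fun F"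
  shows "partial_deriv i (conv u F) = conv u (partial_deriv i F)"
  by (simp add: fun_eq_iff partial_deriv_def[abs_def]
      frechet_derivative_at[OF has_derivative_conv[OF u F], symmetric])

lemma pderivs_conv:
  fixes u :: "real^'n \<Rightarrow> real"
  assumes u: "continuous_on UNIV u" "\<And>y. y \<notin> cbox a b \<Longrightarrow> u y = 0" and F: "smooth_fun F"
  shows "pderivs \<alpha> (conv u F) = conv u (pderivs \<alpha> F)"
  by (induction \<alpha>) (simp_all add: partial_deriv_conv[OF u] smooth_pderivs F)

section \<open>Finite differences in the mean square\<close>

text \<open>Jensen's inequality for the square, read off from the nonnegative variance of
  \<open>v\<close> under the density \<open>\<kappa>\<close>. If the right side is infinite the
  claim is trivial; otherwise \<open>|v| \<le> 1 + v^2\<close> guarantees that the mean of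
  \<open>v\<close> exists.\<close>

lemma square_integral_le_integral_square:
  fixes \<kappa> v :: "'a \<Rightarrow> real"
  assumes \<kappa>: "integrable M \<kappa>" "\<And>x. 0 \<le> \<kappa> x" "(LINT x|M. \<kappa> x) = 1"
    and v: "v \<in> borel_measurable M"
  shows "ennreal ((LINT x|M. \<kappa> x * v x)\<^sup>2) \<le> (\<integral>\<^sup>+x. ennreal (\<kappa> x * (v x)\<^sup>2) \<partial>M)"
proof (cases "(\<integral>\<^sup>+x. ennreal (\<kappa> x * (v x)\<^sup>2) \<partial>M) = \<infinity>")
  case False
  note [measurable] = v borel_measurable_integrable[OF \<kappa>(1)]
  have i2: "integrable M (\<lambda>x. \<kappa> x * (v x)\<^sup>2)"
    by (rule integrableI_nonneg) (use False \<kappa>(2) in \<open>auto simp: less_top\<close>)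
  have i1: "integrable M (\<lambda>x. \<kappa> x * v x)"
  proof (rule Bochner_Integration.integrable_bound)
    show "integrable M (\<lambda>x. \<kappa> x + \<kappa> x * (v x)\<^sup>2)" using \<kappa>(1) i2 by simp
    show "AE x in M. norm (\<kappa> x * v x) \<le> norm (\<kappa> x + \<kappa> x * (v x)\<^sup>2)"
    proof (rule AE_I2)
      fix x
      have "0 \<le> (\<bar>v x\<bar> - 1)\<^sup>2 + 1 + (v x)\<^sup>2" by simp
      then have "\<bar>v x\<bar> \<le> 1 + (v x)\<^sup>2" by (simp add: power2_eq_square algebra_simps)
      then have "\<kappa> x * \<bar>v x\<bar> \<le> \<kappa> x * (1 + (v x)\<^sup>2)" using \<kappa>(2) mult_left_mono by blast
      then show "norm (\<kappa> x * v x) \<le> norm (\<kappa> x + \<kappa> x * (v x)\<^sup>2)"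
        using \<kappa>(2)[of x] by (simp add: abs_mult algebra_simps)
    qed
  qed simp
  define c where "c = (LINT x|M. \<kappa> x * v x)"
  have "0 \<le> (LINT x|M. \<kappa> x * (v x - c)\<^sup>2)" using \<kappa>(2) by simp
  also have "\<dots> = (LINT x|M. \<kappa> x * (v x)\<^sup>2 - 2 * c * (\<kappa> x * v x) + c\<^sup>2 * \<kappa> x)"
    by (simp add: power2_eq_square algebra_simps)
  also have "\<dots> = (LINT x|M. \<kappa> x * (v x)\<^sup>2) - 2 * c * c + c\<^sup>2"
    using i1 i2 \<kappa>(1) by (simp add: \<kappa>(3) c_def[symmetric])
  finally have "c\<^sup>2 \<le> (LINT x|M. \<kappa> x * (v x)\<^sup>2)" by (simp add: power2_eq_square)
  then show ?thesis
    using nn_integral_eq_integral[OF i2] \<kappa>(2) unfolding c_def by (simp add: ennreal_leI)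
qed simp

lemma nn_integral_lborel_translate:
  fixes f :: "'a::euclidean_space \<Rightarrow> ennreal"
  assumes [measurable]: "f \<in> borel_measurable borel"
  shows "(\<integral>\<^sup>+x. f (x + t) \<partial>lborel) = (\<integral>\<^sup>+x. f x \<partial>lborel)"
proof -
  have "(\<integral>\<^sup>+x. f x \<partial>lborel) = (\<integral>\<^sup>+x. f x \<partial>distr lborel borel ((+) t))"
    by (simp add: lborel_distr_plus)
  also have "\<dots> = (\<integral>\<^sup>+x. f (t + x) \<partial>lborel)"
    by (subst nn_integral_distr) auto
  finally show ?thesis by (simp add: add.commute)
qed

text \<open>The step comes first so that \<open>fdiff t ^^ k\<close> is the k-th difference with
  step \<open>t\<close>.\<close>

definition fdiff :: "'a::ab_group_add \<Rightarrow> ('a \<Rightarrow> real) \<Rightarrow> 'a \<Rightarrow> real" where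
  "fdiff t u x = u (x + t) - u x"

lemma frechet_derivative_eq_inner_partial_deriv:
  fixes u :: "real^'n \<Rightarrow> real"
  assumes "u differentiable (at y)"
  shows "frechet_derivative u (at y) t = t \<bullet> (\<chi> i. partial_deriv i u y)"
proof -
  have lin: "linear (frechet_derivative u (at y))"
    by (rule linear_frechet_derivative[OF assms])
  have "frechet_derivative u (at y) t = frechet_derivative u (at y) (\<Sum>i\<in>UNIV. t $ i *\<^sub>R axis i 1)"
    using basis_expansion[of t] by (simp add: scalar_mult_eq_scaleR)
  also have "\<dots> = (\<Sum>i\<in>UNIV. t $ i * partial_deriv i u y)"
    by (simp add: linear_sum[OF lin] linear_cmul[OF lin] partial_deriv_def)
  finally show ?thesis by (simp add: inner_vec_def)
qed

lemma square_frechet_derivative_le: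
  fixes u :: "real^'n \<Rightarrow> real"
  assumes "u differentiable (at y)"
  shows "(frechet_derivative u (at y) t)\<^sup>2 \<le> (norm t)\<^sup>2 * (\<Sum>i\<in>UNIV. (partial_deriv i u y)\<^sup>2)"
  using Cauchy_Schwarz_ineq[of t "\<chi> i. partial_deriv i u y"]
  by (simp add: frechet_derivative_eq_inner_partial_deriv[OF assms] power2_norm_eq_inner)
    (simp add: inner_vec_def power2_eq_square)

text \<open>A difference is the integral over \<open>{0..1}\<close> of the derivative along the
  segment from \<open>x\<close> to \<open>x + t\<close>. Jensen's inequality moves the square
  inside, and after exchanging the integrals translation invariance removes the shift
  \<open>s *\<^sub>R t\<close>.\<close>

lemma nn_integral_fdiff_le:
  fixes u :: "real^'n \<Rightarrow> real"
  assumes u: "smooth_fun u"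
  shows "(\<integral>\<^sup>+x. ennreal ((fdiff t u x)\<^sup>2) \<partial>lborel)
    \<le> ennreal ((norm t)\<^sup>2) * (\<Sum>i\<in>UNIV. \<integral>\<^sup>+x. ennreal ((partial_deriv i u x)\<^sup>2) \<partial>lborel)"
proof -
  define G where "G y = (norm t)\<^sup>2 * (\<Sum>i\<in>UNIV. (partial_deriv i u y)\<^sup>2)" for y
  have cp: "continuous_on UNIV (partial_deriv i u)" for i
    by (rule smooth_fun_continuous_on[OF smooth_partial_deriv[OF u]])
  have [measurable]: "partial_deriv i u \<in> borel_measurable borel" for i
    by (rule borel_measurable_continuous_onI[OF cp])
  have [measurable]: "G \<in> borel_measurable borel"
    unfolding G_def by measurable
  have G0: "0 \<le> G y" for y unfolding G_def by (intro mult_nonneg_nonneg sum_nonneg) auto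
  have pt: "ennreal ((fdiff t u x)\<^sup>2) \<le> (\<integral>\<^sup>+s. ennreal (indicator {0..1} s * G (x + s *\<^sub>R t)) \<partial>lborel)" for x
  proof -
    define h where "h s = frechet_derivative u (at (x + s *\<^sub>R t)) t" for s :: real
    have ch: "continuous_on UNIV h"
      unfolding h_def
      by (intro continuous_on_compose2[OF smooth_fun_continuous_on[OF smooth_fun_frechet_derivative[OF u], of UNIV]]
          continuous_intros) auto
    have [measurable]: "h \<in> borel_measurable borel"
      by (rule borel_measurable_continuous_onI[OF ch])
    have der: "((\<lambda>s. u (x + s *\<^sub>R t)) has_real_derivative h s) (at s)" for s
    proof -
      have "((\<lambda>s. x + s *\<^sub>R t) has_derivative (\<lambda>r. r *\<^sub>R t)) (at s)"
        by (auto intro!: derivative_eq_intros)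
      from has_derivative_compose[OF this smooth_fun_has_derivative[OF u]]
      have "((\<lambda>s. u (x + s *\<^sub>R t)) has_derivative
          (\<lambda>r. frechet_derivative u (at (x + s *\<^sub>R t)) (r *\<^sub>R t))) (at s)" .
      then show ?thesis unfolding h_def has_field_derivative_def
        by (simp add: linear_cmul[OF linear_frechet_derivative[OF smooth_fun_differentiable[OF u]]]
            mult.commute[of _ "frechet_derivative u (at (x + s *\<^sub>R t)) t"])
    qed
    have "(LINT s|lborel. h s * indicator {0..1} s) = u (x + 1 *\<^sub>R t) - u (x + 0 *\<^sub>R t)"
      by (rule integral_FTC_Icc_real[where F="\<lambda>s. u (x + s *\<^sub>R t)"])
        (use der ch in \<open>auto simp: continuous_on_eq_continuous_at\<close>)
    then have eq: "(LINT s|lborel. indicator {0..1} s * h s) = fdiff t u x"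
      by (simp add: fdiff_def mult.commute)
    have "ennreal ((fdiff t u x)\<^sup>2) \<le> (\<integral>\<^sup>+s. ennreal (indicator {0..1} s * (h s)\<^sup>2) \<partial>lborel)"
      unfolding eq[symmetric]
      by (rule square_integral_le_integral_square) auto
    also have "\<dots> \<le> (\<integral>\<^sup>+s. ennreal (indicator {0..1} s * G (x + s *\<^sub>R t)) \<partial>lborel)"
      unfolding h_def G_def
      by (intro nn_integral_mono ennreal_leI mult_left_mono square_frechet_derivative_le
          smooth_fun_differentiable[OF u]) auto
    finally show ?thesis .
  qed
  have "(\<integral>\<^sup>+x. ennreal ((fdiff t u x)\<^sup>2) \<partial>lborel)
      \<le> (\<integral>\<^sup>+x. \<integral>\<^sup>+s. ennreal (indicator {0..1} s * G (x + s *\<^sub>R t)) \<partial>lborel \<partial>lborel)"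
    by (intro nn_integral_mono pt)
  also have "\<dots> = (\<integral>\<^sup>+s. \<integral>\<^sup>+x. ennreal (indicator {0..1::real} s * G (x + s *\<^sub>R t)) \<partial>lborel \<partial>lborel)"
    by (rule lborel_pair.Fubini'[symmetric]) simp
  also have "\<dots> = (\<integral>\<^sup>+s. indicator {0..1::real} s * (\<integral>\<^sup>+x. ennreal (G (x + s *\<^sub>R t)) \<partial>lborel) \<partial>lborel)"
    by (intro nn_integral_cong) (auto simp: indicator_def)
  also have "\<dots> = (\<integral>\<^sup>+s. indicator {0..1::real} s * (\<integral>\<^sup>+x. ennreal (G x) \<partial>lborel) \<partial>lborel)"
    by (subst nn_integral_lborel_translate[where f="\<lambda>x. ennreal (G x)"]) auto
  also have "\<dots> = (\<integral>\<^sup>+x. ennreal (G x) \<partial>lborel)"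
    by (simp add: nn_integral_multc)
  also have "\<dots> = ennreal ((norm t)\<^sup>2) * (\<Sum>i\<in>UNIV. \<integral>\<^sup>+x. ennreal ((partial_deriv i u x)\<^sup>2) \<partial>lborel)"
    unfolding G_def
    by (subst ennreal_mult) (auto simp: sum_nonneg nn_integral_cmult nn_integral_sum simp flip: sum_ennreal)
  finally show ?thesis .
qed

lemma smooth_fun_fdiff: "smooth_fun u \<Longrightarrow> smooth_fun (fdiff t u)"
  using smooth_fun_add[OF smooth_fun_affine[of u 1 t 1] smooth_fun_cmult[of u "-1"]]
  by (simp add: fdiff_def[abs_def] add.commute)

lemma pderivs_fdiff:
  assumes "smooth_fun u"
  shows "pderivs \<alpha> (fdiff t u) = fdiff t (pderivs \<alpha> u)"
proof -
  have "fdiff t u = (\<lambda>x. 1 * u (t + 1 *\<^sub>R x) + (-1) * u (0 + 1 *\<^sub>R x))"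
    by (simp add: fdiff_def[abs_def] add.commute)
  then have "pderivs \<alpha> (fdiff t u) = (\<lambda>x. pderivs \<alpha> (\<lambda>x. 1 * u (t + 1 *\<^sub>R x)) x
      + pderivs \<alpha> (\<lambda>x. (-1) * u (0 + 1 *\<^sub>R x)) x)"
    by (simp only: pderivs_add[OF smooth_fun_affine[OF assms] smooth_fun_affine[OF assms]])
  also have "\<dots> = fdiff t (pderivs \<alpha> u)"
    by (simp only: pderivs_affine[OF assms]) (simp add: fdiff_def[abs_def] add.commute)
  finally show ?thesis .
qed

lemma sum_lists_length_Suc:
  fixes F :: "'n::finite list \<Rightarrow> 'b::comm_monoid_add"
  shows "(\<Sum>\<alpha> | length \<alpha> = Suc k. F \<alpha>) = (\<Sum>\<alpha> | length \<alpha> = k. \<Sum>i\<in>UNIV. F (i # \<alpha>))"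
proof -
  have "{\<alpha>::'n list. length \<alpha> = Suc k} = (\<lambda>(\<alpha>, i). i # \<alpha>) ` ({\<alpha>. length \<alpha> = k} \<times> UNIV)"
    using lists_length_Suc_eq[of "UNIV :: 'n set" k] by simp
  moreover have "inj_on (\<lambda>(\<alpha>, i::'n). i # \<alpha>) ({\<alpha>. length \<alpha> = k} \<times> UNIV)"
    by (auto simp: inj_on_def)
  ultimately show ?thesis
    by (simp add: sum.reindex sum.cartesian_product split_def)
qed

text \<open>Each difference is exchanged for one derivative and a factor \<open>(norm t)^2\<close>;
  because differences commute with \<open>pderivs\<close>, the induction hypothesis can be applied
  to \<open>fdiff t u\<close>. Derivatives are indexed by lists, so mixed ones are counted with
  multiplicity.\<close>

lemma nn_integral_fdiff_funpow_le:
  fixes u :: "real^'n \<Rightarrow> real"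
  assumes "smooth_fun u"
  shows "(\<integral>\<^sup>+x. ennreal (((fdiff t ^^ k) u x)\<^sup>2) \<partial>lborel)
    \<le> ennreal (norm t ^ (2 * k)) * (\<Sum>\<alpha> | length \<alpha> = k. \<integral>\<^sup>+x. ennreal ((pderivs \<alpha> u x)\<^sup>2) \<partial>lborel)"
  using assms
proof (induction k arbitrary: u)
  case 0
  have "{\<alpha>::'n list. \<alpha> = []} = {[]}" by auto
  then show ?case by simp
next
  case (Suc k)
  have "(\<integral>\<^sup>+x. ennreal (((fdiff t ^^ Suc k) u x)\<^sup>2) \<partial>lborel)
      = (\<integral>\<^sup>+x. ennreal (((fdiff t ^^ k) (fdiff t u) x)\<^sup>2) \<partial>lborel)"
    by (simp add: funpow_swap1)
  also have "\<dots> \<le> ennreal (norm t ^ (2 * k)) *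
      (\<Sum>\<alpha> | length \<alpha> = k. \<integral>\<^sup>+x. ennreal ((pderivs \<alpha> (fdiff t u) x)\<^sup>2) \<partial>lborel)"
    by (rule Suc.IH[OF smooth_fun_fdiff[OF Suc.prems]])
  also have "\<dots> \<le> ennreal (norm t ^ (2 * k)) * (\<Sum>\<alpha> | length \<alpha> = k.
      ennreal ((norm t)\<^sup>2) * (\<Sum>i\<in>UNIV. \<integral>\<^sup>+x. ennreal ((pderivs (i # \<alpha>) u x)\<^sup>2) \<partial>lborel))"
    using nn_integral_fdiff_le[OF smooth_pderivs[OF Suc.prems]]
    by (intro mult_left_mono sum_mono) (auto simp: pderivs_fdiff[OF Suc.prems])
  also have "\<dots> = ennreal (norm t ^ (2 * Suc k)) *
      (\<Sum>\<alpha> | length \<alpha> = Suc k. \<integral>\<^sup>+x. ennreal ((pderivs \<alpha> u x)\<^sup>2) \<partial>lborel)"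
    by (simp only: sum_lists_length_Suc sum_distrib_left[symmetric] mult.assoc[symmetric]
        ennreal_mult[symmetric] zero_le_power norm_ge_zero power_add[symmetric])
      (simp add: add.commute)
  finally show ?case .
qed

text \<open>The coefficients are signed binomial coefficients, fixed before \<open>u\<close>,
  \<open>t\<close> and \<open>x\<close>. Only the one at 0 is recorded: its absolute value is 1, so
  that \<open>u x\<close> can be solved for after averaging over \<open>t\<close>.\<close>

lemma fdiff_funpow_eq_sum:
  "\<exists>c :: nat \<Rightarrow> real. c 0 = (-1) ^ k \<and>
    (\<forall>(u :: 'a::real_vector \<Rightarrow> real) t x. (fdiff t ^^ k) u x = (\<Sum>i\<le>k. c i * u (x + real i *\<^sub>R t)))"
proof (induction k)
  case 0
  show ?case by (rule exI[of _ "\<lambda>_. 1"]) simp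
next
  case (Suc k)
  then obtain c :: "nat \<Rightarrow> real" where c0: "c 0 = (-1) ^ k"
    and c: "\<And>(u :: 'a \<Rightarrow> real) t x. (fdiff t ^^ k) u x = (\<Sum>i\<le>k. c i * u (x + real i *\<^sub>R t))"
    by blast
  \<comment> \<open>Padding with zeros beyond \<open>k\<close> gives both shifted sums the range up
    to \<open>Suc k\<close>; \<open>c'\<close> is then Pascal's rule with signs.\<close>
  define b where "b i = (if i \<le> k then c i else 0)" for i
  define c' where "c' i = (if i = 0 then - b 0 else b (i - 1) - b i)" for i
  have "(fdiff t ^^ Suc k) u x = (\<Sum>i\<le>Suc k. c' i * u (x + real i *\<^sub>R t))"
    for u :: "'a \<Rightarrow> real" and t x
  proof -
    define w where "w i = u (x + real i *\<^sub>R t)" for i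
    have "(fdiff t ^^ Suc k) u x = (\<Sum>i\<le>k. b i * w (Suc i)) - (\<Sum>i\<le>k. b i * w i)"
      by (simp add: fdiff_def c b_def w_def algebra_simps)
    also have "(\<Sum>i\<le>k. b i * w i) = (\<Sum>i\<le>Suc k. b i * w i)"
      by (simp add: b_def)
    also have "(\<Sum>i\<le>Suc k. b i * w i) = b 0 * w 0 + (\<Sum>i\<le>k. b (Suc i) * w (Suc i))"
      by (rule sum.atMost_Suc_shift)
    finally have "(fdiff t ^^ Suc k) u x = - b 0 * w 0 + (\<Sum>i\<le>k. (b i - b (Suc i)) * w (Suc i))"
      by (simp add: sum_subtractf left_diff_distrib)
    also have "\<dots> = (\<Sum>i\<le>Suc k. c' i * w i)"
      by (subst sum.atMost_Suc_shift) (simp add: c'_def)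
    finally show ?thesis by (simp add: w_def)
  qed
  moreover have "c' 0 = (-1) ^ Suc k" by (simp add: c'_def b_def c0)
  ultimately show ?case by (intro exI[of _ c'] conjI allI)
qed

lemma tendsto_fdiff_funpow:
  fixes u :: "'a::ab_group_add \<Rightarrow> real"
  assumes "\<And>x. (\<lambda>n. v n x) \<longlonglongrightarrow> u x"
  shows "(\<lambda>n. (fdiff t ^^ k) (v n) x) \<longlonglongrightarrow> (fdiff t ^^ k) u x"
proof (induction k arbitrary: x)
  case 0 then show ?case using assms by simp
next
  case (Suc k) then show ?case by (simp add: fdiff_def tendsto_diff)
qed

text \<open>Continuity in the pair (t, x) supplies the joint measurability for exchanging the
  integrals over \<open>t\<close> and \<open>x\<close>.\<close>

lemma continuous_on_fdiff_funpow:
  fixes u :: "'a::real_normed_vector \<Rightarrow> real"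
  assumes "continuous_on UNIV u"
  shows "continuous_on UNIV (\<lambda>(t, x). (fdiff t ^^ k) u x)"
proof -
  obtain c where c: "\<And>(u :: 'a \<Rightarrow> real) t x. (fdiff t ^^ k) u x = (\<Sum>i\<le>k. c i * u (x + real i *\<^sub>R t))"
    using fdiff_funpow_eq_sum by blast
  show ?thesis unfolding c split_def
    by (intro continuous_intros continuous_on_compose2[OF assms]) auto
qed

section \<open>The Jackson kernel\<close>

lemma nn_integral_lborel_affine:
  fixes f :: "'a::euclidean_space \<Rightarrow> ennreal"
  assumes [measurable]: "f \<in> borel_measurable borel" and "c \<noteq> 0"
  shows "(\<integral>\<^sup>+x. f x \<partial>lborel) = ennreal (\<bar>c\<bar> ^ DIM('a)) * (\<integral>\<^sup>+x. f (t + c *\<^sub>R x) \<partial>lborel)"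
  by (subst lborel_affine[OF \<open>c \<noteq> 0\<close>, of t])
    (simp add: nn_integral_density nn_integral_distr nn_integral_cmult)

lemma integral_lborel_affine:
  fixes f :: "'a::euclidean_space \<Rightarrow> real"
  assumes [measurable]: "f \<in> borel_measurable borel" and "c \<noteq> 0"
  shows "(LINT x|lborel. f x) = \<bar>c\<bar> ^ DIM('a) * (LINT x|lborel. f (t + c *\<^sub>R x))"
  by (subst lborel_affine[OF \<open>c \<noteq> 0\<close>, of t])
    (simp add: integral_density integral_distr)

text \<open>Where the floor of \<open>norm s\<close> is \<open>j\<close>, the integrand is at most
  \<open>(1 + j)^-(n + 2)\<close>, and this shell lies in a ball of volume proportional to
  \<open>(1 + j)^n\<close>. The exponent \<open>n + 2\<close> leaves \<open>1 / (1 + j)^2\<close>,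
  which is summable.\<close>

lemma nn_integral_inverse_power_norm_finite:
  "(\<integral>\<^sup>+s. ennreal (1 / (1 + norm (s::'a::euclidean_space)) ^ (DIM('a) + 2)) \<partial>lborel) < \<infinity>"
proof -
  define n where "n = DIM('a)"
  define a where "a j = 1 / (1 + real j) ^ (n + 2)" for j
  have a0: "0 \<le> a j" for j unfolding a_def by simp
  have [measurable]: "cball (0::'a) e \<in> sets borel" for e by simp
  have pt: "ennreal (1 / (1 + norm s) ^ (n + 2))
      \<le> (\<Sum>j. ennreal (a j) * indicator (cball 0 (1 + real j)) s)" for s :: 'a
  proof -
    define j where "j = nat \<lfloor>norm s\<rfloor>"
    have j: "real j \<le> norm s" "norm s \<le> 1 + real j"
      unfolding j_def by (auto simp: of_nat_nat) linarith
    have "1 / (1 + norm s) ^ (n + 2) \<le> a j"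
      unfolding a_def using j by (intro divide_left_mono power_mono) auto
    then have "ennreal (1 / (1 + norm s) ^ (n + 2)) \<le> ennreal (a j) * indicator (cball 0 (1 + real j)) s"
      using j by (simp add: ennreal_leI)
    also have "\<dots> \<le> (\<Sum>j. ennreal (a j) * indicator (cball 0 (1 + real j)) s)"
    proof -
      have "b j \<le> suminf b" for b :: "nat \<Rightarrow> ennreal"
        using sum_le_suminf[of b "{j}"] by simp
      then show ?thesis by this
    qed
    finally show ?thesis .
  qed
  have "(\<integral>\<^sup>+s. ennreal (1 / (1 + norm (s::'a)) ^ (n + 2)) \<partial>lborel)
      \<le> (\<integral>\<^sup>+s. (\<Sum>j. ennreal (a j) * indicator (cball 0 (1 + real j)) (s::'a)) \<partial>lborel)"
    by (intro nn_integral_mono pt)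
  also have "\<dots> = (\<Sum>j. ennreal (a j) * emeasure lborel (cball (0::'a) (1 + real j)))"
    by (subst nn_integral_suminf) (auto simp: nn_integral_cmult_indicator)
  also have "\<dots> = (\<Sum>j. ennreal (unit_ball_vol (real n) * (1 / (1 + real j) ^ 2)))"
  proof (rule suminf_cong)
    fix j
    have "a j * (unit_ball_vol (real n) * (1 + real j) ^ n) = unit_ball_vol (real n) * (1 / (1 + real j) ^ 2)"
      unfolding a_def power_add by (simp add: field_simps)
    then show "ennreal (a j) * emeasure lborel (cball (0::'a) (1 + real j))
        = ennreal (unit_ball_vol (real n) * (1 / (1 + real j) ^ 2))"
      using a0 by (simp add: emeasure_cball n_def ennreal_mult[symmetric])
  qed
  also have "\<dots> < \<infinity>"
  proof -
    have "summable (\<lambda>j. 1 / (1 + real j) ^ 2)"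
      using inverse_squares_sums by (simp add: sums_iff add.commute)
    then have "summable (\<lambda>j. unit_ball_vol (real n) * (1 / (1 + real j) ^ 2))"
      by (rule summable_mult)
    then show ?thesis
      by (subst suminf_ennreal2) auto
  qed
  finally show ?thesis unfolding n_def .
qed

text \<open>The Dirichlet kernel \<open>sin ((2 j + 1) a) / sin a\<close> as a polynomial in \<open>(sin a)\<^sup>2\<close>.\<close>
fun dirichlet_poly :: "nat \<Rightarrow> real \<Rightarrow> real" where
  "dirichlet_poly 0 x = 1"
| "dirichlet_poly (Suc 0) x = 3 - 4 * x"
| "dirichlet_poly (Suc (Suc j)) x = 2 * (1 - 2 * x) * dirichlet_poly (Suc j) x - dirichlet_poly j x"

text \<open>The recursion is the identity
  \<open>sin (y + 2 a) + sin (y - 2 a) = 2 cos (2 a) sin y\<close> with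
  \<open>cos (2 a) = 1 - 2 (sin a)^2\<close>.\<close>

lemma sin_mult_dirichlet_poly: "sin a * dirichlet_poly j ((sin a)\<^sup>2) = sin ((2 * real j + 1) * a)"
proof (induction j "(sin a)\<^sup>2" rule: dirichlet_poly.induct)
  case 2
  have "sin (3 * a) = sin (2 * a + a)" by simp
  also have "\<dots> = 2 * sin a * (cos a)\<^sup>2 + (1 - 2 * (sin a)\<^sup>2) * sin a"
    unfolding sin_add sin_double cos_double_sin by (simp add: power2_eq_square)
  also have "(cos a)\<^sup>2 = 1 - (sin a)\<^sup>2" by (simp add: cos_squared_eq)
  finally show ?case by (simp add: algebra_simps)
next
  case (3 j)
  define y where "y = (2 * real j + 3) * a"
  have e: "y + 2 * a = (2 * real (Suc (Suc j)) + 1) * a" "y - 2 * a = (2 * real j + 1) * a"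
    "y = (2 * real (Suc j) + 1) * a"
    unfolding y_def by (simp_all add: algebra_simps)
  have "sin (y + 2 * a) = 2 * cos (2 * a) * sin y - sin (y - 2 * a)"
    by (simp add: sin_add sin_diff)
  also have "cos (2 * a) = 1 - 2 * (sin a)\<^sup>2" by (rule cos_double_sin)
  finally have s: "sin (y + 2 * a) = 2 * (1 - 2 * (sin a)\<^sup>2) * sin y - sin (y - 2 * a)" .
  have "sin a * dirichlet_poly (Suc (Suc j)) ((sin a)\<^sup>2)
      = 2 * (1 - 2 * (sin a)\<^sup>2) * (sin a * dirichlet_poly (Suc j) ((sin a)\<^sup>2))
        - sin a * dirichlet_poly j ((sin a)\<^sup>2)"
    by (simp add: algebra_simps)
  also have "\<dots> = sin (y + 2 * a)"
    using 3 s by (simp only: e(2) e(3)[symmetric])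
  finally show ?case unfolding e(1) .
qed simp

lemma dirichlet_poly_0: "dirichlet_poly j 0 = 2 * real j + 1"
  by (induction j "0::real" rule: dirichlet_poly.induct) auto

lemma abs_sin_nat_mult_le: "\<bar>sin (real m * a)\<bar> \<le> real m * \<bar>sin a\<bar>"
proof (induction m)
  case (Suc m)
  have "sin (real (Suc m) * a) = sin (real m * a) * cos a + cos (real m * a) * sin a"
    by (simp add: algebra_simps sin_add)
  also have "\<bar>\<dots>\<bar> \<le> \<bar>sin (real m * a)\<bar> * \<bar>cos a\<bar> + \<bar>cos (real m * a)\<bar> * \<bar>sin a\<bar>"
    by (simp add: abs_triangle_ineq[THEN order_trans] abs_mult)
  also have "\<dots> \<le> \<bar>sin (real m * a)\<bar> * 1 + 1 * \<bar>sin a\<bar>"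
    by (intro add_mono mult_mono) auto
  finally show ?case using Suc by (simp add: algebra_simps)
qed simp

text \<open>With \<open>x = sin a\<close> the kernel is a quotient of sines. The first bound is its
  height near the origin, by \<open>abs_sin_nat_mult_le\<close>; the second is its decay away from
  the origin.\<close>

lemma dirichlet_poly_bounds:
  assumes "0 \<le> x" "x \<le> 1"
  shows "\<bar>dirichlet_poly j (x\<^sup>2)\<bar> \<le> 2 * real j + 1" "\<bar>dirichlet_poly j (x\<^sup>2)\<bar> * x \<le> 1"
proof -
  define a where "a = arcsin x"
  have x: "x = sin a" unfolding a_def using assms by simp
  have eq: "\<bar>dirichlet_poly j (x\<^sup>2)\<bar> * x = \<bar>sin ((2 * real j + 1) * a)\<bar>"
    using sin_mult_dirichlet_poly[of a j] assms(1) unfolding x[symmetric]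
    by (metis abs_mult abs_of_nonneg mult.commute)
  then show "\<bar>dirichlet_poly j (x\<^sup>2)\<bar> * x \<le> 1" by simp
  show "\<bar>dirichlet_poly j (x\<^sup>2)\<bar> \<le> 2 * real j + 1"
  proof (cases "x = 0")
    case True
    then show ?thesis by (simp add: dirichlet_poly_0)
  next
    case False
    have "\<bar>sin ((2 * real j + 1) * a)\<bar> \<le> (2 * real j + 1) * \<bar>sin a\<bar>"
      using abs_sin_nat_mult_le[of "2 * j + 1" a] by (simp add: add.commute)
    also have "\<dots> = (2 * real j + 1) * x" using x assms by simp
    finally have "\<bar>dirichlet_poly j (x\<^sup>2)\<bar> * x \<le> (2 * real j + 1) * x"
      unfolding eq .
    then show ?thesis using False assms by simp
  qed
qed

text \<open>Since 1 < pi / 3, the cosine stays above 1 / 2 on the interval, so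
  \<open>sin y - y / 2\<close> increases from 0.\<close>

lemma half_le_sin:
  fixes y :: real
  assumes "0 \<le> y" "y \<le> 1"
  shows "y / 2 \<le> sin y"
proof -
  have "(\<lambda>y. sin y - y / 2) 0 \<le> (\<lambda>y. sin y - y / 2) y"
  proof (rule DERIV_nonneg_imp_nondecreasing[OF assms(1)])
    fix z :: real assume z: "0 \<le> z" "z \<le> y"
    have "((\<lambda>y. sin y - y / 2) has_real_derivative (cos z - 1 / 2)) (at z)"
      by (auto intro!: derivative_eq_intros)
    moreover have "cos (pi / 3) \<le> cos z"
      using z assms pi_gt3 by (intro cos_monotone_0_pi_le) auto
    ultimately show "\<exists>d. ((\<lambda>y. sin y - y / 2) has_real_derivative d) (at z) \<and> 0 \<le> d"
      by (auto simp: cos_60)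
  qed
  then show ?thesis by simp
qed

text \<open>Put \<open>m = 2 * j + 1\<close> and \<open>x = sin a\<close>. Since
  \<open>x \<le> 1 / (2 * m) \<le> sin (1 / m)\<close>, the angle satisfies
  \<open>m * a \<le> 1\<close>, whence \<open>sin (m * a) \<ge> m * a / 2 \<ge> m * x / 2\<close>.
  This central peak bounds the mass of the kernel from below.\<close>

lemma dirichlet_poly_lower:
  assumes "0 \<le> x" "x \<le> 1 / (2 * (2 * real j + 1))"
  shows "(2 * real j + 1) / 2 \<le> dirichlet_poly j (x\<^sup>2)"
proof (cases "x = 0")
  case True
  then show ?thesis by (simp add: dirichlet_poly_0)
next
  case False
  define m where "m = 2 * real j + 1"
  have m: "m \<ge> 1" unfolding m_def by simp
  have "x \<le> 1 / (2 * m)" using assms(2) unfolding m_def .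
  also have "\<dots> \<le> sin (1 / m)" using half_le_sin[of "1 / m"] m by simp
  finally have xs: "x \<le> sin (1 / m)" .
  then have x1: "x \<le> 1" using sin_le_one order_trans by blast
  define a where "a = arcsin x"
  have x: "x = sin a" unfolding a_def using assms x1 by simp
  have "a \<le> arcsin (sin (1 / m))"
    unfolding a_def using assms xs by (intro arcsin_le_arcsin) auto
  also have "\<dots> = 1 / m"
  proof (rule arcsin_sin)
    have "1 / m \<le> 1" using m by simp
    then show "1 / m \<le> pi / 2" using pi_gt3 by linarith
    have "0 \<le> 1 / m" using m by simp
    then show "- (pi / 2) \<le> 1 / m" using pi_gt3 by linarith
  qed
  finally have am: "m * a \<le> 1" using m by (simp add: field_simps)
  have a0: "0 \<le> a" using assms x1 arcsin_le_arcsin[of 0 x] unfolding a_def by simp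
  have "x \<le> a" unfolding x using a0 by (rule sin_x_le_x)
  then have "m / 2 * x \<le> m * a / 2" using m by simp
  also have "\<dots> \<le> sin (m * a)" using half_le_sin am a0 m by simp
  also have "\<dots> = x * dirichlet_poly j (x\<^sup>2)"
    using sin_mult_dirichlet_poly[of a j] unfolding x m_def by simp
  finally have "m / 2 * x \<le> dirichlet_poly j (x\<^sup>2) * x" by (simp add: mult.commute)
  then show ?thesis using False assms unfolding m_def by simp
qed

lemma continuous_on_dirichlet_poly: "continuous_on UNIV (dirichlet_poly j)"
proof -
  have "continuous_on UNIV (\<lambda>x. dirichlet_poly j x)"
    \<comment> \<open>The recursion passes its second argument on unchanged; \<open>0\<close> only
      fills that slot of the induction rule.\<close>
    by (induction j "0::real" rule: dirichlet_poly.induct) (auto intro!: continuous_intros)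
  then show ?thesis by simp
qed

text \<open>\<open>norm t / \<rho>\<close> stands for \<open>sin a\<close>, so estimates hold for
  \<open>norm t \<le> \<rho>\<close> only. Squaring it keeps the kernel a polynomial in the
  coordinates, of degree \<open>4 * r * j\<close>; the even power makes it nonnegative, and
  \<open>r\<close> sets the decay.\<close>

definition jackson_kernel :: "nat \<Rightarrow> nat \<Rightarrow> real \<Rightarrow> 'a::euclidean_space \<Rightarrow> real" where
  "jackson_kernel r j \<rho> t = dirichlet_poly j ((norm t / \<rho>)\<^sup>2) ^ (2 * r)"

section \<open>Size, mass and moments of the Jackson kernel\<close>

lemma jackson_kernel_nonneg: "0 \<le> jackson_kernel r j \<rho> t"
  unfolding jackson_kernel_def by (simp add: power_mult)

lemma continuous_on_jackson_kernel: "continuous_on S (jackson_kernel r j \<rho>)"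
  unfolding jackson_kernel_def[abs_def] divide_inverse
  by (intro continuous_intros continuous_on_compose2[OF continuous_on_dirichlet_poly]) auto

text \<open>The height \<open>m\<close> and the decay \<open>\<rho> / norm t\<close> of the
  Dirichlet factor combine into the single bound \<open>2 * \<rho> * m / (1 + m * norm t)\<close>;
  \<open>1 \<le> \<rho>\<close> lets the height be absorbed.\<close>

lemma jackson_kernel_upper:
  assumes "1 \<le> \<rho>" "norm t \<le> \<rho>"
  shows "jackson_kernel r j \<rho> t
    \<le> (2 * \<rho> * (2 * real j + 1)) ^ (2 * r) / (1 + (2 * real j + 1) * norm t) ^ (2 * r)"
proof -
  define m where "m = 2 * real j + 1"
  have m: "m \<ge> 1" unfolding m_def by simp
  define D where "D = \<bar>dirichlet_poly j ((norm t / \<rho>)\<^sup>2)\<bar>"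
  have D: "D \<le> m" "D * (norm t / \<rho>) \<le> 1" "0 \<le> D"
    using dirichlet_poly_bounds[of "norm t / \<rho>" j] assms unfolding D_def m_def by auto
  have "D * norm t \<le> \<rho>" using D(2) assms by (simp add: field_simps)
  then have "m * (D * norm t) \<le> m * \<rho>" using m by simp
  moreover have "D \<le> m * \<rho>" using D(1) m assms(1) by (metis mult.right_neutral mult_left_mono order_trans zero_le_one)
  ultimately have "D * (1 + m * norm t) \<le> 2 * \<rho> * m" by (simp add: algebra_simps)
  moreover have pos: "0 < 1 + m * norm t" using m by (intro add_pos_nonneg) auto
  ultimately have "D \<le> 2 * \<rho> * m / (1 + m * norm t)" by (simp add: field_simps)
  then have "D ^ (2 * r) \<le> (2 * \<rho> * m / (1 + m * norm t)) ^ (2 * r)"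
    using D(3) by (rule power_mono)
  then show ?thesis unfolding D_def jackson_kernel_def m_def[symmetric]
    by (simp add: power_even_abs power_divide)
qed

lemma jackson_kernel_lower:
  assumes "1 \<le> \<rho>" "norm t \<le> \<rho> / (2 * (2 * real j + 1))"
  shows "((2 * real j + 1) / 2) ^ (2 * r) \<le> jackson_kernel r j \<rho> t"
  unfolding jackson_kernel_def
  by (rule power_mono[OF dirichlet_poly_lower]) (use assms in \<open>auto simp: field_simps\<close>)

lemma integrable_jackson_kernel:
  "integrable lborel (\<lambda>t. indicator (cball 0 \<rho>) t * jackson_kernel r j \<rho> (t::'a::euclidean_space))"
  using borel_integrable_compact[OF compact_cball continuous_on_jackson_kernel] by simp

text \<open>Only the peak \<open>norm t \<le> \<rho> / (2 * m)\<close> is counted, where the kernel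
  is at least \<open>(m / 2)^(2 * r)\<close>. With the volume of the peak this gives the order
  \<open>m^(2 * r - n)\<close>.\<close>

lemma jackson_kernel_mass_lower:
  assumes "1 \<le> \<rho>"
  shows "((2 * real j + 1) / 2) ^ (2 * r) *
      (unit_ball_vol (real DIM('a)) * (\<rho> / (2 * (2 * real j + 1))) ^ DIM('a))
    \<le> (LINT t|lborel. indicator (cball 0 \<rho>) t * jackson_kernel r j \<rho> (t::'a::euclidean_space))"
proof -
  define m where "m = 2 * real j + 1"
  have m: "m \<ge> 1" unfolding m_def by simp
  define e where "e = \<rho> / (2 * m)"
  have e: "0 \<le> e" "e \<le> \<rho>" unfolding e_def using m assms by (auto simp: field_simps)
  have "(m / 2) ^ (2 * r) * (unit_ball_vol (real DIM('a)) * e ^ DIM('a))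
      = (LINT t|lborel. (m / 2) ^ (2 * r) * indicator (cball (0::'a) e) t)"
    using e by (simp add: content_cball)
  also have "\<dots> \<le> (LINT t|lborel. indicator (cball 0 \<rho>) t * jackson_kernel r j \<rho> (t::'a))"
  proof (rule integral_mono)
    show "integrable lborel (\<lambda>t. (m / 2) ^ (2 * r) * indicator (cball (0::'a) e) t)"
      by (intro integrable_mult_right integrable_real_indicator) (auto simp: emeasure_cball e)
    show "integrable lborel (\<lambda>t. indicator (cball 0 \<rho>) t * jackson_kernel r j \<rho> (t::'a))"
      by (rule integrable_jackson_kernel)
    fix t :: 'a
    show "(m / 2) ^ (2 * r) * indicator (cball (0::'a) e) t
        \<le> indicator (cball 0 \<rho>) t * jackson_kernel r j \<rho> t"
      using jackson_kernel_lower[OF assms, of t j r] jackson_kernel_nonneg[of r j \<rho> t] e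
      unfolding e_def m_def[symmetric] by (auto simp: indicator_def)
  qed
  finally show ?thesis unfolding e_def m_def .
qed

text \<open>Of the \<open>2 * r\<close> powers of decay, \<open>2 * k\<close> pay for the moment,
  \<open>n + 2\<close> for integrability, and \<open>l\<close> is the surplus. Substituting
  \<open>s = m * t\<close> turns the remaining integral into \<open>Z / m^n\<close>, so the order is
  \<open>m^(2 * r - 2 * k - n)\<close>.\<close>

lemma jackson_kernel_moment_upper:
  fixes \<rho> :: real and k r :: nat
  assumes "1 \<le> \<rho>" "2 * r = 2 * k + (DIM('a) + 2) + l"
  defines "Z \<equiv> enn2real (\<integral>\<^sup>+s. ennreal (1 / (1 + norm (s::'a::euclidean_space)) ^ (DIM('a) + 2)) \<partial>lborel)"
  shows "(\<integral>\<^sup>+t. ennreal (indicator (cball 0 \<rho>) t * jackson_kernel r j \<rho> (t::'a) * norm t ^ (2 * k)) \<partial>lborel)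
    \<le> ennreal ((2 * \<rho> * (2 * real j + 1)) ^ (2 * r) / ((2 * real j + 1) ^ (2 * k) * (2 * real j + 1) ^ DIM('a)) * Z)"
proof -
  define n where "n = DIM('a)"
  define m where "m = 2 * real j + 1"
  have m: "m \<ge> 1" unfolding m_def by simp
  define c where "c = (2 * \<rho> * m) ^ (2 * r) / m ^ (2 * k)"
  have c0: "0 \<le> c" unfolding c_def using assms m by simp
  have Z: "ennreal Z = (\<integral>\<^sup>+s. ennreal (1 / (1 + norm (s::'a)) ^ (n + 2)) \<partial>lborel)" and Z0: "0 \<le> Z"
    unfolding Z_def n_def using nn_integral_inverse_power_norm_finite[where 'a='a] by auto
  have pt: "indicator (cball 0 \<rho>) t * jackson_kernel r j \<rho> t * norm t ^ (2 * k)
      \<le> c * (1 / (1 + norm (0 + m *\<^sub>R t)) ^ (n + 2))" for t :: 'a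
  proof (cases "norm t \<le> \<rho>")
    case True
    define q where "q = 1 + m * norm t"
    have q: "q \<ge> 1" "m * norm t \<le> q" unfolding q_def using m by auto
    have "(m * norm t) ^ (2 * k) \<le> q ^ (2 * k)" using q m by (intro power_mono) auto
    then have nt: "norm t ^ (2 * k) \<le> q ^ (2 * k) / m ^ (2 * k)"
      using m by (simp add: power_mult_distrib field_simps)
    have "jackson_kernel r j \<rho> t * norm t ^ (2 * k)
        \<le> ((2 * \<rho> * m) ^ (2 * r) / q ^ (2 * r)) * (q ^ (2 * k) / m ^ (2 * k))"
      using jackson_kernel_upper[OF assms(1) True, of r j] nt q jackson_kernel_nonneg[of r j \<rho> t]
      unfolding q_def m_def by (intro mult_mono) auto
    also have "\<dots> = c * (1 / q ^ (n + 2 + l))"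
      using q(1) unfolding c_def assms(2) n_def[symmetric] power_add
      by (simp add: field_simps)
    also have "\<dots> \<le> c * (1 / q ^ (n + 2))"
      using q(1) c0 by (intro mult_left_mono divide_left_mono power_increasing) auto
    finally show ?thesis using True m unfolding q_def by simp
  qed (use c0 in \<open>auto\<close>)
  have "(\<integral>\<^sup>+t. ennreal (indicator (cball 0 \<rho>) t * jackson_kernel r j \<rho> (t::'a) * norm t ^ (2 * k)) \<partial>lborel)
      \<le> (\<integral>\<^sup>+t. ennreal c * ennreal (1 / (1 + norm (0 + m *\<^sub>R t :: 'a)) ^ (n + 2)) \<partial>lborel)"
    by (intro nn_integral_mono) (use pt c0 in \<open>auto simp: ennreal_mult[symmetric] ennreal_leI simp del: add_0\<close>)
  also have "\<dots> = ennreal c * (\<integral>\<^sup>+t. ennreal (1 / (1 + norm (0 + m *\<^sub>R t :: 'a)) ^ (n + 2)) \<partial>lborel)"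
    by (rule nn_integral_cmult) auto
  also have "(\<integral>\<^sup>+t. ennreal (1 / (1 + norm (0 + m *\<^sub>R t :: 'a)) ^ (n + 2)) \<partial>lborel) = ennreal (Z / m ^ n)"
  proof -
    have "ennreal Z = ennreal (\<bar>m\<bar> ^ n) * (\<integral>\<^sup>+t. ennreal (1 / (1 + norm (0 + m *\<^sub>R t :: 'a)) ^ (n + 2)) \<partial>lborel)"
      unfolding Z n_def by (rule nn_integral_lborel_affine) (use m in auto)
    then have "ennreal (1 / m ^ n) * ennreal Z = ennreal (1 / m ^ n) * ennreal (m ^ n) *
        (\<integral>\<^sup>+t. ennreal (1 / (1 + norm (0 + m *\<^sub>R t :: 'a)) ^ (n + 2)) \<partial>lborel)"
      using m by (simp add: mult.assoc)
    also have "ennreal (1 / m ^ n) * ennreal (m ^ n) = 1"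
      using m by (simp add: ennreal_mult[symmetric])
    finally show ?thesis using m Z0 by (simp add: ennreal_mult[symmetric])
  qed
  also have "ennreal c * ennreal (Z / m ^ n) = ennreal ((2 * \<rho> * m) ^ (2 * r) / (m ^ (2 * k) * m ^ n) * Z)"
    using c0 Z0 m unfolding c_def by (simp add: ennreal_mult[symmetric])
  finally show ?thesis unfolding m_def n_def .
qed

text \<open>In the quotient of moment and mass the powers \<open>2 * r\<close> and \<open>n\<close>
  of \<open>m = 2 * j + 1\<close> cancel, which leaves \<open>m^(-2 * k)\<close> with a constant
  fixed before \<open>j\<close>.\<close>

lemma jackson_kernel_normalized:
  fixes \<rho> :: real and k r :: nat
  assumes "1 \<le> \<rho>" "2 * r \<ge> 2 * k + (DIM('a::euclidean_space) + 2)"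
  obtains C where "C > 0"
    "\<And>j. \<exists>c>0. (LINT t|lborel. indicator (cball 0 \<rho>) t * (c * jackson_kernel r j \<rho> (t::'a))) = 1 \<and>
      (\<integral>\<^sup>+t. ennreal (indicator (cball 0 \<rho>) t * (c * jackson_kernel r j \<rho> (t::'a)) * norm t ^ (2 * k)) \<partial>lborel)
        \<le> ennreal (C / (2 * real j + 1) ^ (2 * k))"
proof -
  define n where "n = DIM('a)"
  define V where "V = unit_ball_vol (real n)"
  have V: "V > 0" unfolding V_def by simp
  obtain l where l: "2 * r = 2 * k + (DIM('a) + 2) + l" using assms(2) le_Suc_ex by blast
  define Z where "Z = enn2real (\<integral>\<^sup>+s. ennreal (1 / (1 + norm (s::'a)) ^ (DIM('a) + 2)) \<partial>lborel)"
  have Z0: "0 \<le> Z" unfolding Z_def by simp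
  \<comment> \<open>The factor \<open>4 * \<rho>\<close> is the ratio of the upper height
    \<open>2 * \<rho> * m\<close> to the lower height \<open>m / 2\<close>, and
    \<open>2 / \<rho>\<close> comes from the radius of the peak; adding 1 gives strict
    positivity.\<close>
  define C where "C = (4 * \<rho>) ^ (2 * r) * Z * (2 / \<rho>) ^ n / V + 1"
  have C: "C > 0" unfolding C_def using assms Z0 V by (intro add_nonneg_pos) auto
  show ?thesis
  proof (rule that[OF C])
    fix j
    define m where "m = 2 * real j + 1"
    have m: "m \<ge> 1" unfolding m_def by simp
    define I where "I = (LINT t|lborel. indicator (cball 0 \<rho>) t * jackson_kernel r j \<rho> (t::'a))"
    define L where "L = (m / 2) ^ (2 * r) * (V * (\<rho> / (2 * m)) ^ n)"
    have L0: "L > 0" unfolding L_def using m V assms by simp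
    have LI: "L \<le> I" using jackson_kernel_mass_lower[OF assms(1), of j r, where 'a='a]
      unfolding L_def I_def m_def V_def n_def .
    define c where "c = 1 / I"
    have c: "c > 0" "c \<le> 1 / L" unfolding c_def using L0 LI by (auto simp: field_simps)
    have "(LINT t|lborel. indicator (cball 0 \<rho>) t * (c * jackson_kernel r j \<rho> (t::'a))) = c * I"
      unfolding I_def by (subst integral_mult_right_zero[symmetric]) (simp add: mult_ac)
    also have "\<dots> = 1" unfolding c_def using L0 LI by simp
    finally have one: "(LINT t|lborel. indicator (cball 0 \<rho>) t * (c * jackson_kernel r j \<rho> (t::'a))) = 1" .
    have [measurable]: "(\<lambda>t. jackson_kernel r j \<rho> (t::'a)) \<in> borel_measurable borel"
      by (rule borel_measurable_continuous_onI[OF continuous_on_jackson_kernel])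
    have [measurable]: "cball (0::'a) \<rho> \<in> sets borel" by simp
    have Q0: "0 \<le> (2 * \<rho> * m) ^ (2 * r) / (m ^ (2 * k) * m ^ n) * Z"
      using m assms(1) Z0 by (intro mult_nonneg_nonneg divide_nonneg_nonneg zero_le_power) auto
    have J: "(\<integral>\<^sup>+t. ennreal (indicator (cball 0 \<rho>) t * jackson_kernel r j \<rho> (t::'a) * norm t ^ (2 * k)) \<partial>lborel)
      \<le> ennreal ((2 * \<rho> * m) ^ (2 * r) / (m ^ (2 * k) * m ^ n) * Z)"
      unfolding m_def n_def Z_def by (rule jackson_kernel_moment_upper[OF assms(1) l])
    have "(\<integral>\<^sup>+t. ennreal (indicator (cball 0 \<rho>) t * (c * jackson_kernel r j \<rho> (t::'a)) * norm t ^ (2 * k)) \<partial>lborel)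
      = (\<integral>\<^sup>+t. ennreal c * ennreal (indicator (cball 0 \<rho>) t * jackson_kernel r j \<rho> (t::'a) * norm t ^ (2 * k)) \<partial>lborel)"
      using c(1) jackson_kernel_nonneg
      by (intro nn_integral_cong)
        (subst ennreal_mult[symmetric], auto simp: mult_ac intro!: mult_nonneg_nonneg)
    also have "\<dots> = ennreal c * (\<integral>\<^sup>+t. ennreal (indicator (cball 0 \<rho>) t * jackson_kernel r j \<rho> (t::'a) * norm t ^ (2 * k)) \<partial>lborel)"
      by (rule nn_integral_cmult) measurable
    also have "\<dots> \<le> ennreal c * ennreal ((2 * \<rho> * m) ^ (2 * r) / (m ^ (2 * k) * m ^ n) * Z)"
      using J by (rule mult_left_mono) simp
    also have "\<dots> = ennreal (c * ((2 * \<rho> * m) ^ (2 * r) / (m ^ (2 * k) * m ^ n) * Z))"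
      using c(1) Q0 by (intro ennreal_mult[symmetric]) linarith+
    also have "\<dots> \<le> ennreal ((1 / L) * ((2 * \<rho> * m) ^ (2 * r) / (m ^ (2 * k) * m ^ n) * Z))"
      by (intro ennreal_leI mult_right_mono c(2) Q0)
    also have "(1 / L) * ((2 * \<rho> * m) ^ (2 * r) / (m ^ (2 * k) * m ^ n) * Z)
        = ((4 * \<rho>) ^ (2 * r) * Z * (2 / \<rho>) ^ n / V) / m ^ (2 * k)"
    proof -
      have "2 * \<rho> * m = (4 * \<rho>) * (m / 2)" by simp
      then have 1: "(2 * \<rho> * m) ^ (2 * r) = (4 * \<rho>) ^ (2 * r) * (m / 2) ^ (2 * r)"
        by (simp only: power_mult_distrib)
      have "(\<rho> / (2 * m)) * ((2 / \<rho>) * m) = 1" using m assms(1) by simp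
      then have 2: "(\<rho> / (2 * m)) ^ n * ((2 / \<rho>) ^ n * m ^ n) = 1"
        by (simp only: power_mult_distrib[symmetric] power_one)
      have pos: "(m / 2) ^ (2 * r) > 0" "m ^ n > 0" "m ^ (2 * k) > 0" using m by auto
      \<comment> \<open>With the powers abstracted to variables, only a rational identity
        remains.\<close>
      have gen: "(1 / (B * (V * P))) * ((A * B) / (F * E) * Z) = A * Z * Q / V / F"
        if "P * (Q * E) = 1" "B > 0" "E > 0" "F > 0" for A B E F P Q :: real
      proof -
        have "P \<noteq> 0" using that(1) by auto
        then have "Q = 1 / (P * E)" using that by (simp add: field_simps)
        then show ?thesis using that V \<open>P \<noteq> 0\<close> by (simp add: field_simps)
      qed
      show ?thesis unfolding L_def 1 by (rule gen[OF 2 pos])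
    qed
    also have "ennreal (((4 * \<rho>) ^ (2 * r) * Z * (2 / \<rho>) ^ n / V) / m ^ (2 * k)) \<le> ennreal (C / m ^ (2 * k))"
      unfolding C_def using m by (intro ennreal_leI divide_right_mono) auto
    finally show "\<exists>c>0. (LINT t|lborel. indicator (cball 0 \<rho>) t * (c * jackson_kernel r j \<rho> (t::'a))) = 1 \<and>
      (\<integral>\<^sup>+t. ennreal (indicator (cball 0 \<rho>) t * (c * jackson_kernel r j \<rho> (t::'a)) * norm t ^ (2 * k)) \<partial>lborel)
        \<le> ennreal (C / (2 * real j + 1) ^ (2 * k))"
      using one c(1) unfolding m_def by blast
  qed
qed

section \<open>Multivariate polynomials\<close>

text \<open>Polynomials in \<open>x\<close> with coefficients depending continuously on a parameter
  \<open>y\<close>: they remain polynomials in \<open>x\<close> after integration over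
  \<open>y\<close>. Continuity makes the coefficients integrable against a continuous
  \<open>u\<close> supported in a box.\<close>

definition poly_kernel :: "nat \<Rightarrow> (real^'n \<Rightarrow> 'b::topological_space \<Rightarrow> real) \<Rightarrow> bool" where
  "poly_kernel d G \<longleftrightarrow> (\<exists>c :: ('n \<Rightarrow> nat) \<Rightarrow> 'b \<Rightarrow> real. (\<forall>e. continuous_on UNIV (c e)) \<and>
     (\<forall>x y. G x y = (\<Sum>e\<in>{e. sum e UNIV \<le> d}. c e y * (\<Prod>i\<in>UNIV. (x $ i) ^ e i))))"

lemma poly_kernelE:
  fixes G :: "real^'n \<Rightarrow> 'b::topological_space \<Rightarrow> real"
  assumes "poly_kernel d G"
  obtains c :: "('n \<Rightarrow> nat) \<Rightarrow> 'b \<Rightarrow> real" where "\<And>e. continuous_on UNIV (c e)"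
    "\<And>x y. G x y = (\<Sum>e\<in>{e. sum e UNIV \<le> d}. c e y * (\<Prod>i\<in>UNIV. (x $ i) ^ e i))"
proof -
  from assms obtain c where
    "(\<forall>e. continuous_on UNIV (c e)) \<and>
     (\<forall>x y. G x y = (\<Sum>e\<in>{e. sum e UNIV \<le> d}. c e y * (\<Prod>i\<in>UNIV. (x $ i) ^ e i)))"
    unfolding poly_kernel_def by (elim exE)
  then show thesis by (intro that[of c]) simp_all
qed

lemma finite_exponents: "finite {e :: 'n::finite \<Rightarrow> nat. sum e UNIV \<le> d}"
proof (rule finite_subset)
  show "{e :: 'n \<Rightarrow> nat. sum e UNIV \<le> d} \<subseteq> (UNIV \<rightarrow>\<^sub>E {..d})"
  proof (clarsimp simp: PiE_def Pi_def)
    fix e :: "'n \<Rightarrow> nat" and i assume "sum e UNIV \<le> d"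
    moreover have "e i \<le> sum e UNIV" by (rule member_le_sum) auto
    ultimately show "e i \<le> d" by simp
  qed
  show "finite (UNIV \<rightarrow>\<^sub>E {..d} :: ('n \<Rightarrow> nat) set)" by (rule finite_PiE) auto
qed

lemma poly_kernel_monomial:
  fixes e :: "'n::finite \<Rightarrow> nat"
  assumes "sum e UNIV \<le> d" "continuous_on UNIV c"
  shows "poly_kernel d (\<lambda>x y. c y * (\<Prod>i\<in>UNIV. (x $ i) ^ e i))"
proof -
  have "(\<Sum>e'\<in>{e. sum e UNIV \<le> d}. (if e' = e then c else (\<lambda>_. 0)) y * (\<Prod>i\<in>UNIV. (x $ i) ^ e' i))
      = c y * (\<Prod>i\<in>UNIV. (x $ i) ^ e i)" for x :: "real^'n" and y
    using assms(1) sum.remove[OF finite_exponents, of e d "\<lambda>e'. (if e' = e then c else (\<lambda>_. 0)) y * (\<Prod>i\<in>UNIV. (x $ i) ^ e' i)"]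
    by simp
  then show ?thesis
    unfolding poly_kernel_def using assms(2)
    by (intro exI[of _ "\<lambda>e'. if e' = e then c else (\<lambda>_. 0)"]) auto
qed

lemma poly_kernel_sum:
  assumes "finite A" "\<And>a. a \<in> A \<Longrightarrow> poly_kernel d (G a)"
  shows "poly_kernel d (\<lambda>x y. \<Sum>a\<in>A. G a x y)"
proof -
  from assms(2) have "\<forall>a\<in>A. \<exists>c. (\<forall>e. continuous_on UNIV (c e)) \<and>
     (\<forall>x y. G a x y = (\<Sum>e\<in>{e. sum e UNIV \<le> d}. c e y * (\<Prod>i\<in>UNIV. (x $ i) ^ e i)))"
    unfolding poly_kernel_def by simp
  from bchoice[OF this] obtain c where c': "\<forall>a\<in>A. (\<forall>e. continuous_on UNIV (c a e)) \<and>
     (\<forall>x y. G a x y = (\<Sum>e\<in>{e. sum e UNIV \<le> d}. c a e y * (\<Prod>i\<in>UNIV. (x $ i) ^ e i)))"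
    by (elim exE)
  have c: "continuous_on UNIV (c a e)"
    "G a x y = (\<Sum>e\<in>{e. sum e UNIV \<le> d}. c a e y * (\<Prod>i\<in>UNIV. (x $ i) ^ e i))" if "a \<in> A" for a e x y
    using c' that by blast+
  show ?thesis
    unfolding poly_kernel_def
  proof (intro exI[of _ "\<lambda>e y. \<Sum>a\<in>A. c a e y"] conjI allI)
    show "continuous_on UNIV (\<lambda>y. \<Sum>a\<in>A. c a e y)" for e
      using c(1) by (intro continuous_on_sum) auto
    show "(\<Sum>a\<in>A. G a x y) = (\<Sum>e\<in>{e. sum e UNIV \<le> d}. (\<Sum>a\<in>A. c a e y) * (\<Prod>i\<in>UNIV. (x $ i) ^ e i))" for x y
      by (simp add: c(2) sum_distrib_right) (rule sum.swap)
  qed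
qed

lemma poly_kernel_add:
  assumes "poly_kernel d G" "poly_kernel d H"
  shows "poly_kernel d (\<lambda>x y. G x y + H x y)"
  using poly_kernel_sum[of "UNIV :: bool set" d "\<lambda>b. if b then G else H"] assms
  by (simp add: UNIV_bool add.commute)

lemma poly_kernel_mult:
  fixes G :: "real^'n \<Rightarrow> 'b::topological_space \<Rightarrow> real"
  assumes "poly_kernel d G" "poly_kernel d' H"
  shows "poly_kernel (d + d') (\<lambda>x y. G x y * H x y)"
proof -
  let ?E = "\<lambda>d. {e :: 'n \<Rightarrow> nat. sum e UNIV \<le> d}"
  obtain c where c: "\<And>e. continuous_on UNIV (c e)"
    "\<And>x y. G x y = (\<Sum>e\<in>?E d. c e y * (\<Prod>i\<in>UNIV. (x $ i) ^ e i))"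
    using assms(1) by (rule poly_kernelE) blast
  obtain b where b: "\<And>e. continuous_on UNIV (b e)"
    "\<And>x y. H x y = (\<Sum>e\<in>?E d'. b e y * (\<Prod>i\<in>UNIV. (x $ i) ^ e i))"
    using assms(2) by (rule poly_kernelE) blast
  have "(\<lambda>x y. G x y * H x y) = (\<lambda>x y. \<Sum>p\<in>?E d \<times> ?E d'.
      (c (fst p) y * b (snd p) y) * (\<Prod>i\<in>UNIV. (x $ i) ^ (fst p i + snd p i)))"
    unfolding fun_eq_iff c(2) b(2) sum_product sum.cartesian_product split_def
    by (intro allI sum.cong) (simp_all add: power_add prod.distrib mult_ac)
  moreover have "poly_kernel (d + d') \<dots>"
  proof (rule poly_kernel_sum)
    show "finite (?E d \<times> ?E d')" by (intro finite_cartesian_product finite_exponents)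
    fix p assume "p \<in> ?E d \<times> ?E d'"
    then show "poly_kernel (d + d') (\<lambda>x y. (c (fst p) y * b (snd p) y) *
        (\<Prod>i\<in>UNIV. (x $ i) ^ (fst p i + snd p i)))"
      by (intro poly_kernel_monomial continuous_intros c(1) b(1)) (auto simp: sum.distrib)
  qed
  ultimately show ?thesis by simp
qed

lemma poly_kernel_coeff:
  assumes "continuous_on UNIV c"
  shows "poly_kernel d (\<lambda>x y. c y)"
  using poly_kernel_monomial[of "\<lambda>_. 0" d c] assms by simp

lemma poly_kernel_coord: "poly_kernel 1 (\<lambda>(x::real^'n) y. x $ i)"
proof -
  have "(\<Prod>j\<in>UNIV. (x $ j) ^ (if j = i then 1 else 0)) = x $ i" for x :: "real^'n"
    by (subst prod.remove[of _ i]) auto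
  then show ?thesis
    using poly_kernel_monomial[of "\<lambda>j. if j = i then 1 else 0" 1 "\<lambda>_. 1"] by simp
qed

text \<open>The constant 1 counts as a polynomial of degree at most \<open>d' - d\<close>, so
  multiplying by it raises the degree bound.\<close>

lemma poly_kernel_le_degree:
  assumes "poly_kernel d G" "d \<le> d'"
  shows "poly_kernel d' G"
  using poly_kernel_mult[OF assms(1) poly_kernel_coeff[OF continuous_on_const[of _ 1]], of "d' - d"] assms(2)
  by simp

lemma poly_kernel_cmult: "poly_kernel d G \<Longrightarrow> poly_kernel d (\<lambda>x y. b * G x y)"
  using poly_kernel_mult[OF poly_kernel_coeff[OF continuous_on_const[of _ b], of 0]] by simp

lemma poly_kernel_power: "poly_kernel d G \<Longrightarrow> poly_kernel (k * d) (\<lambda>x y. G x y ^ k)"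
proof (induction k)
  case 0
  show ?case using poly_kernel_coeff[OF continuous_on_const[of _ 1]] by simp
next
  case (Suc k)
  then show ?case using poly_kernel_mult[of d G "k * d" "\<lambda>x y. G x y ^ k"] by simp
qed

lemma poly_kernel_norm_diff_squared:
  "poly_kernel 2 (\<lambda>(x::real^'n) y. (norm (a *\<^sub>R (y - x)) / \<rho>)\<^sup>2)"
proof -
  have eq: "(norm (a *\<^sub>R (y - x)) / \<rho>)\<^sup>2 = (\<Sum>i\<in>UNIV. (a / \<rho>)\<^sup>2 * (y $ i + (-1) * x $ i)\<^sup>2)" for x y :: "real^'n"
    by (simp add: norm_vec_def L2_set_def power_divide power_mult_distrib sum_nonneg
        sum_divide_distrib sum_distrib_left)
  have "poly_kernel (2 * 1) (\<lambda>(x::real^'n) y. \<Sum>i\<in>UNIV. (a / \<rho>)\<^sup>2 * (y $ i + (-1) * x $ i)\<^sup>2)"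
    by (intro poly_kernel_sum poly_kernel_cmult poly_kernel_power poly_kernel_add poly_kernel_coeff
        poly_kernel_coord continuous_intros) auto
  then show ?thesis unfolding eq by simp
qed

lemma poly_kernel_dirichlet_poly:
  assumes "poly_kernel 2 G"
  shows "poly_kernel (2 * j) (\<lambda>x y. dirichlet_poly j (G x y))"
proof (induction j rule: induct_nat_012)
  case 0
  show ?case using poly_kernel_coeff[OF continuous_on_const[of _ 1]] by simp
next
  case 1
  have "poly_kernel 2 (\<lambda>x y. 3 + (-4) * G x y)"
    by (intro poly_kernel_add poly_kernel_cmult poly_kernel_coeff continuous_intros assms)
  then show ?case by simp
next
  case (ge2 j)
  have "poly_kernel (2 + 2 * Suc j) (\<lambda>x y. (2 + (-4) * G x y) * dirichlet_poly (Suc j) (G x y))"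
    by (intro poly_kernel_mult poly_kernel_add poly_kernel_cmult poly_kernel_coeff continuous_intros assms ge2)
  moreover have "poly_kernel (2 + 2 * Suc j) (\<lambda>x y. (-1) * dirichlet_poly j (G x y))"
    by (intro poly_kernel_cmult poly_kernel_le_degree[OF ge2(1)]) simp
  ultimately have "poly_kernel (2 + 2 * Suc j) (\<lambda>x y. (2 + (-4) * G x y) * dirichlet_poly (Suc j) (G x y)
      + (-1) * dirichlet_poly j (G x y))"
    by (rule poly_kernel_add)
  moreover have "(2 + (-4) * z) * dirichlet_poly (Suc j) z + (-1) * dirichlet_poly j z
      = dirichlet_poly (Suc (Suc j)) z" for z
    by simp
  ultimately show ?case by simp
qed

text \<open>\<open>dirichlet_poly j\<close> has degree \<open>j\<close> in the squared norm, hence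
  \<open>2 * j\<close> in \<open>x\<close>; the power \<open>2 * r\<close> turns this into
  \<open>4 * r * j\<close>.\<close>

lemma poly_kernel_jackson_kernel:
  "poly_kernel (4 * r * j) (\<lambda>(x::real^'n) y. jackson_kernel r j \<rho> (a *\<^sub>R (y - x)))"
  unfolding jackson_kernel_def
  using poly_kernel_power[OF poly_kernel_dirichlet_poly[OF poly_kernel_norm_diff_squared, of j a \<rho>], of "2 * r"]
  by (simp add: mult_ac)

lemma poly_fun_integral_poly_kernel:
  fixes G :: "real^'n \<Rightarrow> real^'n \<Rightarrow> real"
  assumes G: "poly_kernel d G" and u: "continuous_on UNIV u" "\<And>y. y \<notin> cbox a b \<Longrightarrow> u y = 0"
  shows "poly_fun d (\<lambda>x. LINT y|lborel. G x y * u y)"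
proof -
  obtain c where c: "\<And>e. continuous_on UNIV (c e)"
    "\<And>x y. G x y = (\<Sum>e\<in>{e :: 'n \<Rightarrow> nat. sum e UNIV \<le> d}. c e y * (\<Prod>i\<in>UNIV. (x $ i) ^ e i))"
    using G by (rule poly_kernelE) blast
  have int: "integrable lborel (\<lambda>y. c e y * u y)" for e
    by (rule integrable_lborel_continuous_compact_support[where a=a and b=b])
      (use c(1) u in \<open>auto intro!: continuous_intros\<close>)
  have "(LINT y|lborel. G x y * u y)
      = (\<Sum>e\<in>{e :: 'n \<Rightarrow> nat. sum e UNIV \<le> d}. (LINT y|lborel. c e y * u y) * (\<Prod>i\<in>UNIV. (x $ i) ^ e i))" for x
  proof -
    have "G x y * u y = (\<Sum>e\<in>{e :: 'n \<Rightarrow> nat. sum e UNIV \<le> d}. (c e y * u y) * (\<Prod>i\<in>UNIV. (x $ i) ^ e i))" for y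
      unfolding c(2) sum_distrib_right by (intro sum.cong) auto
    then show ?thesis using int by simp
  qed
  then show ?thesis unfolding poly_fun_def by (intro exI[of _ "\<lambda>e. LINT y|lborel. c e y * u y"]) auto
qed

text \<open>Polynomials are kernels constant in the parameter, so the closure properties carry over;
  \<open>real\<close> is an arbitrary parameter type.\<close>

lemma poly_fun_iff_poly_kernel: "poly_fun d p \<longleftrightarrow> poly_kernel d (\<lambda>x (y::real). p x)"
proof
  assume "poly_fun d p"
  then obtain c where "p = (\<lambda>x. \<Sum>e\<in>{e. sum e UNIV \<le> d}. c e * (\<Prod>i\<in>UNIV. (x $ i) ^ e i))"
    unfolding poly_fun_def by blast
  then show "poly_kernel d (\<lambda>x (y::real). p x)"
    unfolding poly_kernel_def by (intro exI[of _ "\<lambda>e y. c e"]) auto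
next
  assume "poly_kernel d (\<lambda>x (y::real). p x)"
  then obtain c where c: "\<And>x (y::real). p x = (\<Sum>e\<in>{e. sum e UNIV \<le> d}. c e y * (\<Prod>i\<in>UNIV. (x $ i) ^ e i))"
    by (rule poly_kernelE) blast
  from c[of _ 0] show "poly_fun d p"
    unfolding poly_fun_def by (intro exI[of _ "\<lambda>e. c e 0"]) auto
qed

section \<open>Algebra of polynomial functions\<close>

lemma poly_fun_mult: "poly_fun d p \<Longrightarrow> poly_fun d' q \<Longrightarrow> poly_fun (d + d') (\<lambda>x. p x * q x)"
  unfolding poly_fun_iff_poly_kernel by (rule poly_kernel_mult)

lemma poly_fun_add: "poly_fun d p \<Longrightarrow> poly_fun d q \<Longrightarrow> poly_fun d (\<lambda>x. p x + q x)"
  unfolding poly_fun_iff_poly_kernel by (rule poly_kernel_add)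

lemma poly_fun_cmult: "poly_fun d p \<Longrightarrow> poly_fun d (\<lambda>x. b * p x)"
  unfolding poly_fun_iff_poly_kernel by (rule poly_kernel_cmult)

lemma poly_fun_sum:
  "finite A \<Longrightarrow> (\<And>a. a \<in> A \<Longrightarrow> poly_fun d (p a)) \<Longrightarrow> poly_fun d (\<lambda>x. \<Sum>a\<in>A. p a x)"
  unfolding poly_fun_iff_poly_kernel by (rule poly_kernel_sum)

lemma poly_fun_le_degree: "poly_fun d p \<Longrightarrow> d \<le> d' \<Longrightarrow> poly_fun d' p"
  unfolding poly_fun_iff_poly_kernel by (rule poly_kernel_le_degree)

lemma poly_fun_continuous_on: "poly_fun d p \<Longrightarrow> continuous_on S p"
  unfolding poly_fun_def by (auto intro!: continuous_intros)

section \<open>Polynomial approximation of Jackson type\<close>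

text \<open>Since \<open>(fdiff t ^^ k) u x\<close> contains the term \<open>\<plusminus> u x\<close>, averaging it over \<open>t\<close> against the kernel
  gives \<open>u x\<close> minus convolutions of \<open>u\<close> with rescaled kernels, which are polynomials.\<close>
lemma jackson_approximation:
  fixes R :: real and k :: nat
  assumes R: "1 \<le> R"
  obtains C r where "C > 0" "r > 0"
    "\<And>j (u :: real^'n \<Rightarrow> real) N Bd. \<lbrakk>continuous_on UNIV u; \<And>y. R \<le> norm y \<Longrightarrow> u y = 0;
       \<And>y. \<bar>u y\<bar> \<le> Bd; 0 \<le> N;
       \<And>t. (\<integral>\<^sup>+x. ennreal (((fdiff t ^^ k) u x)\<^sup>2) \<partial>lborel) \<le> ennreal (N * norm t ^ (2 * k))\<rbrakk>
     \<Longrightarrow> \<exists>q. poly_fun (4 * r * j) q \<and> (\<forall>x\<in>ball 0 R. \<bar>q x\<bar> \<le> C * Bd) \<and>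
       (\<integral>\<^sup>+x. ennreal (indicator (ball 0 R) x * (u x - q x)\<^sup>2) \<partial>lborel)
         \<le> ennreal (C * N / (2 * real j + 1) ^ (2 * k))"
proof -
  \<comment> \<open>If \<open>x\<close> and \<open>x + i *\<^sub>R t\<close> both have norm below
    \<open>R\<close> and \<open>i \<ge> 1\<close>, then \<open>norm t < 2 * R\<close>; this radius
    covers every displacement that meets the support of \<open>u\<close>.\<close>
  define \<rho> where "\<rho> = 2 * R"
  define n where "n = CARD('n)"
  \<comment> \<open>Then \<open>2 * r = 2 * k + 2 * n + 2\<close>, at least the
    \<open>2 * k + n + 2\<close> that the moment bound requires.\<close>
  define r where "r = k + n + 1"
  have n: "n = DIM(real^'n)" unfolding n_def by simp
  obtain C0 where C0: "C0 > 0"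
    "\<And>j. \<exists>c>0. (LINT t|lborel. indicator (cball 0 \<rho>) t * (c * jackson_kernel r j \<rho> (t::real^'n))) = 1 \<and>
      (\<integral>\<^sup>+t. ennreal (indicator (cball 0 \<rho>) t * (c * jackson_kernel r j \<rho> (t::real^'n)) * norm t ^ (2 * k)) \<partial>lborel)
        \<le> ennreal (C0 / (2 * real j + 1) ^ (2 * k))"
    using jackson_kernel_normalized[of \<rho> k r, where 'a="real^'n"] R
    unfolding \<rho>_def r_def n by auto
  obtain a :: "nat \<Rightarrow> real" where a0: "a 0 = (-1) ^ k"
    and a: "\<And>(u :: real^'n \<Rightarrow> real) t x. (fdiff t ^^ k) u x = (\<Sum>i\<le>k. a i * u (x + real i *\<^sub>R t))"
    using fdiff_funpow_eq_sum by blast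
  define C where "C = C0 + (\<Sum>i\<in>{1..k}. \<bar>a i\<bar>)"
  have C: "C > 0" "C0 \<le> C" "(\<Sum>i\<in>{1..k}. \<bar>a i\<bar>) \<le> C"
    unfolding C_def using C0(1) by (auto simp: sum_nonneg add_pos_nonneg)
  show ?thesis
  proof (rule that[OF C(1), of r])
    show "r > 0" unfolding r_def by simp
    fix j and u :: "real^'n \<Rightarrow> real" and N Bd :: real
    assume u: "continuous_on UNIV u" and supp: "\<And>y. R \<le> norm y \<Longrightarrow> u y = 0"
      and Bd: "\<And>y. \<bar>u y\<bar> \<le> Bd" and N: "0 \<le> N"
      and diff: "\<And>t. (\<integral>\<^sup>+x. ennreal (((fdiff t ^^ k) u x)\<^sup>2) \<partial>lborel) \<le> ennreal (N * norm t ^ (2 * k))"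
    obtain c where c: "c > 0"
      and one: "(LINT t|lborel. indicator (cball 0 \<rho>) t * (c * jackson_kernel r j \<rho> (t::real^'n))) = 1"
      and mom: "(\<integral>\<^sup>+t. ennreal (indicator (cball 0 \<rho>) t * (c * jackson_kernel r j \<rho> (t::real^'n)) * norm t ^ (2 * k)) \<partial>lborel)
        \<le> ennreal (C0 / (2 * real j + 1) ^ (2 * k))"
      using C0(2)[of j] by blast
    define \<kappa> where "\<kappa> t = c * jackson_kernel r j \<rho> (t::real^'n)" for t
    define w where "w t = indicator (cball 0 \<rho>) t * \<kappa> t" for t
    have \<kappa>c: "continuous_on UNIV \<kappa>"
      unfolding \<kappa>_def by (intro continuous_intros continuous_on_jackson_kernel)
    have [measurable]: "\<kappa> \<in> borel_measurable borel" "u \<in> borel_measurable borel"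
      using \<kappa>c u by (auto intro: borel_measurable_continuous_onI)
    have [measurable]: "cball (0::real^'n) \<rho> \<in> sets borel" "ball (0::real^'n) R \<in> sets borel" by auto
    have [measurable]: "w \<in> borel_measurable borel" unfolding w_def by measurable
    have w0: "0 \<le> w t" for t unfolding w_def \<kappa>_def
      using c by (intro mult_nonneg_nonneg jackson_kernel_nonneg) auto
    have w1: "(LINT t|lborel. w t) = 1" unfolding w_def \<kappa>_def by (rule one)
    \<comment> \<open>A non-integrable function has integral 0 by convention, so the value 1 forces
      integrability.\<close>
    have wi: "integrable lborel w"
      using w1 not_integrable_integral_eq by fastforce
    have wui: "integrable lborel (\<lambda>t. w t * u (x + s *\<^sub>R t))" for x s
    proof (rule Bochner_Integration.integrable_bound)
      show "integrable lborel (\<lambda>t. w t * Bd)" using wi by simp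
      show "AE t in lborel. norm (w t * u (x + s *\<^sub>R t)) \<le> norm (w t * Bd)"
      proof (rule AE_I2)
        fix t
        show "norm (w t * u (x + s *\<^sub>R t)) \<le> norm (w t * Bd)"
          using Bd[of "x + s *\<^sub>R t"] w0[of t] by (simp add: abs_mult mult_left_mono)
      qed
    qed measurable
    \<comment> \<open>The average of \<open>u\<close> around \<open>x\<close> on scale
      \<open>i\<close>; as \<open>w\<close> is a probability density, it inherits the bound
      \<open>Bd\<close>.\<close>
    define L where "L i x = (LINT t|lborel. w t * u (x + real i *\<^sub>R t))" for i x
    have L_bound: "\<bar>L i x\<bar> \<le> Bd" for i x
    proof -
      have "\<bar>L i x\<bar> \<le> (LINT t|lborel. norm (w t * u (x + real i *\<^sub>R t)))"
        unfolding L_def using integral_norm_bound[of lborel "\<lambda>t. w t * u (x + real i *\<^sub>R t)"] by simp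
      also have "\<dots> \<le> (LINT t|lborel. w t * Bd)"
        using w0 Bd by (intro integral_mono integrable_norm wui integrable_mult_left wi)
          (auto simp: abs_mult mult_left_mono)
      also have "\<dots> = Bd" using w1 by simp
      finally show ?thesis .
    qed
    \<comment> \<open>The averaged difference solved for \<open>u x\<close>, which is the term
      \<open>i = 0\<close>. The substitution \<open>y = x + i *\<^sub>R t\<close> accounts for
      \<open>1 / i^n\<close>, and the kernel is taken without the indicator so that \<open>q\<close>
      is a polynomial.\<close>
    define q where "q x = (\<Sum>i\<in>{1..k}. (- ((-1) ^ k) * a i * c / real i ^ n) *
        (LINT y|lborel. jackson_kernel r j \<rho> ((1 / real i) *\<^sub>R (y - x)) * u y))" for x
    have bounded: "bounded {y. norm y \<le> R}" by (auto simp: bounded_iff)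
    then obtain la lb :: "real^'n" where "{y. norm y \<le> R} \<subseteq> cbox la lb"
      using bounded_subset_cbox_symmetric by blast
    then have cb: "u y = 0" if "y \<notin> cbox la lb" for y
      using supp[of y] that by force
    have poly: "poly_fun (4 * r * j) q"
      unfolding q_def
      by (intro poly_fun_sum poly_fun_cmult poly_fun_integral_poly_kernel[OF poly_kernel_jackson_kernel u cb]) auto
    \<comment> \<open>For these \<open>x\<close>, restricting the kernel to
      \<open>cball 0 \<rho>\<close> changes nothing: where the indicator vanishes, so does
      \<open>u\<close>.\<close>
    have qL: "q x = (\<Sum>i\<in>{1..k}. - ((-1) ^ k) * a i * L i x)" if x: "x \<in> ball 0 R" for x
      unfolding q_def
    proof (rule sum.cong[OF refl])
      fix i assume "i \<in> {1..k}"
      then have i: "i \<ge> 1" by simp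
      have "(LINT y|lborel. \<kappa> ((1 / real i) *\<^sub>R (y - x)) * u y)
          = \<bar>real i\<bar> ^ DIM(real^'n) * (LINT t|lborel. \<kappa> ((1 / real i) *\<^sub>R ((x + real i *\<^sub>R t) - x)) * u (x + real i *\<^sub>R t))"
        by (rule integral_lborel_affine) (use i in auto)
      also have "(LINT t|lborel. \<kappa> ((1 / real i) *\<^sub>R ((x + real i *\<^sub>R t) - x)) * u (x + real i *\<^sub>R t)) = L i x"
        unfolding L_def
      proof (rule Bochner_Integration.integral_cong[OF refl])
        fix t
        have "norm t \<le> \<rho>" if "u (x + real i *\<^sub>R t) \<noteq> 0"
        proof -
          have "norm (x + real i *\<^sub>R t) < R" using supp that by force
          then have "norm (real i *\<^sub>R t) < 2 * R"
            using x norm_triangle_ineq4[of "x + real i *\<^sub>R t" x] by simp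
          moreover have "1 * norm t \<le> real i * norm t" using i by (intro mult_right_mono) auto
          ultimately show ?thesis unfolding \<rho>_def by simp
        qed
        then show "\<kappa> ((1 / real i) *\<^sub>R ((x + real i *\<^sub>R t) - x)) * u (x + real i *\<^sub>R t) = w t * u (x + real i *\<^sub>R t)"
          using i unfolding w_def by (auto simp: indicator_def)
      qed
      finally have "c * (LINT y|lborel. jackson_kernel r j \<rho> ((1 / real i) *\<^sub>R (y - x)) * u y) = real i ^ n * L i x"
        unfolding \<kappa>_def n by (simp add: mult.assoc)
      then show "(- ((-1) ^ k) * a i * c / real i ^ n) *
          (LINT y|lborel. jackson_kernel r j \<rho> ((1 / real i) *\<^sub>R (y - x)) * u y) = - ((-1) ^ k) * a i * L i x"
        using i by (simp add: field_simps)
    qed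
    have qb: "\<bar>q x\<bar> \<le> C * Bd" if x: "x \<in> ball 0 R" for x
    proof -
      have Bd0: "0 \<le> Bd" using Bd[of 0] by linarith
      have "\<bar>q x\<bar> \<le> (\<Sum>i\<in>{1..k}. \<bar>- ((-1) ^ k) * a i * L i x\<bar>)"
        unfolding qL[OF x] by (rule sum_abs)
      also have "\<dots> \<le> (\<Sum>i\<in>{1..k}. \<bar>a i\<bar> * Bd)"
        using L_bound by (intro sum_mono) (auto simp: abs_mult mult_left_mono)
      also have "\<dots> \<le> C * Bd"
        unfolding sum_distrib_right[symmetric] using C(3) Bd0 by (rule mult_right_mono)
      finally show ?thesis .
    qed
    \<comment> \<open>The averaged difference is \<open>(-1)^k * (u x - q x)\<close>, and the sign
      disappears on squaring.\<close>
    have err: "(u x - q x)\<^sup>2 = (LINT t|lborel. w t * (fdiff t ^^ k) u x)\<^sup>2" if x: "x \<in> ball 0 R" for x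
    proof -
      have "(LINT t|lborel. w t * (fdiff t ^^ k) u x) = (LINT t|lborel. (\<Sum>i\<le>k. a i * (w t * u (x + real i *\<^sub>R t))))"
        unfolding a by (simp add: sum_distrib_left mult_ac)
      also have "\<dots> = (\<Sum>i\<le>k. a i * L i x)"
        unfolding L_def using wui by simp
      also have "\<dots> = a 0 * L 0 x + (\<Sum>i\<in>{1..k}. a i * L i x)"
      proof -
        have "{..k} = insert 0 {1..k}" by auto
        then show ?thesis by simp
      qed
      also have "L 0 x = u x" unfolding L_def using w1 by simp
      finally have eq: "(LINT t|lborel. w t * (fdiff t ^^ k) u x) = (-1) ^ k * u x + (\<Sum>i\<in>{1..k}. a i * L i x)"
        unfolding a0 .
      have q': "q x = - ((-1) ^ k) * (\<Sum>i\<in>{1..k}. a i * L i x)"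
        unfolding qL[OF x] by (simp add: sum_distrib_left mult.assoc)
      have sg: "(-1) ^ k * (-1) ^ k = (1::real)"
        by (simp only: power_mult_distrib[symmetric]) simp
      then have "u x - q x = (-1) ^ k * (LINT t|lborel. w t * (fdiff t ^^ k) u x)"
        unfolding eq q' distrib_left mult.assoc[symmetric] by simp
      then show ?thesis by (simp add: power_mult_distrib power2_eq_square[of "(-1) ^ k"] sg)
    qed
    have Dm [measurable]: "(\<lambda>(t, x). (fdiff t ^^ k) u x) \<in> borel_measurable (borel \<Otimes>\<^sub>M borel)"
      unfolding borel_prod by (rule borel_measurable_continuous_onI[OF continuous_on_fdiff_funpow[OF u]])
    have Dt: "(\<lambda>t. (fdiff t ^^ k) u x) \<in> borel_measurable borel" for x
      using measurable_compose[OF measurable_Pair1' Dm] by fastforce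
    have Dx [measurable]: "(\<lambda>x. (fdiff t ^^ k) u x) \<in> borel_measurable borel" for t
      using measurable_compose[OF measurable_Pair1' Dm] by fastforce
    have "(\<integral>\<^sup>+x. ennreal (indicator (ball 0 R) x * (u x - q x)\<^sup>2) \<partial>lborel)
        \<le> (\<integral>\<^sup>+x. \<integral>\<^sup>+t. ennreal (w t * ((fdiff t ^^ k) u x)\<^sup>2) \<partial>lborel \<partial>lborel)"
    proof (rule nn_integral_mono)
      fix x
      show "ennreal (indicator (ball 0 R) x * (u x - q x)\<^sup>2)
          \<le> (\<integral>\<^sup>+t. ennreal (w t * ((fdiff t ^^ k) u x)\<^sup>2) \<partial>lborel)"
      proof (cases "x \<in> ball 0 R")
        case True
        then show ?thesis
          using square_integral_le_integral_square[OF wi w0 w1, of "\<lambda>t. (fdiff t ^^ k) u x"] Dt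
          by (simp add: err)
      qed simp
    qed
    also have "\<dots> = (\<integral>\<^sup>+t. \<integral>\<^sup>+x. ennreal (w t * ((fdiff t ^^ k) u x)\<^sup>2) \<partial>lborel \<partial>lborel)"
      by (rule lborel_pair.Fubini') (use Dm in \<open>measurable\<close>)
    also have "\<dots> \<le> (\<integral>\<^sup>+t. ennreal N * ennreal (w t * norm t ^ (2 * k)) \<partial>lborel)"
    proof (rule nn_integral_mono)
      fix t
      have "(\<integral>\<^sup>+x. ennreal (w t * ((fdiff t ^^ k) u x)\<^sup>2) \<partial>lborel)
          = ennreal (w t) * (\<integral>\<^sup>+x. ennreal (((fdiff t ^^ k) u x)\<^sup>2) \<partial>lborel)"
        using w0 by (simp add: ennreal_mult nn_integral_cmult)
      also have "\<dots> \<le> ennreal (w t) * ennreal (N * norm t ^ (2 * k))"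
        using diff by (intro mult_left_mono) auto
      also have "\<dots> = ennreal N * ennreal (w t * norm t ^ (2 * k))"
        using w0 N by (simp add: ennreal_mult[symmetric] mult_ac)
      finally show "(\<integral>\<^sup>+x. ennreal (w t * ((fdiff t ^^ k) u x)\<^sup>2) \<partial>lborel) \<le> ennreal N * ennreal (w t * norm t ^ (2 * k))" .
    qed
    also have "\<dots> = ennreal N * (\<integral>\<^sup>+t. ennreal (w t * norm t ^ (2 * k)) \<partial>lborel)"
      by (rule nn_integral_cmult) measurable
    also have "\<dots> \<le> ennreal N * ennreal (C0 / (2 * real j + 1) ^ (2 * k))"
      using mom unfolding w_def \<kappa>_def by (intro mult_left_mono) auto
    also have "\<dots> = ennreal (C0 * (N / (2 * real j + 1) ^ (2 * k)))"
      using N C0(1) by (simp add: ennreal_mult[symmetric] mult_ac)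
    also have "\<dots> \<le> ennreal (C * N / (2 * real j + 1) ^ (2 * k))"
      using mult_right_mono[OF C(2), of "N / (2 * real j + 1) ^ (2 * k)"] N by (intro ennreal_leI) simp
    finally show "\<exists>q. poly_fun (4 * r * j) q \<and> (\<forall>x\<in>ball 0 R. \<bar>q x\<bar> \<le> C * Bd) \<and>
       (\<integral>\<^sup>+x. ennreal (indicator (ball 0 R) x * (u x - q x)\<^sup>2) \<partial>lborel)
         \<le> ennreal (C * N / (2 * real j + 1) ^ (2 * k))"
      using poly qb by blast
  qed
qed

section \<open>Orthogonal projection onto polynomials\<close>

text \<open>Functions are not identified up to null sets, so the form
  \<open>LINT y|M. u y * v y\<close> is only semidefinite on \<open>V\<close> and may have null
  vectors.\<close>

locale L2_functions =
  fixes M :: "'a measure" and V :: "('a \<Rightarrow> real) set"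
  assumes integrable_mult: "u \<in> V \<Longrightarrow> v \<in> V \<Longrightarrow> integrable M (\<lambda>y. u y * v y)"
    and add_mem: "u \<in> V \<Longrightarrow> v \<in> V \<Longrightarrow> (\<lambda>y. u y + v y) \<in> V"
    and cmult_mem: "u \<in> V \<Longrightarrow> (\<lambda>y. c * u y) \<in> V"
    and nonempty: "V \<noteq> {}"
begin

lemma diff_cmult_mem: "u \<in> V \<Longrightarrow> v \<in> V \<Longrightarrow> (\<lambda>y. u y - c * v y) \<in> V"
  using add_mem[OF _ cmult_mem, of u v "- c"] by simp

lemma diff_mem: "u \<in> V \<Longrightarrow> v \<in> V \<Longrightarrow> (\<lambda>y. u y - v y) \<in> V"
  using diff_cmult_mem[of u v 1] by simp

lemma zero_mem: "(\<lambda>y. 0) \<in> V"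
  using nonempty cmult_mem[of _ 0] by auto

lemma sum_mem: "finite I \<Longrightarrow> (\<And>i. i \<in> I \<Longrightarrow> b i \<in> V) \<Longrightarrow> (\<lambda>y. \<Sum>i\<in>I. c i * b i y) \<in> V"
  by (induction I rule: finite_induct) (auto intro!: add_mem cmult_mem zero_mem)

lemma integral_mult_diff_cmult:
  assumes "u \<in> V" "v \<in> V" "w \<in> V"
  shows "(LINT y|M. (u y - c * v y) * w y) = (LINT y|M. u y * w y) - c * (LINT y|M. v y * w y)"
proof -
  have "(LINT y|M. (u y - c * v y) * w y) = (LINT y|M. u y * w y - c * (v y * w y))"
    by (simp add: algebra_simps)
  then show ?thesis using assms by (simp add: integrable_mult)
qed

lemma integral_mult_eq_0_of_null:
  assumes "u \<in> V" "r \<in> V" "(LINT y|M. r y * r y) = 0"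
  shows "(LINT y|M. u y * r y) = 0"
proof -
  have "AE y in M. r y * r y = 0"
    using integral_nonneg_eq_0_iff_AE[OF integrable_mult[OF assms(2,2)]] assms(3) by simp
  then have "AE y in M. u y * r y = 0" by eventually_elim simp
  then show ?thesis by (rule integral_eq_zero_AE)
qed

text \<open>Gram-Schmidt for a possibly dependent family. \<open>h\<close> is left free because the
  induction hypothesis is used twice: for the new vector \<open>b i0\<close>, with residue
  \<open>r\<close>, and for \<open>h\<close>, with residue \<open>h'\<close>.\<close>

lemma orthogonal_projection_exists:
  assumes "finite I" "\<And>i. i \<in> I \<Longrightarrow> b i \<in> V" "h \<in> V"
  shows "\<exists>c. \<forall>i\<in>I. (LINT y|M. (h y - (\<Sum>l\<in>I. c l * b l y)) * b i y) = 0"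
  using assms
proof (induction I arbitrary: h rule: finite_induct)
  case (insert i0 I)
  have bV: "b i0 \<in> V" "\<And>i. i \<in> I \<Longrightarrow> b i \<in> V" using insert.prems by auto
  obtain a where a: "\<And>i. i \<in> I \<Longrightarrow> (LINT y|M. (b i0 y - (\<Sum>l\<in>I. a l * b l y)) * b i y) = 0"
    using insert.IH[OF bV(2) bV(1)] by blast
  obtain c where c: "\<And>i. i \<in> I \<Longrightarrow> (LINT y|M. (h y - (\<Sum>l\<in>I. c l * b l y)) * b i y) = 0"
    using insert.IH[OF bV(2) insert.prems(2)] by blast
  define r where "r y = b i0 y - (\<Sum>l\<in>I. a l * b l y)" for y
  define h' where "h' y = h y - (\<Sum>l\<in>I. c l * b l y)" for y
  have rV: "r \<in> V" unfolding r_def[abs_def]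
    by (intro diff_mem sum_mem insert.hyps bV)
  have h'V: "h' \<in> V" unfolding h'_def[abs_def]
    by (intro diff_mem sum_mem insert.hyps bV insert.prems)
  \<comment> \<open>If \<open>r\<close> is null, division by zero makes \<open>\<tau>\<close> zero,
    and \<open>h'\<close> is already orthogonal to \<open>r\<close> by
    \<open>integral_mult_eq_0_of_null\<close>.\<close>
  define \<tau> where "\<tau> = (LINT y|M. h' y * r y) / (LINT y|M. r y * r y)"
  define h'' where "h'' y = h' y - \<tau> * r y" for y
  have h''V: "h'' \<in> V" unfolding h''_def[abs_def] by (intro diff_cmult_mem h'V rV)
  have orth: "(LINT y|M. h'' y * b i y) = 0" if "i \<in> I" for i
    unfolding h''_def using integral_mult_diff_cmult[OF h'V rV bV(2)[OF that]] a[OF that] c[OF that]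
    unfolding r_def h'_def by simp
  have "(LINT y|M. h'' y * r y) = (LINT y|M. h' y * r y) - \<tau> * (LINT y|M. r y * r y)"
    unfolding h''_def by (rule integral_mult_diff_cmult[OF h'V rV rV])
  also have "\<dots> = 0"
    using integral_mult_eq_0_of_null[OF h'V rV] unfolding \<tau>_def by (cases "(LINT y|M. r y * r y) = 0") auto
  finally have orth_r: "(LINT y|M. h'' y * r y) = 0" .
  have orth0: "(LINT y|M. h'' y * b i0 y) = 0"
  proof -
    have "(LINT y|M. h'' y * b i0 y) = (LINT y|M. h'' y * r y + (\<Sum>l\<in>I. a l * (h'' y * b l y)))"
    proof -
      have "h'' y * b i0 y = h'' y * r y + (\<Sum>l\<in>I. a l * (h'' y * b l y))" for y
        unfolding r_def right_diff_distrib sum_distrib_left by (simp add: mult.left_commute)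
      then show ?thesis by simp
    qed
    also have "\<dots> = (LINT y|M. h'' y * r y) + (\<Sum>l\<in>I. a l * (LINT y|M. h'' y * b l y))"
      using integrable_mult[OF h''V rV] integrable_mult[OF h''V bV(2)] by simp
    finally show ?thesis using orth_r orth by simp
  qed
  define c' where "c' l = (if l = i0 then \<tau> else c l - \<tau> * a l)" for l
  have "(\<Sum>l\<in>insert i0 I. c' l * b l y) = \<tau> * b i0 y + (\<Sum>l\<in>I. (c l - \<tau> * a l) * b l y)" for y
  proof -
    have "(\<Sum>l\<in>I. c' l * b l y) = (\<Sum>l\<in>I. (c l - \<tau> * a l) * b l y)"
      using insert.hyps by (intro sum.cong) (auto simp: c'_def)
    then show ?thesis using insert.hyps by (simp add: c'_def)
  qed
  then have "h y - (\<Sum>l\<in>insert i0 I. c' l * b l y) = h'' y" for y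
    unfolding h''_def h'_def r_def
    by (simp only: left_diff_distrib sum_subtractf right_diff_distrib sum_distrib_left mult.assoc)
  with orth orth0 show ?case by (intro exI[of _ c']) auto
qed simp

end

text \<open>Everything follows from the orthogonality that defines the chosen polynomial, whichever
  one \<open>SOME\<close> picks. Pythagoras with \<open>q = p\<close> gives the norm identity, with
  \<open>p - q\<close> the best approximation property; through the latter any explicit approximant
  bounds the projection error.\<close>

lemma proj_norm2_properties:
  fixes M :: "(real^'n) measure"
  assumes "L2_functions M V" and polyV: "\<And>p. poly_fun d p \<Longrightarrow> p \<in> V" and hV: "h \<in> V"
  shows "\<exists>p. poly_fun d p \<and>
    proj_norm2 M d h = (LINT y|M. (h y)\<^sup>2) - (LINT y|M. (h y - p y)\<^sup>2) \<and>
    (\<forall>q. poly_fun d q \<longrightarrow> (LINT y|M. (h y - p y)\<^sup>2) \<le> (LINT y|M. (h y - q y)\<^sup>2))"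
proof -
  interpret L2_functions M V by fact
  let ?P = "\<lambda>p. poly_fun d p \<and> (\<forall>q. poly_fun d q \<longrightarrow> (LINT y|M. (h y - p y) * q y) = 0)"
  let ?E = "{e :: 'n \<Rightarrow> nat. sum e UNIV \<le> d}"
  define b :: "('n \<Rightarrow> nat) \<Rightarrow> real^'n \<Rightarrow> real" where "b e x = (\<Prod>i\<in>UNIV. (x $ i) ^ e i)" for e x
  have b_poly: "poly_fun d (b e)" if "e \<in> ?E" for e
    using poly_kernel_monomial[of e d "\<lambda>_::real. 1"] that
    by (simp add: poly_fun_iff_poly_kernel b_def[abs_def])
  obtain c where c: "\<And>e. e \<in> ?E \<Longrightarrow> (LINT y|M. (h y - (\<Sum>l\<in>?E. c l * b l y)) * b e y) = 0"
    using orthogonal_projection_exists[of ?E b, OF finite_exponents polyV[OF b_poly] hV] by blast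
  define p0 where "p0 y = (\<Sum>l\<in>?E. c l * b l y)" for y
  have p0: "poly_fun d p0" unfolding poly_fun_def p0_def[abs_def] b_def
    by (rule exI[of _ c]) (rule refl)
  have h0V: "(\<lambda>y. h y - p0 y) \<in> V" by (intro diff_mem hV polyV p0)
  have "?P p0"
  proof (intro conjI p0 allI impI)
    fix q :: "real^'n \<Rightarrow> real" assume "poly_fun d q"
    then obtain a where q: "q = (\<lambda>y. \<Sum>e\<in>?E. a e * b e y)" unfolding poly_fun_def b_def
      by (elim exE)
    have "(LINT y|M. (h y - p0 y) * q y) = (LINT y|M. (\<Sum>e\<in>?E. a e * ((h y - p0 y) * b e y)))"
      unfolding q sum_distrib_left by (simp only: mult.left_commute)
    also have "\<dots> = (\<Sum>e\<in>?E. a e * (LINT y|M. (h y - p0 y) * b e y))"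
      using integrable_mult[OF h0V polyV[OF b_poly]] by simp
    also have "\<dots> = 0" using c unfolding p0_def by simp
    finally show "(LINT y|M. (h y - p0 y) * q y) = 0" .
  qed
  then have P: "?P (SOME p. ?P p)" by (rule someI[of ?P])
  define p where "p = (SOME p. ?P p)"
  have p: "poly_fun d p"
    using P unfolding p_def[symmetric] by (rule conjunct1)
  have orth: "\<And>q. poly_fun d q \<Longrightarrow> (LINT y|M. (h y - p y) * q y) = 0"
    using P unfolding p_def[symmetric] by simp
  have pV: "p \<in> V" by (rule polyV[OF p])
  have hpV: "(\<lambda>y. h y - p y) \<in> V" by (intro diff_mem hV pV)
  have pyth: "(LINT y|M. ((h y - p y) + q y)\<^sup>2) = (LINT y|M. (h y - p y)\<^sup>2) + (LINT y|M. (q y)\<^sup>2)"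
    if q: "poly_fun d q" for q
  proof -
    have "(LINT y|M. ((h y - p y) + q y)\<^sup>2)
        = (LINT y|M. (h y - p y) * (h y - p y) + 2 * ((h y - p y) * q y) + q y * q y)"
      by (simp add: power2_eq_square algebra_simps)
    also have "\<dots> = (LINT y|M. (h y - p y) * (h y - p y)) + 2 * (LINT y|M. (h y - p y) * q y) + (LINT y|M. q y * q y)"
      using integrable_mult[OF hpV hpV] integrable_mult[OF hpV polyV[OF q]] integrable_mult[OF polyV[OF q] polyV[OF q]]
      by simp
    finally show ?thesis using orth[OF q] by (simp add: power2_eq_square)
  qed
  show ?thesis
  proof (intro exI[of _ p] conjI allI impI p)
    show "proj_norm2 M d h = (LINT y|M. (h y)\<^sup>2) - (LINT y|M. (h y - p y)\<^sup>2)"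
      using pyth[OF p] unfolding proj_norm2_def Let_def p_def[symmetric] by simp
    fix q :: "real^'n \<Rightarrow> real" assume q: "poly_fun d q"
    have pq: "poly_fun d (\<lambda>y. p y + (-1) * q y)" by (intro poly_fun_add poly_fun_cmult p q)
    have "(LINT y|M. (h y - q y)\<^sup>2) = (LINT y|M. (h y - p y)\<^sup>2) + (LINT y|M. (p y - q y)\<^sup>2)"
      using pyth[OF pq] by simp
    moreover have "0 \<le> (LINT y|M. (p y - q y)\<^sup>2)" by simp
    ultimately show "(LINT y|M. (h y - p y)\<^sup>2) \<le> (LINT y|M. (h y - q y)\<^sup>2)" by linarith
  qed
qed

text \<open>Continuity is imposed only on \<open>X\<close>, where the measure lives; compactness of
  \<open>X\<close> then makes products integrable. Lebesgue measurability on the whole space is what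
  the density representation asks for.\<close>

lemma L2_functions_mu_meas:
  fixes X :: "(real^'n) set"
  assumes X: "compact X" and f: "continuous_on X f" "\<And>x. x \<in> X \<Longrightarrow> 0 \<le> f x"
  shows "L2_functions (mu_meas X f) {u \<in> borel_measurable lebesgue. continuous_on X u}"
    and "u \<in> borel_measurable lebesgue \<Longrightarrow>
      (LINT y|mu_meas X f. u y) = (LINT y|lebesgue. indicator X y * f y * u y)"
proof -
  have cont_int: "integrable lebesgue (\<lambda>y. indicator X y * u y)" if "continuous_on X u" for u :: "real^'n \<Rightarrow> real"
  proof -
    have i: "integrable lborel (\<lambda>y. indicator X y * u y)"
      using borel_integrable_compact[OF X that] by simp
    show ?thesis
      using i integrable_completion[OF borel_measurable_integrable[OF i]] by (rule iffD2[rotated])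
  qed
  have fm: "(\<lambda>y. indicator X y * f y) \<in> borel_measurable lebesgue"
    using cont_int[OF f(1)] by (rule borel_measurable_integrable)
  have f0: "AE y in lebesgue. 0 \<le> indicator X y * f y"
    by (rule AE_I2) (auto simp: indicator_def f(2))
  show "(LINT y|mu_meas X f. u y) = (LINT y|lebesgue. indicator X y * f y * u y)"
    if "u \<in> borel_measurable lebesgue" for u
    unfolding mu_meas_def integral_density[OF that fm f0] by (simp only: real_scaleR_def)
  show "L2_functions (mu_meas X f) {u \<in> borel_measurable lebesgue. continuous_on X u}"
  proof
    fix u v :: "real^'n \<Rightarrow> real" and c :: real
    assume u: "u \<in> {u \<in> borel_measurable lebesgue. continuous_on X u}"
    then show "(\<lambda>y. c * u y) \<in> {u \<in> borel_measurable lebesgue. continuous_on X u}"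
      by (simp add: borel_measurable_times continuous_on_mult_left)
    assume v: "v \<in> {u \<in> borel_measurable lebesgue. continuous_on X u}"
    from u v show "(\<lambda>y. u y + v y) \<in> {u \<in> borel_measurable lebesgue. continuous_on X u}"
      by (simp add: borel_measurable_add continuous_on_add)
    have "integrable lebesgue (\<lambda>y. indicator X y * (f y * (u y * v y)))"
      by (rule cont_int) (use u v f(1) in \<open>auto intro!: continuous_on_mult\<close>)
    then have "integrable lebesgue (\<lambda>y. (indicator X y * f y) *\<^sub>R (u y * v y))"
      by (simp only: real_scaleR_def mult.assoc)
    moreover have "(\<lambda>y. u y * v y) \<in> borel_measurable lebesgue"
      using u v by (simp add: borel_measurable_times)
    ultimately show "integrable (mu_meas X f) (\<lambda>y. u y * v y)"
      unfolding mu_meas_def by (subst integrable_density[OF _ fm f0])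
  next
    have "(\<lambda>_. 0::real) \<in> {u \<in> borel_measurable lebesgue. continuous_on X u}"
      by (intro CollectI conjI borel_measurable_const continuous_on_const)
    then show "{u \<in> borel_measurable lebesgue :: (real^'n \<Rightarrow> real) set. continuous_on X u} \<noteq> {}"
      unfolding ex_in_conv[symmetric] by (rule exI[of _ "\<lambda>_. 0::real"])
  qed
qed

section \<open>Mollification and localisation of Sobolev functions\<close>

lemma finite_lists_le: "finite {\<beta> :: 'n::finite list. length \<beta> \<le> l}"
  using finite_lists_length_le[of "UNIV :: 'n set" l] by simp

text \<open>A Leibniz rule with an unspecified constant, uniform in \<open>u\<close>. Peeling off
  the innermost derivative leaves \<open>\<eta>\<close> times a derivative of \<open>u\<close> plus
  a derivative of \<open>\<eta>\<close> times \<open>u\<close>; both prefactors vanish off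
  \<open>S\<close>, so \<open>\<eta>\<close> is left free in the induction.\<close>

lemma pderivs_mult_bound:
  fixes \<eta> :: "real^'n \<Rightarrow> real"
  assumes S: "compact S"
  shows "\<lbrakk>smooth_fun \<eta>; \<And>x. x \<notin> S \<Longrightarrow> \<eta> x = 0\<rbrakk> \<Longrightarrow>
    \<exists>C\<ge>0. \<forall>u z. smooth_fun u \<longrightarrow> \<bar>pderivs \<alpha> (\<lambda>x. \<eta> x * u x) z\<bar>
      \<le> C * (\<Sum>\<beta> | length \<beta> \<le> length \<alpha>. \<bar>pderivs \<beta> u z\<bar>) * indicator S z"
proof (induction \<alpha> arbitrary: \<eta> rule: rev_induct)
  case Nil
  have "bounded (\<eta> ` S)"
    using S smooth_fun_continuous_on[OF Nil(1)] compact_continuous_image compact_imp_bounded by blast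
  then obtain b where b: "b > 0" "\<And>x. x \<in> S \<Longrightarrow> \<bar>\<eta> x\<bar> \<le> b"
    unfolding bounded_pos by auto
  have "{\<beta>::'n list. \<beta> = []} = {[]}" by auto
  moreover have "\<bar>\<eta> z * u z\<bar> \<le> b * \<bar>u z\<bar> * indicator S z" for u :: "real^'n \<Rightarrow> real" and z
    using b Nil(2)[of z] by (cases "z \<in> S") (auto simp: abs_mult mult_right_mono)
  ultimately show ?case using b(1) by (intro exI[of _ b]) auto
next
  case (snoc i \<alpha>)
  let ?l = "length \<alpha>"
  have pz: "partial_deriv i \<eta> x = 0" if "x \<notin> S" for x
    using pderivs_eq_0_outside_closed[OF compact_imp_closed[OF S], of \<eta> x "[i]"] snoc.prems(2) that by simp
  obtain C1 where C1: "C1 \<ge> 0" "\<And>u z. smooth_fun u \<Longrightarrow> \<bar>pderivs \<alpha> (\<lambda>x. partial_deriv i \<eta> x * u x) z\<bar>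
      \<le> C1 * (\<Sum>\<beta> | length \<beta> \<le> ?l. \<bar>pderivs \<beta> u z\<bar>) * indicator S z"
    using snoc.IH[OF smooth_partial_deriv[OF snoc.prems(1)] pz] by blast
  obtain C2 where C2: "C2 \<ge> 0" "\<And>u z. smooth_fun u \<Longrightarrow> \<bar>pderivs \<alpha> (\<lambda>x. \<eta> x * u x) z\<bar>
      \<le> C2 * (\<Sum>\<beta> | length \<beta> \<le> ?l. \<bar>pderivs \<beta> u z\<bar>) * indicator S z"
    using snoc.IH[OF snoc.prems] by blast
  have "\<bar>pderivs (\<alpha> @ [i]) (\<lambda>x. \<eta> x * u x) z\<bar>
      \<le> (C1 + C2) * (\<Sum>\<beta> | length \<beta> \<le> length (\<alpha> @ [i]). \<bar>pderivs \<beta> u z\<bar>) * indicator S z"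
    if u: "smooth_fun u" for u z
  proof -
    define T where "T = (\<Sum>\<beta> | length \<beta> \<le> Suc ?l. \<bar>pderivs \<beta> u z\<bar>)"
    have "pderivs (\<alpha> @ [i]) (\<lambda>x. \<eta> x * u x) z
        = pderivs \<alpha> (\<lambda>x. \<eta> x * partial_deriv i u x) z + pderivs \<alpha> (\<lambda>x. partial_deriv i \<eta> x * u x) z"
      unfolding pderivs_snoc partial_deriv_mult[OF snoc.prems(1) u]
      by (subst pderivs_add) (auto intro!: smooth_fun_mult smooth_partial_deriv snoc.prems(1) u)
    also have "\<bar>\<dots>\<bar> \<le> C2 * (\<Sum>\<beta> | length \<beta> \<le> ?l. \<bar>pderivs \<beta> (partial_deriv i u) z\<bar>) * indicator S z
        + C1 * (\<Sum>\<beta> | length \<beta> \<le> ?l. \<bar>pderivs \<beta> u z\<bar>) * indicator S z"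
      by (intro order_trans[OF abs_triangle_ineq] add_mono C2(2) C1(2) smooth_partial_deriv u)
    also have "\<dots> \<le> C2 * T * indicator S z + C1 * T * indicator S z"
    proof (intro add_mono mult_right_mono mult_left_mono)
      have "(\<Sum>\<beta> | length \<beta> \<le> ?l. \<bar>pderivs \<beta> (partial_deriv i u) z\<bar>)
          = (\<Sum>\<beta>\<in>(\<lambda>\<beta>. \<beta> @ [i]) ` {\<beta>. length \<beta> \<le> ?l}. \<bar>pderivs \<beta> u z\<bar>)"
        by (subst sum.reindex) (auto simp: inj_on_def pderivs_snoc)
      also have "\<dots> \<le> T" unfolding T_def by (intro sum_mono2 finite_lists_le) auto
      finally show "(\<Sum>\<beta> | length \<beta> \<le> ?l. \<bar>pderivs \<beta> (partial_deriv i u) z\<bar>) \<le> T" .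
      show "(\<Sum>\<beta> | length \<beta> \<le> ?l. \<bar>pderivs \<beta> u z\<bar>) \<le> T"
        unfolding T_def by (intro sum_mono2 finite_lists_le) auto
    qed (use C1(1) C2(1) in auto)
    finally show ?thesis unfolding T_def by (simp add: algebra_simps)
  qed
  then show ?case using C1(1) C2(1) by (intro exI[of _ "C1 + C2"]) auto
qed

text \<open>One bump plays several parts: it is the mollifier of the estimator, it smooths the
  cutoff function, and its rescalings regularise \<open>1 / f\<close>.\<close>

locale bump =
  fixes \<phi> :: "real^'n \<Rightarrow> real"
  assumes nonneg: "0 \<le> \<phi> x"
    and smooth: "smooth_fun \<phi>"
    and zero_outside: "1 \<le> norm x \<Longrightarrow> \<phi> x = 0"
    and integral_one: "(LINT x|lborel. \<phi> x) = 1"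
    and even: "\<phi> (- x) = \<phi> x"
begin

text \<open>The summand \<open>0 +\<close> gives the argument the shape
  \<open>a + c *\<^sub>R x\<close> of the affine lemmas.\<close>

definition mol :: "real \<Rightarrow> real^'n \<Rightarrow> real" where
  "mol \<delta> x = \<delta> powr (- real CARD('n)) * \<phi> (0 + (1 / \<delta>) *\<^sub>R x)"

lemma mollifier_eq_mol: "mollifier \<phi> z \<delta> y = mol \<delta> (z - y)"
  unfolding mollifier_def mol_def by simp

lemma mol_smooth: "smooth_fun (mol \<delta>)"
  unfolding mol_def[abs_def] by (rule smooth_fun_affine[OF smooth])

lemma mol_continuous: "continuous_on S (mol \<delta>)"
  by (rule smooth_fun_continuous_on[OF mol_smooth])

lemma mol_measurable [measurable]: "mol \<delta> \<in> borel_measurable borel"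
  by (rule borel_measurable_continuous_onI[OF mol_continuous])

lemma phi_measurable [measurable]: "\<phi> \<in> borel_measurable borel"
  by (rule borel_measurable_continuous_onI[OF smooth_fun_continuous_on[OF smooth]])

lemma mol_nonneg: "0 \<le> mol \<delta> x"
  unfolding mol_def by (simp add: nonneg)

lemma mol_zero: "0 < \<delta> \<Longrightarrow> \<delta> \<le> norm x \<Longrightarrow> mol \<delta> x = 0"
  unfolding mol_def by (subst zero_outside) (auto simp: field_simps)

lemma mol_even: "mol \<delta> (- x) = mol \<delta> x"
  unfolding mol_def by (simp add: even)

lemma powr_minus_card: "0 < \<delta> \<Longrightarrow> \<delta> powr (- real CARD('n)) = (1 / \<delta>) ^ CARD('n)"
  by (simp add: powr_minus powr_realpow power_one_over inverse_eq_divide)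

lemma mol_integral: "0 < \<delta> \<Longrightarrow> (LINT x|lborel. mol \<delta> x) = 1"
  using integral_lborel_affine[of \<phi> "1 / \<delta>" 0] integral_one
  by (simp add: mol_def[abs_def] powr_minus_card)

lemma mol_integral_shift: "0 < \<delta> \<Longrightarrow> (LINT y|lborel. mol \<delta> (z - y)) = 1"
  using integral_lborel_affine[of "mol \<delta>" "-1" z] mol_integral[of \<delta>] by simp

lemma mol_integrable_shift: "0 < \<delta> \<Longrightarrow> integrable lborel (\<lambda>y. mol \<delta> (z - y))"
  using mol_integral_shift[of \<delta> z] not_integrable_integral_eq by fastforce

lemma mol_nn_integral_shift: "0 < \<delta> \<Longrightarrow> (\<integral>\<^sup>+z. ennreal (mol \<delta> (z - y)) \<partial>lborel) = 1"
proof -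
  assume \<delta>: "0 < \<delta>"
  have "(\<integral>\<^sup>+z. ennreal (mol \<delta> (z - y)) \<partial>lborel) = (\<integral>\<^sup>+z. ennreal (mol \<delta> (y - z)) \<partial>lborel)"
    using mol_even by (metis minus_diff_eq)
  also have "\<dots> = ennreal (LINT z|lborel. mol \<delta> (y - z))"
    by (rule nn_integral_eq_integral[OF mol_integrable_shift[OF \<delta>]]) (simp add: mol_nonneg)
  finally show ?thesis using mol_integral_shift[OF \<delta>] by simp
qed

lemma integrable_mult_mol:
  assumes "0 < \<delta>" "continuous_on UNIV u"
  shows "integrable lborel (\<lambda>y. u y * mol \<delta> (z - y))"
proof -
  obtain a where a: "cball z \<delta> \<subseteq> cbox (-a) a"
    using bounded_subset_cbox_symmetric[OF bounded_cball] by blast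
  show ?thesis
  proof (rule integrable_lborel_continuous_compact_support[of _ "-a" a])
    show "continuous_on UNIV (\<lambda>y. u y * mol \<delta> (z - y))"
      by (intro continuous_intros assms continuous_on_compose2[OF mol_continuous[of UNIV]]) auto
    fix y assume "y \<notin> cbox (-a) a"
    then have "y \<notin> cball z \<delta>" using a by blast
    then show "u y * mol \<delta> (z - y) = 0"
      using mol_zero[OF assms(1), of "z - y"] by (simp add: dist_norm)
  qed
qed

section \<open>Convolution with a rescaled bump\<close>

lemma conv_mol_const:
  assumes "0 < \<delta>" "\<And>y. norm (z - y) < \<delta> \<Longrightarrow> u y = c"
  shows "conv u (mol \<delta>) z = c"
proof -
  have eq: "u y * mol \<delta> (z - y) = c * mol \<delta> (z - y)" for y
    using assms(2)[of y] mol_zero[OF assms(1), of "z - y"] by (cases "norm (z - y) < \<delta>") auto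
  show ?thesis unfolding conv_def eq using mol_integral_shift[OF assms(1)] by simp
qed

lemma conv_mol_near:
  assumes "0 < \<delta>" "continuous_on UNIV u" "\<And>y. norm (z - y) < \<delta> \<Longrightarrow> \<bar>u y - u z\<bar> \<le> e"
  shows "\<bar>conv u (mol \<delta>) z - u z\<bar> \<le> e"
proof -
  have i: "integrable lborel (\<lambda>y. (u y - u z) * mol \<delta> (z - y))"
    by (intro integrable_mult_mol assms continuous_intros)
  have "conv u (mol \<delta>) z - u z = (LINT y|lborel. u y * mol \<delta> (z - y)) - (LINT y|lborel. u z * mol \<delta> (z - y))"
    unfolding conv_def using mol_integral_shift[OF assms(1)] by simp
  also have "\<dots> = (LINT y|lborel. u y * mol \<delta> (z - y) - u z * mol \<delta> (z - y))"
    by (rule Bochner_Integration.integral_diff[symmetric])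
      (intro integrable_mult_mol assms continuous_intros)+
  also have "\<dots> = (LINT y|lborel. (u y - u z) * mol \<delta> (z - y))"
    by (simp only: left_diff_distrib)
  also have "\<bar>\<dots>\<bar> \<le> (LINT y|lborel. norm ((u y - u z) * mol \<delta> (z - y)))"
    using integral_norm_bound[of lborel "\<lambda>y. (u y - u z) * mol \<delta> (z - y)"] by simp
  also have "\<dots> \<le> (LINT y|lborel. e * mol \<delta> (z - y))"
  proof (rule integral_mono[OF integrable_norm[OF i]])
    show "integrable lborel (\<lambda>y. e * mol \<delta> (z - y))"
      by (intro integrable_mult_right mol_integrable_shift assms)
    fix y
    show "norm ((u y - u z) * mol \<delta> (z - y)) \<le> e * mol \<delta> (z - y)"
      using assms(3)[of y] mol_zero[OF assms(1), of "z - y"] mol_nonneg[of \<delta> "z - y"]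
      by (cases "norm (z - y) < \<delta>") (auto simp: abs_mult mult_right_mono)
  qed
  also have "\<dots> = e" using mol_integral_shift[OF assms(1)] by simp
  finally show ?thesis .
qed

lemma conv_mol_tendsto:
  assumes "continuous_on UNIV u" "\<And>n. 0 < \<delta> n" "\<delta> \<longlonglongrightarrow> 0"
  shows "(\<lambda>n. conv u (mol (\<delta> n)) z) \<longlonglongrightarrow> u z"
proof (rule LIMSEQ_I)
  fix r :: real assume r: "0 < r"
  have "isCont u z" using assms(1) by (simp add: continuous_on_eq_continuous_at)
  then obtain d where d: "d > 0" "\<And>y. dist y z < d \<Longrightarrow> dist (u y) (u z) < r / 2"
    using r unfolding continuous_at_eps_delta by (meson half_gt_zero)
  obtain n0 where n0: "\<And>n. n \<ge> n0 \<Longrightarrow> \<delta> n < d"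
    using LIMSEQ_D[OF assms(3) d(1)] by fastforce
  have "norm (conv u (mol (\<delta> n)) z - u z) < r" if "n \<ge> n0" for n
  proof -
    have "\<bar>conv u (mol (\<delta> n)) z - u z\<bar> \<le> r / 2"
    proof (rule conv_mol_near[OF assms(2,1)])
      fix y assume "norm (z - y) < \<delta> n"
      then have "dist y z < d" using n0[OF that] by (simp add: dist_norm norm_minus_commute)
      then show "\<bar>u y - u z\<bar> \<le> r / 2" using d(2)[of y] by (simp add: dist_real_def)
    qed
    then show ?thesis using r by simp
  qed
  then show "\<exists>no. \<forall>n\<ge>no. norm (conv u (mol (\<delta> n)) z - u z) < r" by blast
qed

end

text \<open>As a function of \<open>y\<close>, \<open>mol \<delta> (z - y)\<close> is a test
  function, since \<open>near\<close> places the closed ball around \<open>z\<close> inside the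
  interior. The sign in the definition of the weak derivative cancels the one from the reflection.
  \<open>v3\<close> is a Borel representative of \<open>v\<close>.\<close>

lemma (in bump) pderivs_conv_mol_eq_weak_deriv:
  assumes wd: "weak_deriv X \<alpha> g v"
    and v3 [measurable]: "v3 \<in> borel_measurable borel"
    and V0: "(\<lambda>y. indicator (interior X) y * v y) \<in> borel_measurable lebesgue"
    and ae: "AE y in lborel. indicator (interior X) y * v y = v3 y"
    and g1: "continuous_on UNIV g1" "\<And>y. y \<notin> cbox a b \<Longrightarrow> g1 y = 0"
    and near: "\<And>y. norm (z - y) \<le> \<delta> \<Longrightarrow> y \<in> interior X \<and> g1 y = g y"
    and \<delta>: "0 < \<delta>"
  shows "pderivs \<alpha> (conv g1 (mol \<delta>)) z = (LINT y|lborel. mol \<delta> (z - y) * v3 y)"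
proof -
  define \<psi> where "\<psi> y = 1 * mol \<delta> (z + (-1) *\<^sub>R y)" for y
  have \<psi>_eq: "\<psi> y = mol \<delta> (z - y)" for y unfolding \<psi>_def by simp
  have \<psi>_smooth: "smooth_fun \<psi>" unfolding \<psi>_def[abs_def] by (rule smooth_fun_affine[OF mol_smooth])
  have \<psi>0: "\<psi> y = 0" if "y \<notin> cball z \<delta>" for y
    unfolding \<psi>_eq using that \<delta> by (intro mol_zero) (auto simp: dist_norm)
  have supp: "fsupp \<psi> \<subseteq> cball z \<delta>"
    unfolding fsupp_def using \<psi>0 by (intro closure_minimal closed_cball) blast
  have test: "test_fun (interior X) \<psi>"
    unfolding test_fun_def
  proof (intro conjI \<psi>_smooth)
    show "compact (fsupp \<psi>)"
      using supp unfolding compact_eq_bounded_closed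
      by (auto simp: fsupp_def intro: bounded_subset[OF bounded_cball])
    show "fsupp \<psi> \<subseteq> interior X"
      using supp near by (auto simp: dist_norm)
  qed
  have pd: "pderivs \<alpha> \<psi> y = (-1) ^ length \<alpha> * pderivs \<alpha> (mol \<delta>) (z - y)" for y
    unfolding \<psi>_def[abs_def] pderivs_affine[OF mol_smooth] by simp
  have [measurable]: "pderivs \<alpha> \<psi> \<in> borel_measurable borel" "g1 \<in> borel_measurable borel"
      "\<psi> \<in> borel_measurable borel"
    by (auto intro!: borel_measurable_continuous_onI smooth_fun_continuous_on smooth_pderivs \<psi>_smooth g1(1))
  have "indicator (interior X) y * g y * pderivs \<alpha> \<psi> y = g1 y * pderivs \<alpha> \<psi> y" for y
  proof (cases "y \<in> cball z \<delta>")
    case True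
    then show ?thesis using near[of y] by (simp add: dist_norm)
  next
    case False
    then have "pderivs \<alpha> \<psi> y = 0"
      by (intro pderivs_eq_0_outside_closed[OF closed_cball \<psi>0])
    then show ?thesis by simp
  qed
  then have "(LINT y|lebesgue. indicator (interior X) y * g y * pderivs \<alpha> \<psi> y)
      = (LINT y|lebesgue. g1 y * pderivs \<alpha> \<psi> y)"
    by (simp only:)
  also have "\<dots> = (LINT y|lborel. g1 y * pderivs \<alpha> \<psi> y)"
    by (rule integral_completion) measurable
  also have "\<dots> = (LINT y|lborel. (-1) ^ length \<alpha> * (g1 y * pderivs \<alpha> (mol \<delta>) (z - y)))"
    unfolding pd by (simp only: mult.left_commute)
  also have "\<dots> = (-1) ^ length \<alpha> * conv g1 (pderivs \<alpha> (mol \<delta>)) z"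
    unfolding conv_def by (rule integral_mult_right_zero)
  finally have lhs: "(LINT y|lebesgue. indicator (interior X) y * g y * pderivs \<alpha> \<psi> y)
      = (-1) ^ length \<alpha> * conv g1 (pderivs \<alpha> (mol \<delta>)) z" .
  have \<psi>l: "\<psi> \<in> borel_measurable lebesgue" and v3l: "v3 \<in> borel_measurable lebesgue"
    by (auto intro: measurable_completion)
  have "(LINT y|lebesgue. indicator (interior X) y * v y * \<psi> y) = (LINT y|lebesgue. v3 y * \<psi> y)"
  proof (rule integral_cong_AE)
    show "(\<lambda>y. indicator (interior X) y * v y * \<psi> y) \<in> borel_measurable lebesgue"
      by (rule borel_measurable_times[OF V0 \<psi>l])
    show "(\<lambda>y. v3 y * \<psi> y) \<in> borel_measurable lebesgue"
      by (rule borel_measurable_times[OF v3l \<psi>l])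
    show "AE y in lebesgue. indicator (interior X) y * v y * \<psi> y = v3 y * \<psi> y"
      using AE_completion[OF ae] by eventually_elim simp
  qed
  also have "\<dots> = (LINT y|lborel. v3 y * \<psi> y)"
    by (rule integral_completion) measurable
  also have "\<dots> = (LINT y|lborel. mol \<delta> (z - y) * v3 y)"
    unfolding \<psi>_eq by (simp only: mult.commute)
  finally have rhs: "(LINT y|lebesgue. indicator (interior X) y * v y * \<psi> y)
      = (LINT y|lborel. mol \<delta> (z - y) * v3 y)" .
  have "(-1) ^ length \<alpha> * conv g1 (pderivs \<alpha> (mol \<delta>)) z = (-1) ^ length \<alpha> * (LINT y|lborel. mol \<delta> (z - y) * v3 y)"
    using wd test unfolding weak_deriv_def lhs[symmetric] rhs[symmetric] by simp
  then show ?thesis by (simp add: pderivs_conv[OF g1(1) g1(2) mol_smooth])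
qed

text \<open>On \<open>S\<close> the derivative of the mollified function is the mollified weak
  derivative, and averaging against a probability density does not increase the mean square. So
  \<open>N\<close> is the mean square of \<open>v\<close> over the interior of \<open>X\<close>,
  independent of \<open>\<delta>\<close>.\<close>

lemma (in bump) weak_deriv_mollified_bound:
  assumes wd: "weak_deriv X \<alpha> g v" and L2: "L2_on X v"
    and g1: "continuous_on UNIV g1" "\<And>y. y \<notin> cbox a b \<Longrightarrow> g1 y = 0"
    and near: "\<And>z y. z \<in> S \<Longrightarrow> norm (z - y) \<le> \<rho> \<Longrightarrow> y \<in> interior X \<and> g1 y = g y"
  shows "\<exists>N\<ge>0. \<forall>\<delta>. 0 < \<delta> \<and> \<delta> \<le> \<rho> \<longrightarrow>
    (\<integral>\<^sup>+z. ennreal (indicator S z * (pderivs \<alpha> (conv g1 (mol \<delta>)) z)\<^sup>2) \<partial>lborel) \<le> ennreal N"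
proof -
  have iX: "interior X \<in> sets lebesgue" by (intro sets_completionI_sets) simp
  have V0_eq: "(\<lambda>y. indicator (interior X) y * v y) = (\<lambda>y. indicator (interior X) y * (indicator X y * v y))"
    using interior_subset[of X] by (auto simp: fun_eq_iff indicator_def)
  have V0: "(\<lambda>y. indicator (interior X) y * v y) \<in> borel_measurable lebesgue"
    unfolding V0_eq using L2 unfolding L2_on_def
    by (intro borel_measurable_times[OF borel_measurable_indicator[OF iX]]) (elim conjunct1)
  \<comment> \<open>A Borel version of \<open>v\<close> is taken because the exchange of integrals
    happens over \<open>lborel\<close>.\<close>
  obtain v3 where v3': "v3 \<in> borel_measurable lborel"
    and ae: "AE y in lborel. indicator (interior X) y * v y = v3 y"
    using completion_ex_borel_measurable_real[OF V0] by blast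
  have v3 [measurable]: "v3 \<in> borel_measurable borel" using v3' by simp
  define J where "J = (\<integral>\<^sup>+y. ennreal ((v3 y)\<^sup>2) \<partial>lborel)"
  have "J = (\<integral>\<^sup>+y. ennreal ((indicator (interior X) y * v y)\<^sup>2) \<partial>lborel)"
    unfolding J_def by (rule nn_integral_cong_AE) (use ae in eventually_elim, simp)
  also have "\<dots> = (\<integral>\<^sup>+y. ennreal ((indicator (interior X) y * v y)\<^sup>2) \<partial>lebesgue)"
    by (simp add: nn_integral_completion)
  also have "\<dots> \<le> (\<integral>\<^sup>+y. ennreal (norm (indicator X y * (v y)\<^sup>2)) \<partial>lebesgue)"
  proof (intro nn_integral_mono ennreal_leI)
    fix y
    show "(indicator (interior X) y * v y)\<^sup>2 \<le> norm (indicator X y * (v y)\<^sup>2)"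
      using interior_subset[of X] by (auto simp: indicator_def)
  qed
  also have "\<dots> < \<infinity>"
    using L2 unfolding L2_on_def integrable_iff_bounded by blast
  finally have J: "J < \<infinity>" .
  have "(\<integral>\<^sup>+z. ennreal (indicator S z * (pderivs \<alpha> (conv g1 (mol \<delta>)) z)\<^sup>2) \<partial>lborel) \<le> J"
    if \<delta>: "0 < \<delta>" "\<delta> \<le> \<rho>" for \<delta>
  proof -
    have "(\<integral>\<^sup>+z. ennreal (indicator S z * (pderivs \<alpha> (conv g1 (mol \<delta>)) z)\<^sup>2) \<partial>lborel)
        \<le> (\<integral>\<^sup>+z. \<integral>\<^sup>+y. ennreal (mol \<delta> (z - y) * (v3 y)\<^sup>2) \<partial>lborel \<partial>lborel)"
    proof (rule nn_integral_mono)
      fix z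
      show "ennreal (indicator S z * (pderivs \<alpha> (conv g1 (mol \<delta>)) z)\<^sup>2)
          \<le> (\<integral>\<^sup>+y. ennreal (mol \<delta> (z - y) * (v3 y)\<^sup>2) \<partial>lborel)"
      proof (cases "z \<in> S")
        case True
        have "pderivs \<alpha> (conv g1 (mol \<delta>)) z = (LINT y|lborel. mol \<delta> (z - y) * v3 y)"
          by (rule pderivs_conv_mol_eq_weak_deriv[OF wd v3 V0 ae g1 _ \<delta>(1)])
            (use near[OF True] \<delta>(2) in auto)
        moreover have "ennreal ((LINT y|lborel. mol \<delta> (z - y) * v3 y)\<^sup>2)
            \<le> (\<integral>\<^sup>+y. ennreal (mol \<delta> (z - y) * (v3 y)\<^sup>2) \<partial>lborel)"
          by (rule square_integral_le_integral_square[OF mol_integrable_shift[OF \<delta>(1)] mol_nonneg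
                mol_integral_shift[OF \<delta>(1)]]) measurable
        ultimately show ?thesis using True by simp
      qed simp
    qed
    also have "\<dots> = (\<integral>\<^sup>+y. \<integral>\<^sup>+z. ennreal (mol \<delta> (z - y) * (v3 y)\<^sup>2) \<partial>lborel \<partial>lborel)"
      by (rule lborel_pair.Fubini'[symmetric]) measurable
    also have "\<dots> = J"
      unfolding J_def
    proof (rule nn_integral_cong)
      fix y
      have "(\<integral>\<^sup>+z. ennreal (mol \<delta> (z - y) * (v3 y)\<^sup>2) \<partial>lborel)
          = (\<integral>\<^sup>+z. ennreal (mol \<delta> (z - y)) * ennreal ((v3 y)\<^sup>2) \<partial>lborel)"
        by (intro nn_integral_cong ennreal_mult mol_nonneg) auto
      also have "\<dots> = (\<integral>\<^sup>+z. ennreal (mol \<delta> (z - y)) \<partial>lborel) * ennreal ((v3 y)\<^sup>2)"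
        by (rule nn_integral_multc) measurable
      finally show "(\<integral>\<^sup>+z. ennreal (mol \<delta> (z - y) * (v3 y)\<^sup>2) \<partial>lborel) = ennreal ((v3 y)\<^sup>2)"
        using mol_nn_integral_shift[OF \<delta>(1)] by simp
    qed
    finally show ?thesis .
  qed
  moreover have "J = ennreal (enn2real J)" using J by simp
  ultimately show ?thesis by (intro exI[of _ "enn2real J"]) auto
qed

text \<open>Piecewise linear in the distance and hence only continuous; where a smooth cutoff is
  required, it is mollified.\<close>

definition cutoff :: "'a::metric_space set \<Rightarrow> real \<Rightarrow> real \<Rightarrow> 'a \<Rightarrow> real" where
  "cutoff K a b y = max 0 (min 1 ((b - infdist y K) / (b - a)))"

lemma continuous_on_cutoff: "continuous_on S (cutoff K a b)"
  unfolding cutoff_def[abs_def] divide_inverse by (intro continuous_intros)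

lemma cutoff_eq_1: "a < b \<Longrightarrow> infdist y K \<le> a \<Longrightarrow> cutoff K a b y = 1"
  unfolding cutoff_def by (simp add: min_def max_def field_simps)

lemma cutoff_eq_0: "a < b \<Longrightarrow> b \<le> infdist y K \<Longrightarrow> cutoff K a b y = 0"
  using divide_nonpos_pos[of "b - infdist y K" "b - a"] unfolding cutoff_def by simp

lemma sum_square_le_card:
  fixes a :: "'i \<Rightarrow> real"
  shows "(\<Sum>i\<in>I. \<bar>a i\<bar>)\<^sup>2 \<le> real (card I) * (\<Sum>i\<in>I. (a i)\<^sup>2)"
  using sum_squared_le_sum_of_squares[of "\<lambda>i. \<bar>a i\<bar>" I] by (simp add: mult.commute)

text \<open>Mollifying requires a function on the whole space, so \<open>g\<close> is first cut off
  to \<open>g1\<close>, about whose weak derivatives in the cutoff zone nothing is known.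
  Multiplying the mollification by the smooth \<open>\<eta>\<close>, supported strictly further in,
  removes that zone before derivatives are bounded. \<open>N\<close> is independent of the width of
  the mollifier, so the bound passes to the limit \<open>w\<close>.\<close>

lemma (in bump) sobolev_cutoff:
  fixes X K :: "(real^'n) set" and g :: "real^'n \<Rightarrow> real" and k :: nat
  assumes K: "compact K" "K \<subseteq> interior X" "K \<noteq> {}" and g: "continuous_on (interior X) g"
    and sob: "\<And>\<alpha>. length \<alpha> \<le> k \<Longrightarrow> \<exists>v. weak_deriv X \<alpha> g v \<and> L2_on X v"
  obtains \<rho> w N where "0 < \<rho>"
    "\<And>x y. x \<in> K \<Longrightarrow> norm (x - y) \<le> \<rho> \<Longrightarrow> y \<in> interior X \<and> w y = g y"
    "continuous_on UNIV w" "\<And>y. y \<notin> interior X \<Longrightarrow> w y = 0" "0 \<le> N"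
    "\<And>t. (\<integral>\<^sup>+x. ennreal (((fdiff t ^^ k) w x)\<^sup>2) \<partial>lborel) \<le> ennreal (N * norm t ^ (2 * k))"
proof -
  obtain r where r: "r > 0" "(\<Union>x\<in>K. cball x r) \<subseteq> interior X"
    using compact_subset_open_imp_cball_epsilon_subset[OF K(1) open_interior K(2)] by blast
  \<comment> \<open>Distances from \<open>K\<close> in units of \<open>\<rho>\<close>:
    \<open>\<theta>\<close> falls from 1 to 0 between 2 and 3, so its mollification
    \<open>\<eta>\<close> is 1 up to 1 and vanishes beyond 4. \<open>g1\<close> equals
    \<open>g\<close> up to 5, leaving room for the mollifier around \<open>S\<close>, and vanishes
    from 6 on. Distance 7 is still in the interior of \<open>X\<close>.\<close>
  define \<rho> where "\<rho> = r / 7"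
  have \<rho>: "\<rho> > 0" using r(1) by (simp add: \<rho>_def)
  have inX: "y \<in> interior X" if "infdist y K \<le> 7 * \<rho>" for y
  proof -
    obtain x where "x \<in> K" "infdist y K = dist y x"
      using infdist_attains_inf[OF compact_imp_closed[OF K(1)] K(3)] by blast
    then have "y \<in> cball x r" using that by (simp add: \<rho>_def dist_commute)
    then show ?thesis using r(2) \<open>x \<in> K\<close> by blast
  qed
  have tri: "infdist y K \<le> infdist z K + norm (z - y)" for y z
    using infdist_triangle[of y K z] by (simp add: dist_norm norm_minus_commute)
  define S where "S = {y. infdist y K \<le> 4 * \<rho>}"
  have S: "compact S" unfolding S_def using compact_infdist_le[OF K(3,1)] \<rho> by simp
  have "bounded {y. infdist y K \<le> 6 * \<rho>}"
    using compact_infdist_le[OF K(3,1), of "6 * \<rho>"] \<rho> compact_imp_bounded by simp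
  then obtain a where a: "{y. infdist y K \<le> 6 * \<rho>} \<subseteq> cbox (-a) a"
    by (rule bounded_subset_cbox_symmetric)
  define \<theta> where "\<theta> = cutoff K (2 * \<rho>) (3 * \<rho>)"
  have \<theta>c: "continuous_on UNIV \<theta>" unfolding \<theta>_def by (rule continuous_on_cutoff)
  have \<theta>0: "\<theta> y = 0" if "y \<notin> cbox (-a) a" for y
  proof -
    have "\<not> infdist y K \<le> 6 * \<rho>" using a that by blast
    then show ?thesis unfolding \<theta>_def using \<rho> by (intro cutoff_eq_0) auto
  qed
  define \<eta> where "\<eta> = conv \<theta> (mol \<rho>)"
  have \<eta>_smooth: "smooth_fun \<eta>" unfolding \<eta>_def by (rule smooth_fun_conv[OF \<theta>c \<theta>0 mol_smooth])
  have \<eta>1: "\<eta> z = 1" if "infdist z K \<le> \<rho>" for z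
    unfolding \<eta>_def
  proof (rule conv_mol_const[OF \<rho>])
    fix y assume "norm (z - y) < \<rho>"
    then have "infdist y K \<le> 2 * \<rho>" using tri[of y z] that by linarith
    then show "\<theta> y = 1" unfolding \<theta>_def using \<rho> by (intro cutoff_eq_1) auto
  qed
  have \<eta>0: "\<eta> z = 0" if "z \<notin> S" for z
    unfolding \<eta>_def
  proof (rule conv_mol_const[OF \<rho>])
    fix y assume "norm (z - y) < \<rho>"
    then have "3 * \<rho> \<le> infdist y K"
      using tri[of z y] that unfolding S_def by (simp add: norm_minus_commute)
    then show "\<theta> y = 0" unfolding \<theta>_def using \<rho> by (intro cutoff_eq_0) auto
  qed
  define g1 where "g1 y = cutoff K (5 * \<rho>) (6 * \<rho>) y * g y" for y
  have g1_0': "g1 y = 0" if "6 * \<rho> \<le> infdist y K" for y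
    unfolding g1_def using that \<rho> by (simp add: cutoff_eq_0)
  have g1_0: "g1 y = 0" if "y \<notin> cbox (-a) a" for y
    using a that by (intro g1_0') force
  \<comment> \<open>Continuity is glued from two open sets: the interior of \<open>X\<close>, where
    \<open>g\<close> is continuous, and \<open>W\<close>, where \<open>g1\<close> vanishes.\<close>
  have g1c: "continuous_on UNIV g1"
  proof -
    define W where "W = {y. 6 * \<rho> < infdist y K}"
    have W: "open W" unfolding W_def by (intro open_Collect_less continuous_intros)
    have "continuous_on (interior X) g1"
      unfolding g1_def[abs_def] by (intro continuous_intros continuous_on_cutoff g)
    moreover have "continuous_on W g1"
      by (rule continuous_on_eq[OF continuous_on_const[of _ 0]]) (simp add: g1_0' W_def)
    ultimately have "continuous_on (interior X \<union> W) g1"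
      by (intro continuous_on_open_Un open_interior W)
    moreover have "interior X \<union> W = UNIV" using inX \<rho> unfolding W_def by force
    ultimately show ?thesis by simp
  qed
  have near: "y \<in> interior X \<and> g1 y = g y" if "z \<in> S" "norm (z - y) \<le> \<rho>" for z y
  proof -
    have "infdist y K \<le> 5 * \<rho>" using tri[of y z] that unfolding S_def by simp
    then show ?thesis unfolding g1_def using inX[of y] \<rho> by (simp add: cutoff_eq_1)
  qed
  let ?L = "{\<beta> :: 'n list. length \<beta> \<le> k}"
  have "\<forall>\<beta>\<in>?L. \<exists>N\<ge>0. \<forall>\<delta>. 0 < \<delta> \<and> \<delta> \<le> \<rho> \<longrightarrow>
      (\<integral>\<^sup>+z. ennreal (indicator S z * (pderivs \<beta> (conv g1 (mol \<delta>)) z)\<^sup>2) \<partial>lborel) \<le> ennreal N"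
  proof
    fix \<beta> :: "'n list" assume "\<beta> \<in> ?L"
    then obtain v where v: "weak_deriv X \<beta> g v" "L2_on X v" using sob by blast
    show "\<exists>N\<ge>0. \<forall>\<delta>. 0 < \<delta> \<and> \<delta> \<le> \<rho> \<longrightarrow>
      (\<integral>\<^sup>+z. ennreal (indicator S z * (pderivs \<beta> (conv g1 (mol \<delta>)) z)\<^sup>2) \<partial>lborel) \<le> ennreal N"
      by (rule weak_deriv_mollified_bound[OF v g1c g1_0 near])
  qed
  from bchoice[OF this] obtain Nf where Nf: "\<forall>\<beta>\<in>?L. 0 \<le> Nf \<beta> \<and> (\<forall>\<delta>. 0 < \<delta> \<and> \<delta> \<le> \<rho> \<longrightarrow>
      (\<integral>\<^sup>+z. ennreal (indicator S z * (pderivs \<beta> (conv g1 (mol \<delta>)) z)\<^sup>2) \<partial>lborel) \<le> ennreal (Nf \<beta>))"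
    by (elim exE)
  have "\<forall>\<alpha>::'n list. \<exists>C\<ge>0. \<forall>u z. smooth_fun u \<longrightarrow> \<bar>pderivs \<alpha> (\<lambda>x. \<eta> x * u x) z\<bar>
      \<le> C * (\<Sum>\<beta> | length \<beta> \<le> length \<alpha>. \<bar>pderivs \<beta> u z\<bar>) * indicator S z"
    by (intro allI pderivs_mult_bound[OF S \<eta>_smooth \<eta>0])
  from choice[OF this] obtain Cf where Cf: "\<forall>\<alpha>::'n list. 0 \<le> Cf \<alpha> \<and> (\<forall>u z. smooth_fun u \<longrightarrow>
      \<bar>pderivs \<alpha> (\<lambda>x. \<eta> x * u x) z\<bar>
      \<le> Cf \<alpha> * (\<Sum>\<beta> | length \<beta> \<le> length \<alpha>. \<bar>pderivs \<beta> u z\<bar>) * indicator S z)"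
    by (elim exE)
  define NN where "NN = (\<Sum>\<beta>\<in>?L. Nf \<beta>)"
  have NN0: "0 \<le> NN" unfolding NN_def using Nf by (intro sum_nonneg) blast
  define c where "c \<alpha> = (Cf \<alpha>)\<^sup>2 * real (card ?L)" for \<alpha>
  have c0: "0 \<le> c \<alpha>" for \<alpha> unfolding c_def by simp
  define N where "N = (\<Sum>\<alpha> | length \<alpha> = k. c \<alpha> * NN)"
  have N0: "0 \<le> N" unfolding N_def using NN0 c0 by (intro sum_nonneg mult_nonneg_nonneg)
  have Sm [measurable]: "S \<in> sets borel" using S by (simp add: compact_imp_closed borel_closed)
  have pd_bound: "(\<integral>\<^sup>+z. ennreal ((pderivs \<alpha> (\<lambda>x. \<eta> x * conv g1 (mol \<delta>) x) z)\<^sup>2) \<partial>lborel) \<le> ennreal (c \<alpha> * NN)"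
    if \<delta>: "0 < \<delta>" "\<delta> \<le> \<rho>" and \<alpha>: "length \<alpha> = k" for \<delta> and \<alpha> :: "'n list"
  proof -
    define u where "u = conv g1 (mol \<delta>)"
    have u: "smooth_fun u" unfolding u_def by (rule smooth_fun_conv[OF g1c g1_0 mol_smooth])
    have [measurable]: "pderivs \<beta> u \<in> borel_measurable borel" for \<beta>
      by (intro borel_measurable_continuous_onI smooth_fun_continuous_on smooth_pderivs u)
    have pt: "ennreal ((pderivs \<alpha> (\<lambda>x. \<eta> x * u x) z)\<^sup>2)
        \<le> ennreal (c \<alpha>) * (\<Sum>\<beta>\<in>?L. ennreal (indicator S z * (pderivs \<beta> u z)\<^sup>2))" for z
    proof -
      have "\<bar>pderivs \<alpha> (\<lambda>x. \<eta> x * u x) z\<bar> \<le> Cf \<alpha> * (\<Sum>\<beta>\<in>?L. \<bar>pderivs \<beta> u z\<bar>) * indicator S z"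
        using Cf u \<alpha> by blast
      from power_mono[OF this abs_ge_zero, of 2]
      have "(pderivs \<alpha> (\<lambda>x. \<eta> x * u x) z)\<^sup>2 \<le> ((Cf \<alpha>)\<^sup>2 * indicator S z) * (\<Sum>\<beta>\<in>?L. \<bar>pderivs \<beta> u z\<bar>)\<^sup>2"
        by (simp add: power_mult_distrib mult_ac power2_eq_square[of "indicator S z"] indicator_inter_arith[symmetric])
      also have "\<dots> \<le> ((Cf \<alpha>)\<^sup>2 * indicator S z) * (real (card ?L) * (\<Sum>\<beta>\<in>?L. (pderivs \<beta> u z)\<^sup>2))"
        by (intro mult_left_mono sum_square_le_card) auto
      also have "\<dots> = c \<alpha> * (\<Sum>\<beta>\<in>?L. indicator S z * (pderivs \<beta> u z)\<^sup>2)"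
        unfolding c_def sum_distrib_left[symmetric] by (simp add: mult_ac)
      finally have "ennreal ((pderivs \<alpha> (\<lambda>x. \<eta> x * u x) z)\<^sup>2)
          \<le> ennreal (c \<alpha> * (\<Sum>\<beta>\<in>?L. indicator S z * (pderivs \<beta> u z)\<^sup>2))"
        by (rule ennreal_leI)
      also have "\<dots> = ennreal (c \<alpha>) * (\<Sum>\<beta>\<in>?L. ennreal (indicator S z * (pderivs \<beta> u z)\<^sup>2))"
        by (subst ennreal_mult) (auto intro!: sum_nonneg simp: c0)
      finally show ?thesis .
    qed
    have "(\<integral>\<^sup>+z. ennreal ((pderivs \<alpha> (\<lambda>x. \<eta> x * u x) z)\<^sup>2) \<partial>lborel)
        \<le> (\<integral>\<^sup>+z. ennreal (c \<alpha>) * (\<Sum>\<beta>\<in>?L. ennreal (indicator S z * (pderivs \<beta> u z)\<^sup>2)) \<partial>lborel)"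
      by (intro nn_integral_mono pt)
    also have "\<dots> = ennreal (c \<alpha>) * (\<integral>\<^sup>+z. (\<Sum>\<beta>\<in>?L. ennreal (indicator S z * (pderivs \<beta> u z)\<^sup>2)) \<partial>lborel)"
      by (rule nn_integral_cmult) measurable
    also have "\<dots> = ennreal (c \<alpha>) * (\<Sum>\<beta>\<in>?L. \<integral>\<^sup>+z. ennreal (indicator S z * (pderivs \<beta> u z)\<^sup>2) \<partial>lborel)"
      by (subst nn_integral_sum) measurable
    also have "\<dots> \<le> ennreal (c \<alpha>) * (\<Sum>\<beta>\<in>?L. ennreal (Nf \<beta>))"
      unfolding u_def using Nf \<delta> by (intro mult_left_mono sum_mono) auto
    also have "\<dots> = ennreal (c \<alpha> * NN)"
    proof -
      have "(\<Sum>\<beta>\<in>?L. ennreal (Nf \<beta>)) = ennreal NN"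
        unfolding NN_def by (rule sum_ennreal) (use Nf in blast)
      then show ?thesis by (simp only: ennreal_mult[OF c0 NN0])
    qed
    finally show ?thesis unfolding u_def .
  qed
  define w where "w x = \<eta> x * g1 x" for x
  have wc: "continuous_on UNIV w"
    unfolding w_def[abs_def] by (intro continuous_intros smooth_fun_continuous_on[OF \<eta>_smooth] g1c)
  show thesis
  proof (rule that[of \<rho> w N])
    show "0 < \<rho>" "0 \<le> N" "continuous_on UNIV w" by (fact \<rho> N0 wc)+
    show "w y = 0" if "y \<notin> interior X" for y
      using \<eta>0[of y] inX[of y] that \<rho> unfolding w_def S_def by fastforce
    fix x y assume xy: "x \<in> K" "norm (x - y) \<le> \<rho>"
    then have i: "infdist y K \<le> \<rho>" using tri[of y x] by simp
    have "x \<in> S" unfolding S_def using xy \<rho> by simp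
    from near[OF this xy(2)] show "y \<in> interior X \<and> w y = g y"
      unfolding w_def using \<eta>1[OF i] by simp
  next
    fix t :: "real^'n"
    define \<delta> where "\<delta> n = \<rho> / real (Suc n)" for n
    have \<delta>: "0 < \<delta> n" "\<delta> n \<le> \<rho>" for n unfolding \<delta>_def using \<rho> by (auto simp: field_simps)
    have \<delta>_lim: "\<delta> \<longlonglongrightarrow> 0"
      unfolding \<delta>_def by (intro real_tendsto_divide_at_top[OF tendsto_const]
          filterlim_compose[OF filterlim_real_sequentially filterlim_Suc])
    define wn where "wn n x = \<eta> x * conv g1 (mol (\<delta> n)) x" for n x
    have wn_smooth: "smooth_fun (wn n)" for n
      unfolding wn_def[abs_def]
      by (intro smooth_fun_mult \<eta>_smooth smooth_fun_conv[OF g1c g1_0 mol_smooth])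
    have wn_lim: "(\<lambda>n. wn n x) \<longlonglongrightarrow> w x" for x
      unfolding wn_def w_def by (intro tendsto_intros conv_mol_tendsto g1c \<delta> \<delta>_lim)
    have le: "(\<integral>\<^sup>+x. ennreal (((fdiff t ^^ k) (wn n) x)\<^sup>2) \<partial>lborel) \<le> ennreal (N * norm t ^ (2 * k))" for n
    proof -
      have "(\<integral>\<^sup>+x. ennreal (((fdiff t ^^ k) (wn n) x)\<^sup>2) \<partial>lborel)
          \<le> ennreal (norm t ^ (2 * k)) * (\<Sum>\<alpha> | length \<alpha> = k. \<integral>\<^sup>+x. ennreal ((pderivs \<alpha> (wn n) x)\<^sup>2) \<partial>lborel)"
        by (rule nn_integral_fdiff_funpow_le[OF wn_smooth])
      also have "\<dots> \<le> ennreal (norm t ^ (2 * k)) * (\<Sum>\<alpha> | length (\<alpha>::'n list) = k. ennreal (c \<alpha> * NN))"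
        unfolding wn_def[abs_def] by (intro mult_left_mono sum_mono pd_bound \<delta>) auto
      also have "\<dots> = ennreal (norm t ^ (2 * k)) * ennreal N"
        unfolding N_def using c0 NN0 by (subst sum_ennreal) auto
      also have "\<dots> = ennreal (N * norm t ^ (2 * k))"
        using N0 by (simp add: ennreal_mult[symmetric] mult.commute)
      finally show ?thesis .
    qed
    have [measurable]: "(\<lambda>x. (fdiff t ^^ k) (wn n) x) \<in> borel_measurable borel" for n
    proof (rule borel_measurable_continuous_onI)
      show "continuous_on UNIV (\<lambda>x. (fdiff t ^^ k) (wn n) x)"
        using continuous_on_compose2[OF continuous_on_fdiff_funpow[OF smooth_fun_continuous_on[OF wn_smooth]],
            of UNIV "\<lambda>x. (t, x)"] by (simp add: continuous_on_Pair)
    qed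
    have "(\<lambda>n. ennreal (((fdiff t ^^ k) (wn n) x)\<^sup>2)) \<longlonglongrightarrow> ennreal (((fdiff t ^^ k) w x)\<^sup>2)" for x
      by (intro tendsto_ennrealI tendsto_power tendsto_fdiff_funpow wn_lim)
    then have "ennreal (((fdiff t ^^ k) w x)\<^sup>2) = liminf (\<lambda>n. ennreal (((fdiff t ^^ k) (wn n) x)\<^sup>2))" for x
      by (intro lim_imp_Liminf[symmetric]) auto
    then have "(\<integral>\<^sup>+x. ennreal (((fdiff t ^^ k) w x)\<^sup>2) \<partial>lborel)
        = (\<integral>\<^sup>+x. liminf (\<lambda>n. ennreal (((fdiff t ^^ k) (wn n) x)\<^sup>2)) \<partial>lborel)"
      by (simp only:)
    also have "\<dots> \<le> liminf (\<lambda>n. \<integral>\<^sup>+x. ennreal (((fdiff t ^^ k) (wn n) x)\<^sup>2) \<partial>lborel)"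
      by (rule nn_integral_liminf) measurable
    also have "\<dots> \<le> liminf (\<lambda>n::nat. ennreal (N * norm t ^ (2 * k)))"
      by (intro Liminf_mono always_eventually allI le)
    also have "\<dots> = ennreal (N * norm t ^ (2 * k))"
      by (simp add: Liminf_const)
    finally show "(\<integral>\<^sup>+x. ennreal (((fdiff t ^^ k) w x)\<^sup>2) \<partial>lborel) \<le> ennreal (N * norm t ^ (2 * k))" .
  qed
qed

section \<open>Second differences of a reciprocal\<close>

lemma compact_continuous_abs_bound:
  fixes f :: "'a::topological_space \<Rightarrow> real"
  assumes "compact S" "continuous_on S f"
  shows "\<exists>b\<ge>0. \<forall>x\<in>S. \<bar>f x\<bar> \<le> b"
proof -
  have "bounded (f ` S)" using assms compact_continuous_image compact_imp_bounded by blast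
  then obtain b where "b > 0" "\<forall>y\<in>f ` S. norm y \<le> b" by (meson bounded_pos)
  then show ?thesis by (intro exI[of _ b]) auto
qed

text \<open>Two mean value steps give the second difference: one for
  \<open>F (x + s z) + F (x - s z)\<close> as a function of \<open>s\<close>, one for the
  directional derivative on \<open>[-s, s]\<close>, whose length is at most 2; hence
  \<open>2 * M2\<close>. The hypothesis on the whole segment replaces convexity of
  \<open>S\<close>.\<close>

lemma C2_difference_bounds:
  fixes F :: "real^'n \<Rightarrow> real"
  assumes C2: "Ck_on 2 U F" and U: "open U" and S: "compact S" "S \<subseteq> U"
  obtains C where "0 \<le> C"
    "\<And>x z. (\<And>s. \<bar>s\<bar> \<le> 1 \<Longrightarrow> x + s *\<^sub>R z \<in> S) \<Longrightarrow> \<bar>F (x + z) - F x\<bar> \<le> C * norm z"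
    "\<And>x z. (\<And>s. \<bar>s\<bar> \<le> 1 \<Longrightarrow> x + s *\<^sub>R z \<in> S) \<Longrightarrow> \<bar>F (x + z) + F (x - z) - 2 * F x\<bar> \<le> C * (norm z)\<^sup>2"
proof -
  define D where "D v y = frechet_derivative F (at y) v" for v y
  define E where "E v w y = frechet_derivative (D v) (at y) w" for v w y
  have F1: "F differentiable (at y)" if "y \<in> U" for y
    using C2 that by (simp add: numeral_2_eq_2)
  have D_cont: "continuous_on U (D v)" for v
    using C2 by (simp add: numeral_2_eq_2 D_def[abs_def])
  have D_diff: "D v differentiable (at y)" if "y \<in> U" for v y
    using C2 that by (simp add: numeral_2_eq_2 D_def[abs_def])
  have E_cont: "continuous_on U (E v w)" for v w
    using C2 by (simp add: numeral_2_eq_2 D_def[abs_def] E_def[abs_def])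
  have D_lin: "D v y = (\<Sum>i\<in>UNIV. v $ i * D (axis i 1) y)" if "y \<in> U" for v y
    using frechet_derivative_eq_inner_partial_deriv[OF F1[OF that], of v]
    by (simp add: D_def inner_vec_def partial_deriv_def)
  have E_lin2: "E v w y = (\<Sum>l\<in>UNIV. w $ l * E v (axis l 1) y)" if "y \<in> U" for v w y
    using frechet_derivative_eq_inner_partial_deriv[OF D_diff[OF that], of v w]
    by (simp add: E_def inner_vec_def partial_deriv_def)
  \<comment> \<open>Linearity in the direction taken first: the expansion \<open>D_lin\<close> holds
    on the open set \<open>U\<close> and may be differentiated there.\<close>
  have E_lin: "E v w y = (\<Sum>i\<in>UNIV. v $ i * E (axis i 1) w y)" if y: "y \<in> U" for v w y
  proof -
    have "((\<lambda>y. \<Sum>i\<in>UNIV. v $ i * D (axis i 1) y) has_derivative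
        (\<lambda>w. \<Sum>i\<in>UNIV. v $ i * E (axis i 1) w y)) (at y)"
      unfolding E_def using D_diff[OF y]
      by (intro has_derivative_sum has_derivative_mult_right) (simp add: frechet_derivative_works)
    then have "(D v has_derivative (\<lambda>w. \<Sum>i\<in>UNIV. v $ i * E (axis i 1) w y)) (at y)"
      by (rule has_derivative_transform_within_open[OF _ U y]) (simp add: D_lin)
    from fun_cong[OF frechet_derivative_at[OF this], of w] show ?thesis by (simp add: E_def)
  qed
  have "\<forall>i. \<exists>b\<ge>0. \<forall>y\<in>S. \<bar>D (axis i 1) y\<bar> \<le> b"
    by (intro allI compact_continuous_abs_bound[OF S(1)] continuous_on_subset[OF D_cont S(2)])
  then obtain b1 where "\<forall>i. 0 \<le> b1 i \<and> (\<forall>y\<in>S. \<bar>D (axis i 1) y\<bar> \<le> b1 i)"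
    by (rule choice[THEN exE])
  then have b1: "\<And>i. 0 \<le> b1 i" "\<And>i y. y \<in> S \<Longrightarrow> \<bar>D (axis i 1) y\<bar> \<le> b1 i" by blast+
  have "\<forall>p. \<exists>b\<ge>0. \<forall>y\<in>S. \<bar>E (axis (fst p) 1) (axis (snd p) 1) y\<bar> \<le> b"
    by (intro allI compact_continuous_abs_bound[OF S(1)] continuous_on_subset[OF E_cont S(2)])
  then obtain b2' where "\<forall>p. 0 \<le> b2' p \<and> (\<forall>y\<in>S. \<bar>E (axis (fst p) 1) (axis (snd p) 1) y\<bar> \<le> b2' p)"
    by (rule choice[THEN exE])
  then have b2': "0 \<le> b2' p" "y \<in> S \<Longrightarrow> \<bar>E (axis (fst p) 1) (axis (snd p) 1) y\<bar> \<le> b2' p" for p y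
    by blast+
  define b2 where "b2 i l = b2' (i, l)" for i l
  have b2: "\<And>i l. 0 \<le> b2 i l" "\<And>i l y. y \<in> S \<Longrightarrow> \<bar>E (axis i 1) (axis l 1) y\<bar> \<le> b2 i l"
    unfolding b2_def using b2'(1) b2'(2)[of _ "(_, _)"] by auto
  define M1 where "M1 = (\<Sum>i\<in>UNIV. b1 i)"
  define M2 where "M2 = (\<Sum>i\<in>UNIV. \<Sum>l\<in>UNIV. b2 i l)"
  have M: "0 \<le> M1" "0 \<le> M2" unfolding M1_def M2_def using b1 b2 by (auto intro!: sum_nonneg)
  have D_bound: "\<bar>D v y\<bar> \<le> M1 * norm v" if y: "y \<in> S" for v y
  proof -
    have "\<bar>D v y\<bar> \<le> (\<Sum>i\<in>UNIV. \<bar>v $ i\<bar> * \<bar>D (axis i 1) y\<bar>)"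
      using y S(2) D_lin[of y v] sum_abs[of "\<lambda>i. v $ i * D (axis i 1) y" UNIV] by (auto simp: abs_mult)
    also have "\<dots> \<le> (\<Sum>i\<in>UNIV. norm v * b1 i)"
      using b1 y by (intro sum_mono mult_mono component_le_norm_cart) auto
    finally show ?thesis unfolding M1_def by (simp add: sum_distrib_left sum_distrib_right mult_ac)
  qed
  have E_bound: "\<bar>E v v y\<bar> \<le> M2 * (norm v)\<^sup>2" if y: "y \<in> S" for v y
  proof -
    have yU: "y \<in> U" using y S(2) by blast
    have "E v v y = (\<Sum>i\<in>UNIV. \<Sum>l\<in>UNIV. (v $ i * v $ l) * E (axis i 1) (axis l 1) y)"
      by (subst E_lin[OF yU], rule sum.cong[OF refl], subst E_lin2[OF yU])
        (simp add: sum_distrib_left mult_ac)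
    also have "\<bar>\<dots>\<bar> \<le> (\<Sum>i\<in>UNIV. \<Sum>l\<in>UNIV. \<bar>(v $ i * v $ l) * E (axis i 1) (axis l 1) y\<bar>)"
      by (intro order_trans[OF sum_abs] sum_mono sum_abs)
    also have "\<dots> \<le> (\<Sum>i\<in>UNIV. \<Sum>l\<in>UNIV. (norm v * norm v) * b2 i l)"
      unfolding abs_mult using b2 y
      by (intro sum_mono mult_mono component_le_norm_cart mult_nonneg_nonneg) auto
    finally show ?thesis unfolding M2_def
      by (simp add: sum_distrib_left sum_distrib_right power2_eq_square mult_ac)
  qed
  have der1: "((\<lambda>s. F (x + s *\<^sub>R z)) has_real_derivative D z (x + s *\<^sub>R z)) (at s)"
    if "x + s *\<^sub>R z \<in> U" for x z s
  proof -
    have "((\<lambda>s. x + s *\<^sub>R z) has_derivative (\<lambda>r. r *\<^sub>R z)) (at s)"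
      by (auto intro!: derivative_eq_intros)
    from has_derivative_compose[OF this, of F "frechet_derivative F (at (x + s *\<^sub>R z))"] F1[OF that]
    have "((\<lambda>s. F (x + s *\<^sub>R z)) has_derivative (\<lambda>r. frechet_derivative F (at (x + s *\<^sub>R z)) (r *\<^sub>R z))) (at s)"
      by (simp add: frechet_derivative_works)
    then show ?thesis unfolding D_def has_field_derivative_def
      by (simp add: linear_cmul[OF linear_frechet_derivative[OF F1[OF that]]] mult.commute[of _ "frechet_derivative F (at (x + s *\<^sub>R z)) z"])
  qed
  have der2: "((\<lambda>s. D z (x + s *\<^sub>R z)) has_real_derivative E z z (x + s *\<^sub>R z)) (at s)"
    if "x + s *\<^sub>R z \<in> U" for x z s
  proof -
    have "((\<lambda>s. x + s *\<^sub>R z) has_derivative (\<lambda>r. r *\<^sub>R z)) (at s)"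
      by (auto intro!: derivative_eq_intros)
    from has_derivative_compose[OF this, of "D z" "frechet_derivative (D z) (at (x + s *\<^sub>R z))"] D_diff[OF that]
    have "((\<lambda>s. D z (x + s *\<^sub>R z)) has_derivative (\<lambda>r. frechet_derivative (D z) (at (x + s *\<^sub>R z)) (r *\<^sub>R z))) (at s)"
      by (simp add: frechet_derivative_works)
    then show ?thesis unfolding E_def has_field_derivative_def
      by (simp add: linear_cmul[OF linear_frechet_derivative[OF D_diff[OF that]]] mult.commute[of _ "frechet_derivative (D z) (at (x + s *\<^sub>R z)) z"])
  qed
  show thesis
  proof (rule that[of "M1 + 2 * M2"])
    show "0 \<le> M1 + 2 * M2" using M by simp
    fix x z assume seg: "\<And>s. \<bar>s\<bar> \<le> 1 \<Longrightarrow> x + s *\<^sub>R z \<in> S"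
    then have segU: "\<And>s. \<bar>s\<bar> \<le> 1 \<Longrightarrow> x + s *\<^sub>R z \<in> U" using S(2) by blast
    have "\<exists>s>0. s < 1 \<and> F (x + 1 *\<^sub>R z) - F (x + 0 *\<^sub>R z) = (1 - 0) * D z (x + s *\<^sub>R z)"
      by (rule MVT2[of 0 1 "\<lambda>s. F (x + s *\<^sub>R z)"]) (auto intro!: der1 segU)
    then obtain s where "0 < s" "s < 1" "F (x + z) - F x = D z (x + s *\<^sub>R z)" by auto
    then have "\<bar>F (x + z) - F x\<bar> \<le> M1 * norm z" using D_bound[OF seg[of s], of z] by simp
    moreover have "0 \<le> 2 * M2 * norm z" using M by simp
    ultimately show "\<bar>F (x + z) - F x\<bar> \<le> (M1 + 2 * M2) * norm z"
      by (simp add: distrib_right)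
    have der3: "((\<lambda>s. F (x + s *\<^sub>R z) + F (x - s *\<^sub>R z)) has_real_derivative
        (D z (x + s *\<^sub>R z) - D z (x + (- s) *\<^sub>R z))) (at s)" if "\<bar>s\<bar> \<le> 1" for s
    proof -
      have "((\<lambda>s. F (x + s *\<^sub>R z)) has_real_derivative D z (x + (- s) *\<^sub>R z)) (at (- s))"
        by (rule der1) (use segU[of "- s"] that in auto)
      then have "((\<lambda>s. F (x + (- s) *\<^sub>R z)) has_real_derivative - D z (x + (- s) *\<^sub>R z)) (at s)"
        by (simp only: DERIV_mirror)
      from DERIV_add[OF der1[OF segU[OF that]] this] show ?thesis by simp
    qed
    have "\<exists>s>0. s < 1 \<and> (F (x + 1 *\<^sub>R z) + F (x - 1 *\<^sub>R z)) - (F (x + 0 *\<^sub>R z) + F (x - 0 *\<^sub>R z))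
        = (1 - 0) * (D z (x + s *\<^sub>R z) - D z (x + (- s) *\<^sub>R z))"
      by (rule MVT2[of 0 1 "\<lambda>s. F (x + s *\<^sub>R z) + F (x - s *\<^sub>R z)"]) (use der3 in auto)
    then obtain s where s: "0 < s" "s < 1"
      "F (x + z) + F (x - z) - 2 * F x = D z (x + s *\<^sub>R z) - D z (x + (- s) *\<^sub>R z)" by auto
    have "\<exists>r>-s. r < s \<and> D z (x + s *\<^sub>R z) - D z (x + (- s) *\<^sub>R z) = (s - (- s)) * E z z (x + r *\<^sub>R z)"
      by (rule MVT2[of "- s" s "\<lambda>s. D z (x + s *\<^sub>R z)"]) (use s in \<open>auto intro!: der2 segU\<close>)
    then obtain r where r: "- s < r" "r < s"
      "D z (x + s *\<^sub>R z) - D z (x + (- s) *\<^sub>R z) = 2 * s * E z z (x + r *\<^sub>R z)" by auto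
    have "\<bar>F (x + z) + F (x - z) - 2 * F x\<bar> = 2 * s * \<bar>E z z (x + r *\<^sub>R z)\<bar>"
      unfolding s(3) r(3) using s by (simp add: abs_mult)
    also have "\<dots> \<le> 2 * 1 * (M2 * (norm z)\<^sup>2)"
      using s r by (intro mult_mono E_bound seg) auto
    also have "\<dots> \<le> (M1 + 2 * M2) * (norm z)\<^sup>2" using M by (simp add: distrib_right)
    finally show "\<bar>F (x + z) + F (x - z) - 2 * F x\<bar> \<le> (M1 + 2 * M2) * (norm z)\<^sup>2" .
  qed
qed

text \<open>The exact expansion \<open>1 / x = 1 / c - (x - c) / c^2 + (x - c)^2 / (x * c^2)\<close>
  is used at \<open>a\<close> and \<open>b\<close>: the linear terms add up to the second
  difference, and the remainders are squares of first differences. Applied to values of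
  \<open>f\<close>, this avoids differentiating \<open>1 / f\<close>.\<close>

lemma reciprocal_second_difference:
  fixes a b c m C t :: real
  assumes m: "0 < m" "m \<le> a" "m \<le> b" "m \<le> c" and t: "0 \<le> t" "0 \<le> C"
    and d: "\<bar>a - c\<bar> \<le> C * t" "\<bar>b - c\<bar> \<le> C * t" "\<bar>a + b - 2 * c\<bar> \<le> C * t\<^sup>2"
  shows "\<bar>1 / a + 1 / b - 2 / c\<bar> \<le> (C / m\<^sup>2 + 2 * C\<^sup>2 / m ^ 3) * t\<^sup>2"
proof -
  have pos: "a > 0" "b > 0" "c > 0" using m by auto
  have mc: "m\<^sup>2 \<le> c\<^sup>2" using m by (intro power_mono) auto
  have eq: "1 / a + 1 / b - 2 / c = - ((a + b - 2 * c) / c\<^sup>2) + ((a - c)\<^sup>2 / (a * c\<^sup>2) + (b - c)\<^sup>2 / (b * c\<^sup>2))"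
  proof -
    have one: "1 / x = 1 / c - (x - c) / c\<^sup>2 + (x - c)\<^sup>2 / (x * c\<^sup>2)" if "x > 0" for x
      using that pos(3) by (simp add: field_simps power2_eq_square)
    have "1 / a + 1 / b - 2 / c = - ((a - c) / c\<^sup>2 + (b - c) / c\<^sup>2) + ((a - c)\<^sup>2 / (a * c\<^sup>2) + (b - c)\<^sup>2 / (b * c\<^sup>2))"
      unfolding one[OF pos(1)] one[OF pos(2)] by simp
    also have "(a - c) / c\<^sup>2 + (b - c) / c\<^sup>2 = (a + b - 2 * c) / c\<^sup>2"
      by (simp add: add_divide_distrib[symmetric])
    finally show ?thesis .
  qed
  have first: "\<bar>(a + b - 2 * c) / c\<^sup>2\<bar> \<le> C * t\<^sup>2 / m\<^sup>2"
    unfolding abs_divide using d(3) mc m by (intro frac_le) auto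
  have second: "(x - c)\<^sup>2 / (x * c\<^sup>2) \<le> C\<^sup>2 * t\<^sup>2 / m ^ 3" if "m \<le> x" "\<bar>x - c\<bar> \<le> C * t" for x
  proof (rule frac_le)
    show "(x - c)\<^sup>2 \<le> C\<^sup>2 * t\<^sup>2"
      using power_mono[OF that(2), of 2] by (simp add: power_mult_distrib)
    show "m ^ 3 \<le> x * c\<^sup>2"
      using mult_mono[OF that(1) mc] m that by (simp add: power3_eq_cube power2_eq_square mult.assoc)
  qed (use m in auto)
  have "\<bar>1 / a + 1 / b - 2 / c\<bar> \<le> C * t\<^sup>2 / m\<^sup>2 + (C\<^sup>2 * t\<^sup>2 / m ^ 3 + C\<^sup>2 * t\<^sup>2 / m ^ 3)"
  proof -
    have "0 \<le> (a - c)\<^sup>2 / (a * c\<^sup>2)" "0 \<le> (b - c)\<^sup>2 / (b * c\<^sup>2)" using pos by auto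
    then show ?thesis
      unfolding eq using first second[OF m(2) d(1)] second[OF m(3) d(2)] by linarith
  qed
  also have "\<dots> = (C / m\<^sup>2 + 2 * C\<^sup>2 / m ^ 3) * t\<^sup>2" by (simp add: algebra_simps)
  finally show ?thesis .
qed

section \<open>The main estimate\<close>

context bump
begin

section \<open>Norms and differences of the rescaled bump\<close>

lemma phi_compact_cbox: obtains a where "\<And>y. y \<notin> cbox (-a) a \<Longrightarrow> \<phi> y = 0"
proof -
  obtain a :: "real^'n" where a: "cball 0 1 \<subseteq> cbox (-a) a"
    using bounded_subset_cbox_symmetric[OF bounded_cball] by blast
  have "\<phi> y = 0" if "y \<notin> cbox (-a) a" for y
  proof -
    have "y \<notin> cball 0 1" using a that by blast
    then show ?thesis by (intro zero_outside) simp
  qed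
  then show thesis by (rule that)
qed

text \<open>A vanishing square integral would make \<open>\<phi>\<close> zero almost everywhere,
  against \<open>integral_one\<close>.\<close>

lemma phi_square_integral_pos: "0 < (LINT x|lborel. (\<phi> x)\<^sup>2)"
proof -
  obtain a where a: "\<And>y. y \<notin> cbox (-a) a \<Longrightarrow> \<phi> y = 0" by (rule phi_compact_cbox) blast
  have i: "integrable lborel (\<lambda>x. (\<phi> x)\<^sup>2)"
    by (rule integrable_lborel_continuous_compact_support[of _ "-a" a])
      (auto simp: a continuous_on_power smooth_fun_continuous_on[OF smooth])
  have "(LINT x|lborel. (\<phi> x)\<^sup>2) \<noteq> 0"
  proof
    assume "(LINT x|lborel. (\<phi> x)\<^sup>2) = 0"
    then have "AE x in lborel. (\<phi> x)\<^sup>2 = 0"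
      using integral_nonneg_eq_0_iff_AE[OF i] by simp
    then have "AE x in lborel. \<phi> x = 0" by eventually_elim simp
    then have "(LINT x|lborel. \<phi> x) = 0" by (rule integral_eq_zero_AE)
    then show False using integral_one by simp
  qed
  moreover have "0 \<le> (LINT x|lborel. (\<phi> x)\<^sup>2)" by simp
  ultimately show ?thesis by linarith
qed

lemma mol_square_integral:
  assumes "0 < \<epsilon>"
  shows "(LINT y|lborel. (mol \<epsilon> y)\<^sup>2) = (1 / \<epsilon>) ^ CARD('n) * (LINT x|lborel. (\<phi> x)\<^sup>2)"
proof -
  have "(LINT y|lborel. (mol \<epsilon> y)\<^sup>2)
      = ((1 / \<epsilon>) ^ CARD('n))\<^sup>2 * (LINT y|lborel. (\<phi> (0 + (1 / \<epsilon>) *\<^sub>R y))\<^sup>2)"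
    unfolding mol_def power_mult_distrib powr_minus_card[OF assms] by (rule integral_mult_right_zero)
  also have "\<dots> = (1 / \<epsilon>) ^ CARD('n) * (\<bar>1 / \<epsilon>\<bar> ^ DIM(real^'n) * (LINT y|lborel. (\<phi> (0 + (1 / \<epsilon>) *\<^sub>R y))\<^sup>2))"
    using assms by (simp add: power2_eq_square)
  also have "\<bar>1 / \<epsilon>\<bar> ^ DIM(real^'n) * (LINT y|lborel. (\<phi> (0 + (1 / \<epsilon>) *\<^sub>R y))\<^sup>2) = (LINT x|lborel. (\<phi> x)\<^sup>2)"
    by (rule integral_lborel_affine[of "\<lambda>x. (\<phi> x)\<^sup>2", symmetric]) (use assms in auto)
  finally show ?thesis .
qed

text \<open>Powers of \<open>1 / \<epsilon>\<close>, with n the dimension: the squared normalisation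
  gives 2 n, the \<open>k\<close> derivatives give 2 k, and the change of variables takes back n.
  The centre \<open>x\<close> drops out by translation invariance.\<close>

lemma mol_difference_bound:
  obtains N where "0 \<le> N"
    "\<And>\<epsilon> x t. 0 < \<epsilon> \<Longrightarrow> (\<integral>\<^sup>+y. ennreal (((fdiff t ^^ k) (\<lambda>y. mol \<epsilon> (x - y)) y)\<^sup>2) \<partial>lborel)
      \<le> ennreal (((1 / \<epsilon>) ^ CARD('n) * (1 / \<epsilon>) ^ (2 * k) * N) * norm t ^ (2 * k))"
proof -
  obtain a where a: "\<And>y. y \<notin> cbox (-a) a \<Longrightarrow> \<phi> y = 0" by (rule phi_compact_cbox) blast
  define I where "I \<alpha> = (LINT x|lborel. (pderivs \<alpha> \<phi> x)\<^sup>2)" for \<alpha>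
  have I0: "0 \<le> I \<alpha>" for \<alpha> unfolding I_def by simp
  have pm [measurable]: "pderivs \<alpha> \<phi> \<in> borel_measurable borel" for \<alpha>
    by (intro borel_measurable_continuous_onI smooth_fun_continuous_on smooth_pderivs smooth)
  have I: "(\<integral>\<^sup>+x. ennreal ((pderivs \<alpha> \<phi> x)\<^sup>2) \<partial>lborel) = ennreal (I \<alpha>)" for \<alpha>
    unfolding I_def
  proof (rule nn_integral_eq_integral)
    show "integrable lborel (\<lambda>x. (pderivs \<alpha> \<phi> x)\<^sup>2)"
      by (rule integrable_lborel_continuous_compact_support[of _ "-a" a])
        (auto simp: pderivs_eq_0_outside_closed[OF closed_cbox a] continuous_on_power
          smooth_fun_continuous_on[OF smooth_pderivs[OF smooth]])
  qed simp
  define N where "N = (\<Sum>\<alpha> | length (\<alpha>::'n list) = k. I \<alpha>)"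
  have N0: "0 \<le> N" unfolding N_def using I0 by (intro sum_nonneg)
  show thesis
  proof (rule that[OF N0])
    fix \<epsilon> :: real and x t :: "real^'n" assume \<epsilon>: "0 < \<epsilon>"
    define b where "b = (1 / \<epsilon>) ^ CARD('n)"
    have b0: "0 < b" unfolding b_def using \<epsilon> by simp
    define u where "u y = b * \<phi> (- ((1 / \<epsilon>) *\<^sub>R x) + (1 / \<epsilon>) *\<^sub>R y)" for y
    have u: "smooth_fun u" unfolding u_def[abs_def] by (rule smooth_fun_affine[OF smooth])
    have "mol \<epsilon> (x - y) = u y" for y
      using mol_even[of \<epsilon> "x - y"] unfolding u_def mol_def b_def powr_minus_card[OF \<epsilon>]
      by (auto simp: scaleR_diff_right)
    then have mu: "(\<lambda>y. mol \<epsilon> (x - y)) = u" by blast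
    have pd: "(\<integral>\<^sup>+y. ennreal ((pderivs \<alpha> u y)\<^sup>2) \<partial>lborel) = ennreal (b * (1 / \<epsilon>) ^ (2 * k) * I \<alpha>)"
      if "length \<alpha> = k" for \<alpha>
    proof -
      define s where "s = (b * (1 / \<epsilon>) ^ k)\<^sup>2"
      have s: "s = b * (b * (1 / \<epsilon>) ^ (2 * k))"
        unfolding s_def by (simp add: power2_eq_square mult_2 power_add)
      have s0: "0 \<le> s" unfolding s_def by simp
      have "(\<integral>\<^sup>+y. ennreal ((pderivs \<alpha> u y)\<^sup>2) \<partial>lborel)
          = (\<integral>\<^sup>+y. ennreal s * ennreal ((pderivs \<alpha> \<phi> (- ((1 / \<epsilon>) *\<^sub>R x) + (1 / \<epsilon>) *\<^sub>R y))\<^sup>2) \<partial>lborel)"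
        unfolding u_def[abs_def] pderivs_affine[OF smooth] that power_mult_distrib[of "b * (1 / \<epsilon>) ^ k"] s_def[symmetric]
        by (intro nn_integral_cong ennreal_mult s0) simp
      also have "\<dots> = ennreal s * (\<integral>\<^sup>+y. ennreal ((pderivs \<alpha> \<phi> (- ((1 / \<epsilon>) *\<^sub>R x) + (1 / \<epsilon>) *\<^sub>R y))\<^sup>2) \<partial>lborel)"
        by (rule nn_integral_cmult) measurable
      also have "\<dots> = ennreal (b * (1 / \<epsilon>) ^ (2 * k)) * (ennreal (\<bar>1 / \<epsilon>\<bar> ^ DIM(real^'n)) *
          (\<integral>\<^sup>+y. ennreal ((pderivs \<alpha> \<phi> (- ((1 / \<epsilon>) *\<^sub>R x) + (1 / \<epsilon>) *\<^sub>R y))\<^sup>2) \<partial>lborel))"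
        using \<epsilon> b0 unfolding s by (simp add: b_def[symmetric] ennreal_mult mult_ac)
      also have "ennreal (\<bar>1 / \<epsilon>\<bar> ^ DIM(real^'n)) *
          (\<integral>\<^sup>+y. ennreal ((pderivs \<alpha> \<phi> (- ((1 / \<epsilon>) *\<^sub>R x) + (1 / \<epsilon>) *\<^sub>R y))\<^sup>2) \<partial>lborel) = ennreal (I \<alpha>)"
        unfolding I[symmetric]
        by (rule nn_integral_lborel_affine[of "\<lambda>y. ennreal ((pderivs \<alpha> \<phi> y)\<^sup>2)", symmetric]) (use \<epsilon> in auto)
      finally show ?thesis using b0 \<epsilon> I0 by (simp add: ennreal_mult)
    qed
    have "(\<integral>\<^sup>+y. ennreal (((fdiff t ^^ k) u y)\<^sup>2) \<partial>lborel)
        \<le> ennreal (norm t ^ (2 * k)) * (\<Sum>\<alpha> | length \<alpha> = k. \<integral>\<^sup>+x. ennreal ((pderivs \<alpha> u x)\<^sup>2) \<partial>lborel)"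
      by (rule nn_integral_fdiff_funpow_le[OF u])
    also have "(\<Sum>\<alpha> | length \<alpha> = k. \<integral>\<^sup>+x. ennreal ((pderivs \<alpha> u x)\<^sup>2) \<partial>lborel)
        = (\<Sum>\<alpha> | length \<alpha> = k. ennreal (b * (1 / \<epsilon>) ^ (2 * k) * I \<alpha>))"
      by (rule sum.cong) (auto simp: pd)
    also have "\<dots> = ennreal (\<Sum>\<alpha> | length \<alpha> = k. b * (1 / \<epsilon>) ^ (2 * k) * I \<alpha>)"
      by (rule sum_ennreal) (use b0 \<epsilon> I0 in \<open>intro mult_nonneg_nonneg, auto\<close>)
    also have "(\<Sum>\<alpha> | length \<alpha> = k. b * (1 / \<epsilon>) ^ (2 * k) * I \<alpha>) = b * (1 / \<epsilon>) ^ (2 * k) * N"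
      unfolding N_def by (simp only: sum_distrib_left)
    also have "ennreal (norm t ^ (2 * k)) * ennreal (b * (1 / \<epsilon>) ^ (2 * k) * N)
        = ennreal ((b * (1 / \<epsilon>) ^ (2 * k) * N) * norm t ^ (2 * k))"
      by (subst ennreal_mult[symmetric]) (use b0 \<epsilon> N0 in \<open>auto simp: mult.commute\<close>)
    finally show "(\<integral>\<^sup>+y. ennreal (((fdiff t ^^ k) (\<lambda>y. mol \<epsilon> (x - y)) y)\<^sup>2) \<partial>lborel)
      \<le> ennreal (((1 / \<epsilon>) ^ CARD('n) * (1 / \<epsilon>) ^ (2 * k) * N) * norm t ^ (2 * k))"
      unfolding mu b_def .
  qed
qed

text \<open>Substituting \<open>y = x + z\<close> and \<open>y = x - z\<close> and adding turns the
  error into an average of second differences; evenness of the bump is what cancels the first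
  order.\<close>

lemma weighted_average_bound:
  assumes \<epsilon>: "0 < \<epsilon>" and w: "continuous_on UNIV w"
    and B: "\<And>z. norm z < \<epsilon> \<Longrightarrow> \<bar>w (x + z) + w (x - z) - 2 * w x\<bar> \<le> B * \<epsilon>\<^sup>2"
  shows "\<bar>(LINT y|lborel. (mol \<epsilon> (x - y))\<^sup>2 * w y) - w x * (LINT y|lborel. (mol \<epsilon> y)\<^sup>2)\<bar>
    \<le> B / 2 * \<epsilon>\<^sup>2 * (LINT y|lborel. (mol \<epsilon> y)\<^sup>2)"
proof -
  have [measurable]: "w \<in> borel_measurable borel" by (rule borel_measurable_continuous_onI[OF w])
  define A where "A = (LINT y|lborel. (mol \<epsilon> (x - y))\<^sup>2 * w y)"
  define S where "S = (LINT y|lborel. (mol \<epsilon> y)\<^sup>2)"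
  have int: "integrable lborel (\<lambda>z. (mol \<epsilon> z)\<^sup>2 * v z)" if "continuous_on UNIV v" for v
    using integrable_mult_mol[OF \<epsilon>, of "\<lambda>z. mol \<epsilon> z * v z" 0]
      continuous_on_mult[OF mol_continuous that] mol_even
    by (simp add: power2_eq_square mult_ac)
  have cw: "continuous_on UNIV (\<lambda>z. w (x + z))" "continuous_on UNIV (\<lambda>z. w (x - z))"
    by (intro continuous_on_compose2[OF w] continuous_intros; simp)+
  have "A = \<bar>1\<bar> ^ DIM(real^'n) * (LINT z|lborel. (mol \<epsilon> (x - (x + 1 *\<^sub>R z)))\<^sup>2 * w (x + 1 *\<^sub>R z))"
    unfolding A_def by (rule integral_lborel_affine) auto
  then have A1: "A = (LINT z|lborel. (mol \<epsilon> z)\<^sup>2 * w (x + z))" using mol_even by simp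
  have "A = \<bar>-1\<bar> ^ DIM(real^'n) * (LINT z|lborel. (mol \<epsilon> (x - (x + (-1) *\<^sub>R z)))\<^sup>2 * w (x + (-1) *\<^sub>R z))"
    unfolding A_def by (rule integral_lborel_affine) auto
  then have A2: "A = (LINT z|lborel. (mol \<epsilon> z)\<^sup>2 * w (x - z))" by simp
  have i1: "integrable lborel (\<lambda>z. (mol \<epsilon> z)\<^sup>2 * w (x + z))" by (rule int[OF cw(1)])
  have i2: "integrable lborel (\<lambda>z. (mol \<epsilon> z)\<^sup>2 * w (x - z))" by (rule int[OF cw(2)])
  have i3: "integrable lborel (\<lambda>z. (mol \<epsilon> z)\<^sup>2)" using int[OF continuous_on_const[of _ 1]] by simp
  define G where "G z = w (x + z) + w (x - z) - 2 * w x" for z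
  have "(LINT z|lborel. (mol \<epsilon> z)\<^sup>2 * G z)
      = (LINT z|lborel. ((mol \<epsilon> z)\<^sup>2 * w (x + z) + (mol \<epsilon> z)\<^sup>2 * w (x - z)) - (2 * w x) * (mol \<epsilon> z)\<^sup>2)"
    unfolding G_def by (simp add: algebra_simps)
  also have "\<dots> = 2 * A - 2 * w x * S"
    using i1 i2 i3 by (simp add: A1[symmetric] A2[symmetric] S_def)
  finally have eq: "2 * A - 2 * w x * S = (LINT z|lborel. (mol \<epsilon> z)\<^sup>2 * G z)" by simp
  have iG: "integrable lborel (\<lambda>z. (mol \<epsilon> z)\<^sup>2 * G z)"
    unfolding G_def by (intro int continuous_intros cw)
  have "\<bar>2 * A - 2 * w x * S\<bar> \<le> (LINT z|lborel. norm ((mol \<epsilon> z)\<^sup>2 * G z))"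
    unfolding eq using integral_norm_bound[of lborel "\<lambda>z. (mol \<epsilon> z)\<^sup>2 * G z"] by simp
  also have "\<dots> \<le> (LINT z|lborel. (mol \<epsilon> z)\<^sup>2 * (B * \<epsilon>\<^sup>2))"
  proof (rule integral_mono[OF integrable_norm[OF iG]])
    show "integrable lborel (\<lambda>z. (mol \<epsilon> z)\<^sup>2 * (B * \<epsilon>\<^sup>2))" using i3 by simp
    fix z
    show "norm ((mol \<epsilon> z)\<^sup>2 * G z) \<le> (mol \<epsilon> z)\<^sup>2 * (B * \<epsilon>\<^sup>2)"
      using B[of z] mol_zero[OF \<epsilon>, of z] unfolding G_def
      by (cases "norm z < \<epsilon>") (auto simp: abs_mult mult_left_mono)
  qed
  also have "\<dots> = B * \<epsilon>\<^sup>2 * S" unfolding S_def using i3 by simp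
  finally have "\<bar>2 * A - 2 * w x * S\<bar> \<le> B * \<epsilon>\<^sup>2 * S" .
  moreover have "2 * A - 2 * w x * S = 2 * (A - w x * S)" by simp
  ultimately have "\<bar>A - w x * S\<bar> \<le> B * \<epsilon>\<^sup>2 * S / 2" by (simp only: abs_mult)
  then show ?thesis unfolding A_def S_def by (simp add: mult_ac)
qed

end

lemma poly_product_error:
  fixes u w p q :: real
  assumes "\<bar>w\<bar> \<le> b" "\<bar>p\<bar> \<le> c"
  shows "(u * w - p * q)\<^sup>2 \<le> 2 * b\<^sup>2 * (u - p)\<^sup>2 + 2 * c\<^sup>2 * (w - q)\<^sup>2"
proof -
  have sq: "(s + t)\<^sup>2 \<le> 2 * s\<^sup>2 + 2 * t\<^sup>2" for s t :: real
    using zero_le_power2[of "s - t"] by (simp add: power2_eq_square algebra_simps)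
  have "(u * w - p * q)\<^sup>2 = ((u - p) * w + p * (w - q))\<^sup>2" by (simp add: algebra_simps)
  also have "\<dots> \<le> 2 * ((u - p) * w)\<^sup>2 + 2 * (p * (w - q))\<^sup>2" by (rule sq)
  also have "\<dots> = 2 * (w\<^sup>2 * (u - p)\<^sup>2) + 2 * (p\<^sup>2 * (w - q)\<^sup>2)" by (simp add: power_mult_distrib)
  also have "\<dots> \<le> 2 * (b\<^sup>2 * (u - p)\<^sup>2) + 2 * (c\<^sup>2 * (w - q)\<^sup>2)"
  proof -
    have "w\<^sup>2 \<le> b\<^sup>2" "p\<^sup>2 \<le> c\<^sup>2"
      using power_mono[OF assms(1), of 2] power_mono[OF assms(2), of 2] by auto
    then show ?thesis by (intro add_mono mult_left_mono mult_right_mono) auto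
  qed
  finally show ?thesis by (simp add: mult_ac)
qed

lemma (in bump) polynomial_approximation:
  fixes X K :: "(real^'n) set" and f w :: "real^'n \<Rightarrow> real" and k :: nat
  assumes X: "compact X" and f: "continuous_on X f" "\<And>x. x \<in> X \<Longrightarrow> 0 \<le> f x \<and> f x \<le> M"
    and k: "CARD('n) \<le> 2 * k"
    and w: "continuous_on UNIV w" "\<And>y. y \<notin> interior X \<Longrightarrow> w y = 0"
    and N: "0 \<le> N" "\<And>t. (\<integral>\<^sup>+x. ennreal (((fdiff t ^^ k) w x)\<^sup>2) \<partial>lborel) \<le> ennreal (N * norm t ^ (2 * k))"
    and near: "\<And>x y. x \<in> K \<Longrightarrow> norm (x - y) \<le> \<rho> \<Longrightarrow> y \<in> interior X"
  obtains A where "0 < A"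
    "\<And>x d \<epsilon>. \<lbrakk>x \<in> K; d \<ge> 1; 0 < \<epsilon>; \<epsilon> \<le> \<rho>; \<epsilon> \<le> 1\<rbrakk> \<Longrightarrow> \<exists>P. poly_fun d P \<and>
      (LINT y|lborel. indicator X y * f y * (mol \<epsilon> (x - y) * w y - P y)\<^sup>2)
        \<le> A * (1 / \<epsilon>) ^ CARD('n) / (\<epsilon> * real d) ^ (2 * k)"
proof -
  obtain R0 where R0: "\<And>x. x \<in> X \<Longrightarrow> norm x \<le> R0"
    using compact_imp_bounded[OF X] unfolding bounded_iff by blast
  define R where "R = max 1 (R0 + 1)"
  have R: "1 \<le> R" and XR: "X \<subseteq> ball 0 R" using R0 unfolding R_def by force+
  have iXR: "norm y < R" if "y \<in> interior X" for y
    using that XR interior_subset[of X] by auto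
  obtain Bw where Bw: "0 \<le> Bw" "\<And>y. \<bar>w y\<bar> \<le> Bw"
  proof -
    obtain b where "b \<ge> 0" "\<forall>y\<in>X. \<bar>w y\<bar> \<le> b"
      using compact_continuous_abs_bound[OF X continuous_on_subset[OF w(1)]] by auto
    then have "\<bar>w y\<bar> \<le> b" for y using w(2)[of y] interior_subset[of X] by (cases "y \<in> interior X") auto
    then show thesis using that \<open>b \<ge> 0\<close> by blast
  qed
  obtain Bp where Bp: "0 \<le> Bp" "\<And>y. \<bar>\<phi> y\<bar> \<le> Bp"
  proof -
    obtain b where "b \<ge> 0" "\<forall>y\<in>cball 0 1. \<bar>\<phi> y\<bar> \<le> b"
      using compact_continuous_abs_bound[OF compact_cball smooth_fun_continuous_on[OF smooth]] by blast
    then have "\<bar>\<phi> y\<bar> \<le> b" for y using zero_outside[of y] by (cases "norm y \<le> 1") auto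
    then show thesis using that \<open>b \<ge> 0\<close> by blast
  qed
  obtain Np where Np: "0 \<le> Np"
    "\<And>\<epsilon> x t. 0 < \<epsilon> \<Longrightarrow> (\<integral>\<^sup>+y. ennreal (((fdiff t ^^ k) (\<lambda>y. mol \<epsilon> (x - y)) y)\<^sup>2) \<partial>lborel)
      \<le> ennreal (((1 / \<epsilon>) ^ CARD('n) * (1 / \<epsilon>) ^ (2 * k) * Np) * norm t ^ (2 * k))"
    by (rule mol_difference_bound) blast
  obtain C r where C: "C > 0" and r: "r > 0" and jackson:
    "\<And>j (u :: real^'n \<Rightarrow> real) N Bd. \<lbrakk>continuous_on UNIV u; \<And>y. R \<le> norm y \<Longrightarrow> u y = 0;
       \<And>y. \<bar>u y\<bar> \<le> Bd; 0 \<le> N;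
       \<And>t. (\<integral>\<^sup>+x. ennreal (((fdiff t ^^ k) u x)\<^sup>2) \<partial>lborel) \<le> ennreal (N * norm t ^ (2 * k))\<rbrakk>
     \<Longrightarrow> \<exists>q. poly_fun (4 * r * j) q \<and> (\<forall>x\<in>ball 0 R. \<bar>q x\<bar> \<le> C * Bd) \<and>
       (\<integral>\<^sup>+x. ennreal (indicator (ball 0 R) x * (u x - q x)\<^sup>2) \<partial>lborel)
         \<le> ennreal (C * N / (2 * real j + 1) ^ (2 * k))"
    by (rule jackson_approximation[OF R, of k]) blast
  \<comment> \<open>\<open>M\<close> may be negative when \<open>X\<close> is empty; the maximum is
    nonnegative in every case.\<close>
  define M' where "M' = max M 0"
  have M': "0 \<le> M'" "\<And>x. x \<in> X \<Longrightarrow> f x \<le> M'" unfolding M'_def using f(2) by force+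
  \<comment> \<open>The two summands are the contributions of approximating the bump and
    \<open>w\<close>; the last factor is the loss in \<open>d \<le> 8 * r * m\<close>.\<close>
  define A where "A = M' * (2 * Bw\<^sup>2 * (C * Np) + 2 * (C * Bp)\<^sup>2 * (C * N)) * real (8 * r) ^ (2 * k) + 1"
  have A0: "0 \<le> M' * (2 * Bw\<^sup>2 * (C * Np) + 2 * (C * Bp)\<^sup>2 * (C * N)) * real (8 * r) ^ (2 * k)"
    using M'(1) C Np(1) N(1) by (intro mult_nonneg_nonneg add_nonneg_nonneg) auto
  have A: "A > 0" unfolding A_def using A0 by linarith
  show thesis
  proof (rule that[OF A])
    fix x and d :: nat and \<epsilon> :: real
    assume x: "x \<in> K" and d: "d \<ge> 1" and \<epsilon>: "0 < \<epsilon>" "\<epsilon> \<le> \<rho>" "\<epsilon> \<le> 1"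
    define e where "e = (1 / \<epsilon>) ^ CARD('n)"
    define e2 where "e2 = (1 / \<epsilon>) ^ (2 * k)"
    \<comment> \<open>The condition on the dimension enters here, together with
      \<open>\<epsilon> \<le> 1\<close>: \<open>e * e\<close>, from the squared sup norm of the
      bump, is then at most \<open>e * e2\<close>.\<close>
    have ee: "0 \<le> e" "0 \<le> e2" "e \<le> e2"
      unfolding e_def e2_def using \<epsilon> k by (auto intro!: power_increasing)
    define u where "u y = mol \<epsilon> (x - y)" for y
    have uc: "continuous_on UNIV u"
      unfolding u_def by (intro continuous_on_compose2[OF mol_continuous[of UNIV]] continuous_intros) auto
    have uz: "u y = 0" if "R \<le> norm y" for y
    proof (rule ccontr)
      assume "u y \<noteq> 0"
      then have "norm (x - y) < \<epsilon>" unfolding u_def using mol_zero[OF \<epsilon>(1), of "x - y"] by force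
      then have "y \<in> interior X" using near[OF x, of y] \<epsilon>(2) by simp
      then show False using iXR that by force
    qed
    have ub: "\<bar>u y\<bar> \<le> e * Bp" for y
      unfolding u_def mol_def powr_minus_card[OF \<epsilon>(1)] e_def[symmetric]
      using Bp(2) ee(1) by (simp add: abs_mult mult_left_mono)
    \<comment> \<open>Both approximants get degree \<open>4 * r * j\<close>, so the product has
      degree \<open>8 * r * j \<le> d\<close>, while \<open>d < 8 * r * (j + 1)\<close> keeps
      \<open>2 * j + 1\<close> comparable with \<open>d\<close>. For \<open>d < 8 * r\<close> this
      means \<open>j = 0\<close>, with constant approximants.\<close>
    define j where "j = d div (8 * r)"
    define m where "m = 2 * real j + 1"
    have dm: "real d \<le> real (8 * r) * m"
    proof -
      have "8 * r * j + d mod (8 * r) = d" unfolding j_def by (rule mult_div_mod_eq)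
      moreover have "d mod (8 * r) < 8 * r" using r by simp
      ultimately have "d < 8 * r * (j + 1)"
        by (simp only: distrib_left mult_1_right)
      then have "real d \<le> real (8 * r) * (real j + 1)"
        by (metis of_nat_less_iff of_nat_mult of_nat_add of_nat_1 less_imp_le)
      also have "\<dots> \<le> real (8 * r) * m" unfolding m_def by (intro mult_left_mono) auto
      finally show ?thesis .
    qed
    obtain p where p: "poly_fun (4 * r * j) p" "\<And>y. y \<in> ball 0 R \<Longrightarrow> \<bar>p y\<bar> \<le> C * (e * Bp)"
      "(\<integral>\<^sup>+y. ennreal (indicator (ball 0 R) y * (u y - p y)\<^sup>2) \<partial>lborel) \<le> ennreal (C * (e * e2 * Np) / m ^ (2 * k))"
    proof -
      have "0 \<le> e * e2 * Np" using ee Np(1) by simp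
      from jackson[OF uc uz ub this] Np(2)[OF \<epsilon>(1), of _ x, folded u_def e_def e2_def]
      show thesis using that unfolding m_def by blast
    qed
    obtain q where q: "poly_fun (4 * r * j) q"
      "(\<integral>\<^sup>+y. ennreal (indicator (ball 0 R) y * (w y - q y)\<^sup>2) \<partial>lborel) \<le> ennreal (C * N / m ^ (2 * k))"
    proof -
      have wz: "w y = 0" if "R \<le> norm y" for y using w(2)[of y] iXR[of y] that by force
      from jackson[OF w(1) wz Bw(2) N] show thesis using that unfolding m_def by blast
    qed
    define P where "P y = p y * q y" for y
    have "poly_fun (4 * r * j + 4 * r * j) P"
      unfolding P_def[abs_def] by (rule poly_fun_mult[OF p(1) q(1)])
    moreover have "4 * r * j + 4 * r * j \<le> d"
    proof -
      have "4 * r * j + 4 * r * j = 8 * r * j" by simp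
      also have "\<dots> \<le> d" unfolding j_def by (rule times_div_less_eq_dividend)
      finally show ?thesis .
    qed
    ultimately have P: "poly_fun d P" by (rule poly_fun_le_degree)
    have [measurable]: "p \<in> borel_measurable borel" "q \<in> borel_measurable borel"
      "u \<in> borel_measurable borel" "w \<in> borel_measurable borel" "P \<in> borel_measurable borel"
      using poly_fun_continuous_on[OF p(1), of UNIV] poly_fun_continuous_on[OF q(1), of UNIV]
        poly_fun_continuous_on[OF P, of UNIV] uc w(1)
      by (auto intro: borel_measurable_continuous_onI)
    have fm: "(\<lambda>y. indicator X y * f y) \<in> borel_measurable lborel"
      using borel_measurable_integrable[OF borel_integrable_compact[OF X f(1)]] by simp
    have Br [measurable]: "ball (0::real^'n) R \<in> sets borel" by simp
    define a where "a = M' * (2 * Bw\<^sup>2)"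
    define b where "b = M' * (2 * (C * (e * Bp))\<^sup>2)"
    have ab: "0 \<le> a" "0 \<le> b" unfolding a_def b_def using M'(1) by auto
    have pt: "indicator X y * f y * (u y * w y - P y)\<^sup>2
        \<le> a * (indicator (ball 0 R) y * (u y - p y)\<^sup>2) + b * (indicator (ball 0 R) y * (w y - q y)\<^sup>2)" for y
    proof (cases "y \<in> X")
      case True
      then have yR: "y \<in> ball 0 R" using XR by blast
      have "f y * (u y * w y - P y)\<^sup>2 \<le> M' * (2 * Bw\<^sup>2 * (u y - p y)\<^sup>2 + 2 * (C * (e * Bp))\<^sup>2 * (w y - q y)\<^sup>2)"
        unfolding P_def using True M' f(2)[OF True] p(2)[OF yR] Bw(2)
        by (intro mult_mono poly_product_error) auto
      then show ?thesis using True yR unfolding a_def b_def by (simp add: algebra_simps)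
    qed (use ab in \<open>auto intro!: add_nonneg_nonneg mult_nonneg_nonneg\<close>)
    define bd where "bd = a * (C * (e * e2 * Np) / m ^ (2 * k)) + b * (C * N / m ^ (2 * k))"
    have m: "m > 0" unfolding m_def by simp
    have t0: "0 \<le> C * (e * e2 * Np) / m ^ (2 * k)" "0 \<le> C * N / m ^ (2 * k)"
      using C ee Np(1) N(1) m by (intro mult_nonneg_nonneg divide_nonneg_nonneg; simp)+
    have bd0: "0 \<le> a * (C * (e * e2 * Np) / m ^ (2 * k))" "0 \<le> b * (C * N / m ^ (2 * k))"
      by (intro mult_nonneg_nonneg ab t0)+
    have "(\<integral>\<^sup>+y. ennreal (indicator X y * f y * (u y * w y - P y)\<^sup>2) \<partial>lborel)
        \<le> (\<integral>\<^sup>+y. ennreal a * ennreal (indicator (ball 0 R) y * (u y - p y)\<^sup>2)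
            + ennreal b * ennreal (indicator (ball 0 R) y * (w y - q y)\<^sup>2) \<partial>lborel)"
    proof (rule nn_integral_mono)
      fix y
      have "ennreal (indicator X y * f y * (u y * w y - P y)\<^sup>2)
        \<le> ennreal (a * (indicator (ball 0 R) y * (u y - p y)\<^sup>2) + b * (indicator (ball 0 R) y * (w y - q y)\<^sup>2))"
        by (rule ennreal_leI[OF pt])
      also have "\<dots> = ennreal a * ennreal (indicator (ball 0 R) y * (u y - p y)\<^sup>2)
            + ennreal b * ennreal (indicator (ball 0 R) y * (w y - q y)\<^sup>2)"
        using ab by (subst ennreal_plus) (auto simp: ennreal_mult intro!: mult_nonneg_nonneg)
      finally show "ennreal (indicator X y * f y * (u y * w y - P y)\<^sup>2)
        \<le> ennreal a * ennreal (indicator (ball 0 R) y * (u y - p y)\<^sup>2)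
            + ennreal b * ennreal (indicator (ball 0 R) y * (w y - q y)\<^sup>2)" .
    qed
    also have "\<dots> = ennreal a * (\<integral>\<^sup>+y. ennreal (indicator (ball 0 R) y * (u y - p y)\<^sup>2) \<partial>lborel)
            + ennreal b * (\<integral>\<^sup>+y. ennreal (indicator (ball 0 R) y * (w y - q y)\<^sup>2) \<partial>lborel)"
      by (subst nn_integral_add, measurable, subst (1 2) nn_integral_cmult) measurable
    also have "\<dots> \<le> ennreal a * ennreal (C * (e * e2 * Np) / m ^ (2 * k)) + ennreal b * ennreal (C * N / m ^ (2 * k))"
      by (intro add_mono mult_left_mono p(3) q(2)) auto
    also have "\<dots> = ennreal bd"
      unfolding bd_def ennreal_plus[OF bd0] ennreal_mult[OF ab(1) t0(1)] ennreal_mult[OF ab(2) t0(2)]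
      by (rule refl)
    finally have nn: "(\<integral>\<^sup>+y. ennreal (indicator X y * f y * (u y * w y - P y)\<^sup>2) \<partial>lborel) \<le> ennreal bd" .
    have "(LINT y|lborel. indicator X y * f y * (u y * w y - P y)\<^sup>2)
        = enn2real (\<integral>\<^sup>+y. ennreal (indicator X y * f y * (u y * w y - P y)\<^sup>2) \<partial>lborel)"
    proof (rule integral_eq_nn_integral)
      show "(\<lambda>y. indicator X y * f y * (u y * w y - P y)\<^sup>2) \<in> borel_measurable lborel"
        by (rule borel_measurable_times[OF fm]) measurable
      show "AE y in lborel. 0 \<le> indicator X y * f y * (u y * w y - P y)\<^sup>2"
        by (rule AE_I2) (auto simp: indicator_def f(2))
    qed
    also have "\<dots> \<le> bd"
      using nn bd0 unfolding bd_def by (intro enn2real_leI) auto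
    also have "bd \<le> A * e / (\<epsilon> * real d) ^ (2 * k)"
    proof -
      define Q where "Q = M' * (2 * Bw\<^sup>2 * (C * Np) + 2 * (C * Bp)\<^sup>2 * (C * N))"
      have Q0: "0 \<le> Q" unfolding Q_def
        using M'(1) C Np(1) N(1) by (intro mult_nonneg_nonneg add_nonneg_nonneg) auto
      have "bd = (M' * (2 * Bw\<^sup>2 * (C * Np)) * (e * e2) + M' * (2 * (C * Bp)\<^sup>2 * (C * N)) * (e * e)) / m ^ (2 * k)"
        unfolding bd_def a_def b_def by (simp add: add_divide_distrib power2_eq_square mult_ac)
      also have "\<dots> \<le> (M' * (2 * Bw\<^sup>2 * (C * Np)) * (e * e2) + M' * (2 * (C * Bp)\<^sup>2 * (C * N)) * (e * e2)) / m ^ (2 * k)"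
        using M'(1) C N(1) ee m by (intro divide_right_mono add_left_mono mult_left_mono mult_nonneg_nonneg) auto
      also have "\<dots> = Q * e * e2 / m ^ (2 * k)"
        unfolding Q_def by (simp add: algebra_simps)
      also have "\<dots> \<le> Q * e * e2 / (real d / real (8 * r)) ^ (2 * k)"
        using dm r d Q0 ee by (intro divide_left_mono power_mono mult_nonneg_nonneg)
          (auto simp: field_simps m)
      also have "\<dots> = (Q * real (8 * r) ^ (2 * k)) * e / (\<epsilon> * real d) ^ (2 * k)"
        unfolding e2_def using \<epsilon>(1) d r
        by (simp only: power_mult_distrib power_divide power_one) simp
      also have "\<dots> \<le> A * e / (\<epsilon> * real d) ^ (2 * k)"
        unfolding A_def Q_def[symmetric] using ee \<epsilon>(1)
        by (intro divide_right_mono mult_right_mono) auto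
      finally show ?thesis .
    qed
    finally show "\<exists>P. poly_fun d P \<and>
      (LINT y|lborel. indicator X y * f y * (mol \<epsilon> (x - y) * w y - P y)\<^sup>2)
        \<le> A * (1 / \<epsilon>) ^ CARD('n) / (\<epsilon> * real d) ^ (2 * k)"
      using P unfolding u_def e_def by blast
  qed
qed

text \<open>The condition \<open>d \<ge> 1\<close> reflects that \<open>0 powr a\<close> is 0,
  whereas the intended bound at \<open>d = 0\<close> is infinite. The error splits into
  \<open>H / S - w x\<close>, where only second differences of \<open>1 / f\<close> enter, and
  \<open>E / S\<close>, where only polynomial approximation enters.\<close>

lemma (in bump) g_hat_estimate:
  fixes X K :: "(real^'n) set" and f :: "real^'n \<Rightarrow> real" and k :: nat
  assumes X: "compact X" and f_C2: "Ck_set 2 X f"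
    and m: "0 < m" and f_bounds: "\<And>x. x \<in> X \<Longrightarrow> m \<le> f x \<and> f x \<le> M"
    and sob: "\<And>\<alpha>. length \<alpha> \<le> k \<Longrightarrow> \<exists>v. weak_deriv X \<alpha> (\<lambda>x. 1 / f x) v \<and> L2_on X v"
    and k: "CARD('n) \<le> 2 * k" and K: "compact K" "K \<subseteq> interior X" "K \<noteq> {}"
  shows "\<exists>A>0. \<exists>B>0. \<exists>\<epsilon>0>0. \<forall>x\<in>K. \<forall>d::nat. \<forall>\<epsilon>. d \<ge> 1 \<and> 0 < \<epsilon> \<and> \<epsilon> < \<epsilon>0 \<longrightarrow>
    \<bar>g_hat \<phi> X f d \<epsilon> x - 1 / f x\<bar> \<le> A * (\<epsilon> * real d) powr (- 2 * real k) + B * \<epsilon>\<^sup>2"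
proof -
  obtain F U where U: "open U" "X \<subseteq> U" and F: "Ck_on 2 U F" and Ff: "\<And>x. x \<in> X \<Longrightarrow> F x = f x"
    using f_C2 unfolding Ck_set_def by blast
  have fc: "continuous_on X f"
    using continuous_on_eq[OF continuous_on_subset[OF Ck_on_imp_continuous_on[OF F] U(2)] Ff] .
  have fpos: "0 < f x" if "x \<in> X" for x using f_bounds[OF that] m by linarith
  have gc: "continuous_on (interior X) (\<lambda>x. 1 / f x)"
    using fpos interior_subset[of X]
    by (intro continuous_intros continuous_on_subset[OF fc]) force+
  obtain \<rho> w N where \<rho>: "0 < \<rho>"
    and near: "\<And>x y. x \<in> K \<Longrightarrow> norm (x - y) \<le> \<rho> \<Longrightarrow> y \<in> interior X \<and> w y = 1 / f y"
    and w: "continuous_on UNIV w" "\<And>y. y \<notin> interior X \<Longrightarrow> w y = 0" and N: "0 \<le> N"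
    "\<And>t. (\<integral>\<^sup>+x. ennreal (((fdiff t ^^ k) w x)\<^sup>2) \<partial>lborel) \<le> ennreal (N * norm t ^ (2 * k))"
    by (rule sobolev_cutoff[OF K gc sob, of k]) blast+
  have f0: "0 \<le> f x \<and> f x \<le> M" if "x \<in> X" for x using f_bounds[OF that] m by auto
  obtain A where A: "0 < A" and approx:
    "\<And>x d \<epsilon>. \<lbrakk>x \<in> K; d \<ge> 1; 0 < \<epsilon>; \<epsilon> \<le> \<rho>; \<epsilon> \<le> 1\<rbrakk> \<Longrightarrow> \<exists>P. poly_fun d P \<and>
      (LINT y|lborel. indicator X y * f y * (mol \<epsilon> (x - y) * w y - P y)\<^sup>2)
        \<le> A * (1 / \<epsilon>) ^ CARD('n) / (\<epsilon> * real d) ^ (2 * k)"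
    using polynomial_approximation[OF X fc f0 k w N, of K \<rho>] near by blast
  obtain C where C: "0 \<le> C"
    "\<And>x z. (\<And>s. \<bar>s\<bar> \<le> 1 \<Longrightarrow> x + s *\<^sub>R z \<in> X) \<Longrightarrow> \<bar>F (x + z) - F x\<bar> \<le> C * norm z"
    "\<And>x z. (\<And>s. \<bar>s\<bar> \<le> 1 \<Longrightarrow> x + s *\<^sub>R z \<in> X) \<Longrightarrow> \<bar>F (x + z) + F (x - z) - 2 * F x\<bar> \<le> C * (norm z)\<^sup>2"
    by (rule C2_difference_bounds[OF F U(1) X U(2)]) blast
  define B where "B = C / m\<^sup>2 + 2 * C\<^sup>2 / m ^ 3"
  have B0: "0 \<le> B" unfolding B_def using C(1) m by simp
  define S\<phi> where "S\<phi> = (LINT x|lborel. (\<phi> x)\<^sup>2)"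
  have S\<phi>: "0 < S\<phi>" unfolding S\<phi>_def by (rule phi_square_integral_pos)
  let ?V = "{u \<in> borel_measurable lebesgue. continuous_on X u} :: (real^'n \<Rightarrow> real) set"
  have fX0: "0 \<le> f x" if "x \<in> X" for x using f0[OF that] by simp
  have L2: "L2_functions (mu_meas X f) ?V" by (rule L2_functions_mu_meas(1)[OF X fc fX0])
  have cV: "u \<in> ?V" if "continuous_on UNIV u" for u
    using borel_measurable_continuous_onI[OF that] continuous_on_subset[OF that]
    by (auto intro: measurable_completion)
  have mu_integral: "(LINT y|mu_meas X f. u y) = (LINT y|lborel. indicator X y * f y * u y)"
    if u: "continuous_on UNIV u" for u
  proof -
    have "(\<lambda>y. indicator X y * f y) \<in> borel_measurable lborel"
      using borel_measurable_integrable[OF borel_integrable_compact[OF X fc]] by simp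
    moreover have "u \<in> borel_measurable lborel" using borel_measurable_continuous_onI[OF u] by simp
    ultimately have "(\<lambda>y. indicator X y * f y * u y) \<in> borel_measurable lborel"
      by (rule borel_measurable_times)
    from integral_completion[OF this] show ?thesis using L2_functions_mu_meas(2)[OF X fc fX0, of u] cV[OF u] by simp
  qed
  \<comment> \<open>\<open>\<rho>\<close> keeps the bump inside the region where
    \<open>w = 1 / f\<close>; the bound 1 allows powers of \<open>1 / \<epsilon>\<close> to be
    compared.\<close>
  define \<epsilon>0 where "\<epsilon>0 = min \<rho> 1"
  have est: "\<bar>g_hat \<phi> X f d \<epsilon> x - 1 / f x\<bar> \<le> A / S\<phi> * (\<epsilon> * real d) powr (- 2 * real k) + (B / 2 + 1) * \<epsilon>\<^sup>2"
    if x: "x \<in> K" and d: "d \<ge> 1" and \<epsilon>: "0 < \<epsilon>" "\<epsilon> < \<epsilon>0" for x d \<epsilon>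
  proof -
    have \<epsilon>\<rho>: "\<epsilon> \<le> \<rho>" "\<epsilon> \<le> 1" using \<epsilon>(2) unfolding \<epsilon>0_def by auto
    have wx: "w x = 1 / f x" using near[OF x, of x] \<rho> by simp
    define u where "u y = mol \<epsilon> (x - y)" for y
    have uc: "continuous_on UNIV u"
      unfolding u_def by (intro continuous_on_compose2[OF mol_continuous[of UNIV]] continuous_intros) auto
    have unz: "y \<in> interior X \<and> w y = 1 / f y" if "u y \<noteq> 0" for y
    proof -
      have "norm (x - y) < \<epsilon>" using that mol_zero[OF \<epsilon>(1), of "x - y"] unfolding u_def by force
      then show ?thesis using near[OF x, of y] \<epsilon>\<rho>(1) by simp
    qed
    define h where "h y = u y * w y" for y
    have hc: "continuous_on UNIV h" unfolding h_def[abs_def] by (intro continuous_intros uc w(1))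
    \<comment> \<open>Off the support of the bump both sides are 0, whatever the value of
      \<open>f\<close> there; on it \<open>w\<close> is \<open>1 / f\<close>.\<close>
    have h_eq: "(\<lambda>y. mollifier \<phi> x \<epsilon> y / f y) = h"
    proof
      fix y show "mollifier \<phi> x \<epsilon> y / f y = h y"
        using unz[of y] unfolding mollifier_eq_mol h_def u_def by (cases "mol \<epsilon> (x - y) = 0") auto
    qed
    define S where "S = (LINT y|lborel. (mol \<epsilon> y)\<^sup>2)"
    have S_eq: "S = (1 / \<epsilon>) ^ CARD('n) * S\<phi>"
      unfolding S_def S\<phi>_def by (rule mol_square_integral[OF \<epsilon>(1)])
    have S: "S > 0" unfolding S_eq using \<epsilon>(1) S\<phi> by simp
    have den: "(LINT y|lebesgue. (mollifier \<phi> x \<epsilon> y)\<^sup>2) = S"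
    proof -
      have "(LINT y|lebesgue. (mollifier \<phi> x \<epsilon> y)\<^sup>2) = (LINT y|lborel. (mol \<epsilon> (x - y))\<^sup>2)"
        unfolding mollifier_eq_mol by (rule integral_completion) measurable
      also have "\<dots> = S"
        using integral_lborel_affine[of "\<lambda>y. (mol \<epsilon> y)\<^sup>2" "-1" x] unfolding S_def by simp
      finally show ?thesis .
    qed
    have pV: "p \<in> ?V" if "poly_fun d p" for p
      by (rule cV[OF poly_fun_continuous_on[OF that]])
    have "\<exists>p. poly_fun d p \<and>
      proj_norm2 (mu_meas X f) d h = (LINT y|mu_meas X f. (h y)\<^sup>2) - (LINT y|mu_meas X f. (h y - p y)\<^sup>2) \<and>
      (\<forall>q. poly_fun d q \<longrightarrow> (LINT y|mu_meas X f. (h y - p y)\<^sup>2) \<le> (LINT y|mu_meas X f. (h y - q y)\<^sup>2))"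
      by (rule proj_norm2_properties[OF L2 _ cV[OF hc]]) (rule pV)
    then obtain p where p': "poly_fun d p \<and>
      proj_norm2 (mu_meas X f) d h = (LINT y|mu_meas X f. (h y)\<^sup>2) - (LINT y|mu_meas X f. (h y - p y)\<^sup>2) \<and>
      (\<forall>q. poly_fun d q \<longrightarrow> (LINT y|mu_meas X f. (h y - p y)\<^sup>2) \<le> (LINT y|mu_meas X f. (h y - q y)\<^sup>2))"
      by (elim exE)
    note p = conjunct1[OF p'] conjunct1[OF conjunct2[OF p']] conjunct2[OF conjunct2[OF p']]
    define E where "E = (LINT y|mu_meas X f. (h y - p y)\<^sup>2)"
    have E0: "0 \<le> E" unfolding E_def by simp
    obtain P where P: "poly_fun d P"
      "(LINT y|lborel. indicator X y * f y * (mol \<epsilon> (x - y) * w y - P y)\<^sup>2)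
        \<le> A * (1 / \<epsilon>) ^ CARD('n) / (\<epsilon> * real d) ^ (2 * k)"
      using approx[OF x d \<epsilon>(1) \<epsilon>\<rho>] by blast
    have "E \<le> (LINT y|mu_meas X f. (h y - P y)\<^sup>2)" unfolding E_def by (rule p(3)[rule_format, OF P(1)])
    also have "\<dots> = (LINT y|lborel. indicator X y * f y * (h y - P y)\<^sup>2)"
      by (intro mu_integral continuous_intros hc poly_fun_continuous_on[OF P(1)])
    also have "\<dots> \<le> A * (1 / \<epsilon>) ^ CARD('n) / (\<epsilon> * real d) ^ (2 * k)"
      using P(2) unfolding h_def u_def .
    finally have E: "E \<le> A * (1 / \<epsilon>) ^ CARD('n) / (\<epsilon> * real d) ^ (2 * k)" .
    have "E / S \<le> (A * (1 / \<epsilon>) ^ CARD('n) / (\<epsilon> * real d) ^ (2 * k)) / S"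
      using E S by (intro divide_right_mono) auto
    \<comment> \<open>The power \<open>(1 / \<epsilon>) ^ CARD('n)\<close> of the approximation
      error cancels against the one in \<open>S\<close>, so only powers of
      \<open>\<epsilon> * d\<close> are left.\<close>
    also have "\<dots> = A / S\<phi> * (1 / (\<epsilon> * real d) ^ (2 * k))"
      unfolding S_eq using \<epsilon>(1) S\<phi> by (simp add: field_simps)
    also have "1 / (\<epsilon> * real d) ^ (2 * k) = (\<epsilon> * real d) powr (- 2 * real k)"
    proof -
      have "0 < \<epsilon> * real d" using \<epsilon>(1) d by simp
      then have "(\<epsilon> * real d) powr (- real (2 * k)) = 1 / (\<epsilon> * real d) ^ (2 * k)"
        by (simp only: powr_minus powr_realpow inverse_eq_divide)
      then show ?thesis by simp
    qed
    finally have ES: "E / S \<le> A / S\<phi> * (\<epsilon> * real d) powr (- 2 * real k)" .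
    define H where "H = (LINT y|mu_meas X f. (h y)\<^sup>2)"
    have "H = (LINT y|lborel. indicator X y * f y * (h y)\<^sup>2)"
      unfolding H_def by (intro mu_integral continuous_intros hc)
    \<comment> \<open>On the support of the bump, \<open>f * (u / f)^2 = u^2 / f\<close>: the
      density turns the squared norm into a weighted sum of values of \<open>1 / f\<close>.\<close>
    also have "\<dots> = (LINT y|lborel. (mol \<epsilon> (x - y))\<^sup>2 * w y)"
    proof (rule Bochner_Integration.integral_cong[OF refl])
      fix y
      show "indicator X y * f y * (h y)\<^sup>2 = (mol \<epsilon> (x - y))\<^sup>2 * w y"
      proof (cases "u y = 0")
        case True
        then show ?thesis unfolding h_def u_def by simp
      next
        case False
        then have yX: "y \<in> X" and wy: "w y = 1 / f y" using unz interior_subset[of X] by auto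
        then show ?thesis using fpos[OF yX] unfolding h_def u_def wy by (simp add: power2_eq_square)
      qed
    qed
    finally have "\<bar>H - w x * S\<bar> \<le> B / 2 * \<epsilon>\<^sup>2 * S"
      unfolding S_def
    proof (simp only:, intro weighted_average_bound[OF \<epsilon>(1) w(1)])
      fix z :: "real^'n" assume z: "norm z < \<epsilon>"
      have in_ball: "x + s *\<^sub>R z \<in> interior X \<and> w (x + s *\<^sub>R z) = 1 / f (x + s *\<^sub>R z)" if "\<bar>s\<bar> \<le> 1" for s
      proof (rule near[OF x])
        have "norm (x - (x + s *\<^sub>R z)) = \<bar>s\<bar> * norm z" by simp
        also have "\<dots> \<le> 1 * norm z" using that by (intro mult_right_mono) auto
        finally show "norm (x - (x + s *\<^sub>R z)) \<le> \<rho>" using z \<epsilon>\<rho>(1) by simp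
      qed
      then have seg: "\<And>s. \<bar>s\<bar> \<le> 1 \<Longrightarrow> x + s *\<^sub>R z \<in> X" using interior_subset by blast
      have seg': "x + s *\<^sub>R (- z) \<in> X" if "\<bar>s\<bar> \<le> 1" for s using seg[of "- s"] that by simp
      have pts: "x \<in> X" "x + z \<in> X" "x - z \<in> X" using seg[of 0] seg[of 1] seg[of "-1"] by auto
      have ws: "w (x + z) = 1 / f (x + z)" "w (x - z) = 1 / f (x - z)"
        using in_ball[of 1] in_ball[of "-1"] by auto
      have "\<bar>1 / f (x + z) + 1 / f (x - z) - 2 / f x\<bar> \<le> B * (norm z)\<^sup>2"
        unfolding B_def
      proof (rule reciprocal_second_difference)
        show "0 < m" "m \<le> f (x + z)" "m \<le> f (x - z)" "m \<le> f x" "0 \<le> norm z" "0 \<le> C"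
          using m f_bounds pts C(1) by auto
        show "\<bar>f (x + z) - f x\<bar> \<le> C * norm z" using C(2)[OF seg] pts by (simp add: Ff)
        show "\<bar>f (x - z) - f x\<bar> \<le> C * norm z" using C(2)[OF seg'] pts by (simp add: Ff)
        show "\<bar>f (x + z) + f (x - z) - 2 * f x\<bar> \<le> C * (norm z)\<^sup>2" using C(3)[OF seg] pts by (simp add: Ff)
      qed
      also have "\<dots> \<le> B * \<epsilon>\<^sup>2" using z B0 by (intro mult_left_mono power_mono) auto
      finally show "\<bar>w (x + z) + w (x - z) - 2 * w x\<bar> \<le> B * \<epsilon>\<^sup>2" unfolding ws wx by simp
    qed
    then have HS: "\<bar>H / S - w x\<bar> \<le> B / 2 * \<epsilon>\<^sup>2"
    proof -
      assume le: "\<bar>H - w x * S\<bar> \<le> B / 2 * \<epsilon>\<^sup>2 * S"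
      have "H / S - w x = (H - w x * S) / S" using S by (simp add: field_simps)
      then have "\<bar>H / S - w x\<bar> = \<bar>H - w x * S\<bar> / S" using S by simp
      also have "\<dots> \<le> B / 2 * \<epsilon>\<^sup>2" using le S by (simp add: field_simps)
      finally show ?thesis .
    qed
    have "g_hat \<phi> X f d \<epsilon> x = H / S - E / S"
      unfolding g_hat_def h_eq den p(2) H_def E_def by (rule diff_divide_distrib)
    then have "\<bar>g_hat \<phi> X f d \<epsilon> x - 1 / f x\<bar> \<le> \<bar>H / S - w x\<bar> + E / S"
      using divide_nonneg_pos[OF E0 S] unfolding wx by linarith
    also have "\<dots> \<le> B / 2 * \<epsilon>\<^sup>2 + A / S\<phi> * (\<epsilon> * real d) powr (- 2 * real k)"
      by (rule add_mono[OF HS ES])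
    also have "\<dots> \<le> A / S\<phi> * (\<epsilon> * real d) powr (- 2 * real k) + (B / 2 + 1) * \<epsilon>\<^sup>2"
      by (simp add: distrib_right)
    finally show ?thesis .
  qed
  \<comment> \<open>\<open>B\<close> may be 0, which is why 1 was added to its half.\<close>
  have pos: "A / S\<phi> > 0" "B / 2 + 1 > 0" "\<epsilon>0 > 0"
    using A S\<phi> B0 \<rho> unfolding \<epsilon>0_def by auto
  show ?thesis
  proof (rule exI[of _ "A / S\<phi>"], rule conjI[OF pos(1)], rule exI[of _ "B / 2 + 1"],
      rule conjI[OF pos(2)], rule exI[of _ \<epsilon>0], rule conjI[OF pos(3)], intro ballI allI impI)
    fix x and d :: nat and \<epsilon> :: real assume "x \<in> K" "d \<ge> 1 \<and> 0 < \<epsilon> \<and> \<epsilon> < \<epsilon>0"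
    then show "\<bar>g_hat \<phi> X f d \<epsilon> x - 1 / f x\<bar>
        \<le> A / S\<phi> * (\<epsilon> * real d) powr (- 2 * real k) + (B / 2 + 1) * \<epsilon>\<^sup>2"
      by (elim conjE) (rule est)
  qed
qed

theorem theorem4p9:
  fixes \<phi> :: "real^'n \<Rightarrow> real" and X :: "(real^'n) set" and f :: "real^'n \<Rightarrow> real"
    and m M s :: real and k :: nat
  assumes phi_nonneg: "\<forall>y. 0 \<le> \<phi> y"
    and phi_smooth: "smooth_fun \<phi>"
    and phi_int: "integrable lebesgue \<phi>" "(LINT y|lebesgue. \<phi> y) = 1"
    and phi_supp: "fsupp \<phi> \<subseteq> ball 0 1"
    and phi_sym: "\<forall>y. \<phi> (- y) = \<phi> y"
    and X: "regular_lipschitz_domain X"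
    and f_C2: "Ck_set 2 X f"
    and m_pos: "0 < m" and f_bounds: "\<forall>x\<in>X. m \<le> f x \<and> f x \<le> M"
    and s_gt: "s > real CARD('n) / 2"
    and f_sob: "sobolev_H s X f" and finv_sob: "sobolev_H s X (\<lambda>x. 1 / f x)"
    and k: "1 \<le> k" "real k \<le> s" "real k > real CARD('n) / 2"
  shows "(\<forall>K. compact K \<and> K \<subseteq> interior X \<longrightarrow>
           (\<exists>A>0. \<exists>B>0. \<exists>\<epsilon>0>0. \<forall>x\<in>K. \<forall>d::nat. \<forall>\<epsilon>. d \<ge> 1 \<and> 0 < \<epsilon> \<and> \<epsilon> < \<epsilon>0 \<longrightarrow>
              \<bar>g_hat \<phi> X f d \<epsilon> x - 1 / f x\<bar> \<le> A * (\<epsilon> * real d) powr (- 2 * real k) + B * \<epsilon>\<^sup>2))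
       \<and> (\<forall>K. compact K \<and> K \<subseteq> interior X \<longrightarrow>
           (\<exists>C D. \<forall>d::nat. d \<ge> D \<longrightarrow> (\<forall>x\<in>K.
              \<bar>g_hat \<phi> X f d (real d powr (- real k / (real k + 1))) x - 1 / f x\<bar>
                \<le> C * real d powr (- 2 * real k / (real k + 1)))))"
proof -
  have \<phi>m: "\<phi> \<in> borel_measurable borel"
    by (rule borel_measurable_continuous_onI[OF smooth_fun_continuous_on[OF phi_smooth]])
  interpret bump \<phi>
  proof
    show "0 \<le> \<phi> x" "\<phi> (- x) = \<phi> x" for x using phi_nonneg phi_sym by auto
    show "smooth_fun \<phi>" by (rule phi_smooth)
    show "\<phi> x = 0" if "1 \<le> norm x" for x
    proof (rule ccontr)
      assume "\<phi> x \<noteq> 0"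
      then have "x \<in> fsupp \<phi>" unfolding fsupp_def
        using closure_subset[of "{x. \<phi> x \<noteq> 0}"] by auto
      then show False using phi_supp that by auto
    qed
    show "(LINT x|lborel. \<phi> x) = 1"
      using integral_completion[of \<phi> lborel] \<phi>m phi_int(2) by simp
  qed
  have cX: "compact X" using X unfolding regular_lipschitz_domain_def by blast
  have fb: "m \<le> f x \<and> f x \<le> M" if "x \<in> X" for x using f_bounds that by blast
  have sob: "\<exists>v. weak_deriv X \<alpha> (\<lambda>x. 1 / f x) v \<and> L2_on X v" if "length \<alpha> \<le> k" for \<alpha>
  proof -
    \<comment> \<open>As \<open>k\<close> is an integer, \<open>k \<le> s\<close> puts every order
      up to \<open>k\<close> within the integer part of \<open>s\<close>.\<close>
    have "k \<le> nat \<lfloor>s\<rfloor>" using k(2) by (simp add: le_nat_floor)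
    then have "length \<alpha> \<le> nat \<lfloor>s\<rfloor>" using that by simp
    then show ?thesis using finv_sob unfolding sobolev_H_def Let_def by blast
  qed
  have kn: "CARD('n) \<le> 2 * k" using k(3) by linarith
  have main: "\<exists>A>0. \<exists>B>0. \<exists>\<epsilon>0>0. \<forall>x\<in>K. \<forall>d::nat. \<forall>\<epsilon>. d \<ge> 1 \<and> 0 < \<epsilon> \<and> \<epsilon> < \<epsilon>0 \<longrightarrow>
      \<bar>g_hat \<phi> X f d \<epsilon> x - 1 / f x\<bar> \<le> A * (\<epsilon> * real d) powr (- 2 * real k) + B * \<epsilon>\<^sup>2"
    if "compact K" "K \<subseteq> interior X" for K
  \<comment> \<open>The cutoffs are built from distances to \<open>K\<close>, hence for nonempty
    \<open>K\<close>; for the empty set any constants do.\<close>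
  proof (cases "K = {}")
    case True
    then show ?thesis by (auto intro: exI[of _ 1])
  next
    case False
    show ?thesis by (rule g_hat_estimate[OF cX f_C2 m_pos fb sob kn that False])
  qed
  have rate: "\<exists>C D. \<forall>d::nat. d \<ge> D \<longrightarrow> (\<forall>x\<in>K.
      \<bar>g_hat \<phi> X f d (real d powr (- real k / (real k + 1))) x - 1 / f x\<bar>
        \<le> C * real d powr (- 2 * real k / (real k + 1)))"
    if K: "compact K" "K \<subseteq> interior X" for K
  proof -
    obtain A B \<epsilon>0 where "\<epsilon>0 > 0" and est: "\<And>x d \<epsilon>. \<lbrakk>x \<in> K; d \<ge> 1; 0 < \<epsilon>; \<epsilon> < \<epsilon>0\<rbrakk> \<Longrightarrow>
        \<bar>g_hat \<phi> X f d \<epsilon> x - 1 / f x\<bar> \<le> A * (\<epsilon> * real d) powr (- 2 * real k) + B * \<epsilon>\<^sup>2"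
      using main[OF K] by blast
    \<comment> \<open>Since \<open>1 - b = 1 / (k + 1)\<close>, the choice \<epsilon> = d^(-b) makes
      (\<epsilon> d)^(-2 k) and \<epsilon>^2 both equal to d^(-2 b), so the two error terms
      balance.\<close>
    define b where "b = real k / (real k + 1)"
    have b: "b > 0" unfolding b_def using k(1) by simp
    have "((\<lambda>d. real d powr (- b)) \<longlongrightarrow> 0) sequentially"
      by (rule tendsto_neg_powr[OF _ filterlim_real_sequentially]) (use b in simp)
    then have "eventually (\<lambda>d. real d powr (- b) < \<epsilon>0) sequentially"
      using \<open>\<epsilon>0 > 0\<close> by (rule order_tendstoD(2))
    \<comment> \<open>From \<open>D0\<close> on the chosen width is below
      \<open>\<epsilon>0\<close>; this threshold does not involve \<open>x\<close>, so the rate is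
      uniform on \<open>K\<close>.\<close>
    then obtain D0 where D0: "\<And>d. d \<ge> D0 \<Longrightarrow> real d powr (- b) < \<epsilon>0"
      unfolding eventually_sequentially by blast
    have "\<bar>g_hat \<phi> X f d (real d powr (- real k / (real k + 1))) x - 1 / f x\<bar>
        \<le> (A + B) * real d powr (- 2 * real k / (real k + 1))"
      if d: "d \<ge> max 1 D0" and x: "x \<in> K" for d x
    proof -
      have d0: "0 < real d" "d \<ge> 1" "d \<ge> D0" using d by auto
      define \<epsilon> where "\<epsilon> = real d powr (- b)"
      have \<epsilon>: "0 < \<epsilon>" "\<epsilon> < \<epsilon>0" unfolding \<epsilon>_def using d0 D0 by auto
      have "\<epsilon> * real d = real d powr (- b) * real d powr 1" unfolding \<epsilon>_def using d0 by simp
      also have "\<dots> = real d powr (1 - b)" unfolding powr_add[symmetric] by simp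
      finally have "(\<epsilon> * real d) powr (- 2 * real k) = real d powr ((1 - b) * (- 2 * real k))"
        by (simp only: powr_powr)
      also have "(1 - b) * (- 2 * real k) = - 2 * b" unfolding b_def by (simp add: field_simps)
      finally have e1: "(\<epsilon> * real d) powr (- 2 * real k) = real d powr (- 2 * b)" .
      have e2: "\<epsilon>\<^sup>2 = real d powr (- 2 * b)"
        unfolding \<epsilon>_def power2_eq_square powr_add[symmetric] by simp
      have le: "\<bar>g_hat \<phi> X f d \<epsilon> x - 1 / f x\<bar> \<le> A * real d powr (- 2 * b) + B * real d powr (- 2 * b)"
        using est[OF x d0(2) \<epsilon>] unfolding e1 e2 .
      have eqs: "- real k / (real k + 1) = - b" "- 2 * real k / (real k + 1) = - 2 * b"
        unfolding b_def by simp_all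
      show ?thesis using le unfolding eqs \<epsilon>_def distrib_right .
    qed
    then show ?thesis by blast
  qed
  show ?thesis
    by (intro conjI allI impI; elim conjE) (rule main rate; assumption)+
qed

end
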